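(* Assume $\Phi$ has Property 5.2 (as defined in the context), witnessed by $\sigma^*$, $\mathcal{L}^*$, $r$, $\Phi^*$, and structures $\mathcal{A}^*$. Then there is an algorithm that solves the Exact Learning with Precomputation problem for $\Phi$ and $\Phi^*$, using only local access to the structure $\mathcal{A}^*$ associated with the $(\sigma,\mathbf{W})$-structure $\mathcal{A}$, in time $f_{\Phi^*}(\mathcal{A}^* )\cdot(\log n+d+t)^{O(1)}$, where $t$ is the number of training examples, $n$ and $d$ are the size and the degree of $\mathcal{A}^*$, and $f_{\Phi^*}(\mathcal{A}^* )$ is an upper bound on the time complexity of model checking formulas of $\Phi^*$ on $\mathcal{A}^*$.
   Context: Weighted structures. A signature $\sigma$ is a finite set of relation symbols with arities in $\mathbb{N}$. Let $\mathcal{S}$ be a collection of rings and/or abelian groups and $\mathbf{W}$ a finite set of weight symbols $\mathtt{w}$ with arity $\ge1$ and type in $\mathcal{S}$. A $(\sigma,\mathbf{W})$-structure $\mathcal{A}$ has a finite non-empty universe $A$ (also written $U(\mathcal{A})$), relations $R^{\mathcal{A}}\subseteq A^{\mathrm{ar}(R)}$, and functions $\mathtt{w}^{\mathcal{A}}:A^{\mathrm{ar}(\mathtt{w})}\to\mathrm{type}(\mathtt{w})$ such that $\mathtt{w}^{\mathcal{A}}(a_1,\ldots,a_k)\ne0$ implies $k=1$, or $a_1=\cdots=a_k$, or some tuple of some $R^{\mathcal{A}}$ contains all $a_i$. Its size is $|A|$; its Gaifman graph has vertex set $A$ and edges between distinct elements co-occurring in some relation tuple; the degree is the maximal vertex degree;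 $\mathrm{dist}^{\mathcal{A}}$ is the graph distance (minimum over entries for tuples); $\mathcal{N}_r^{\mathcal{A}}(\bar{a})$ is the induced substructure on $N_r^{\mathcal{A}}(\bar{a})=\{b:\mathrm{dist}^{\mathcal{A}}(\bar{a},b)\le r\}$. Learning setting. Fix $k,\ell\in\mathbb{N}$, a logic $\mathcal{L}$ (a set of formulas evaluable on weighted structures), a signature $\sigma$, and a set $\Phi\subseteq\mathcal{L}[\sigma,\mathcal{S},\mathbf{W}]$ of formulas $\varphi(\bar{x},\bar{y})$ with $|\bar{x}|=k$, $|\bar{y}|=\ell$. For a structure $\mathcal{A}$ and such a set $\Phi$, the concept class is $\mathcal{C}(\Phi,\mathcal{A},k,\ell):=\{\bar{a}\mapsto[\![\varphi(\bar{a},\bar{v})]\!]^{\mathcal{A}}:\varphi\in\Phi,\bar{v}\in A^\ell\}$, where $[\![\varphi(\bar{a},\bar{v})]\!]^{\mathcal{A}}=1$ iff $\mathcal{A}\models\varphi[\bar{a},\bar{v}]$, else $0$ (maps $A^k\to\{0,1\}$). Local access to a structure means that an algorithm may interact with it only via the queries "Is $\bar{a}\in R^{\mathcal{A}}$?", "Return $\mathtt{w}^{\mathcal{A}}(\bar{a})$" and "Return the list of all neighbours of $a$ in the Gaifman graph". A formula $\varphi(\bar{z})$ is $r$-local if $\mathcal{A}\models\varphi[\bar{a}]$ iff $\mathcal{N}_r^{\mathcal{A}}(\bar{a})\models\varphi[\bar{a}]$ for all structures $\mathcal{A}$ and tuples $\bar{a}$. Feferman-Vaught decomposition: for a signature $\tau$,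 let $X,Y$ be new unary symbols; for $(\tau,\mathbf{W})$-structures $\mathcal{A},\mathcal{B}$ with disjoint universes, $\mathcal{A}\oplus\mathcal{B}$ has universe $A\cup B$, $X=A$, $Y=B$, relations the unions, and weights $\mathtt{w}^{\mathcal{A}}$ on tuples from $A$, $\mathtt{w}^{\mathcal{B}}$ on tuples from $B$, $0$ otherwise. A Feferman-Vaught decomposition of $\varphi$ in a set $\mathcal{L}'$ w.r.t. a partition $(\bar{z};\bar{z}')$ of its free variables is a finite non-empty set $\Delta$ of pairs $(\alpha,\beta)\in\mathcal{L}'\times\mathcal{L}'$, $\mathrm{free}(\alpha)\subseteq\bar{z}$, $\mathrm{free}(\beta)\subseteq\bar{z}'$, such that for all such $\mathcal{A},\mathcal{B}$ and tuples $\bar{a}$ from $A$, $\bar{b}$ from $B$: $\mathcal{A}\oplus\mathcal{B}\models\varphi[\bar{a},\bar{b}]$ iff some $(\alpha,\beta)\in\Delta$ has $\mathcal{A}\models\alpha[\bar{a}]$ and $\mathcal{B}\models\beta[\bar{b}]$. Property 5.2 (of $\Phi$): there are a signature $\sigma^*$, a logic $\mathcal{L}^*$, an $r\in\mathbb{N}$ and a finite set of $r$-local formulas $\Phi^*\subseteq\mathcal{L}^*[\sigma^*,\mathcal{S},\mathbf{W}]$ such that (1) for every $(\sigma,\mathbf{W})$-structure $\mathcal{A}$ there is a $(\sigma^*,\mathbf{W})$-structure $\mathcal{A}^*$ with $U(\mathcal{A}^* )=U(\mathcal{A})$ such that for every $\varphi(\bar{x},\bar{y})\in\Phi$ there is $\varphi^*(\bar{x},\bar{y})\in\Phi^*$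 with $\mathcal{A}\models\varphi[\bar{a},\bar{b}]\iff\mathcal{A}^*\models\varphi^*[\bar{a},\bar{b}]$ for all $\bar{a}\in A^k,\bar{b}\in A^\ell$; (2) every $\varphi^*\in\Phi^*$ has, for every partition $(\bar{z};\bar{z}')$ of its free variables, a Feferman-Vaught decomposition in $\Phi^*$ w.r.t. $(\bar{z};\bar{z}')$; (3) for all $\varphi^*_1,\varphi^*_2\in\Phi^*$, $\Phi^*$ contains formulas equivalent to $\neg\varphi^*_1$ and to $(\varphi^*_1\vee\varphi^*_2)$. Exact Learning with Precomputation (Problem 5.1): given a training sequence $T=((\bar{a}_1,b_1),\ldots,(\bar{a}_t,b_t))\in(A^k\times\{0,1\})^t$ and, for a $(\sigma,\mathbf{W})$-structure $\mathcal{A}$, local access to the associated $(\sigma^*,\mathbf{W})$-structure $\mathcal{A}^*$ (with $U(\mathcal{A}^* )=U(\mathcal{A})$ and $\mathcal{C}(\Phi,\mathcal{A},k,\ell)\subseteq\mathcal{C}(\Phi^*,\mathcal{A}^*,k,\ell)$), return $\varphi^*\in\Phi^*$ and $\bar{v}\in A^\ell$ such that the hypothesis $\bar{a}\mapsto[\![\varphi^*(\bar{a},\bar{v})]\!]^{\mathcal{A}^*}$ is consistent with $T$, i.e. maps $\bar{a}_i$ to $b_i$ for every $i\in[t]$; the algorithm may reject if no classifier in $\mathcal{C}(\Phi,\mathcal{A},k,\ell)$ is consistent with $T$. *)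

theory Defs
  imports Complex_Main "HOL-Algebra.Ring" "HOL-Library.Extended_Nat" "HOL-Library.Log_Nat"
begin

section \<open>Weighted structures\<close>

text \<open>
  A signature is a finite map from relation symbols to arities.  A set of weight symbols is a
  finite map sending a symbol to its arity and its type, the latter being a member of the
  collection \<open>S\<close>.  An abelian group is represented additively, by a \<open>ring\<close> record whose
  multiplicative part is irrelevant.
\<close>

type_synonym 'r signature = "'r \<rightharpoonup> nat"
type_synonym ('w, 's) weights = "'w \<rightharpoonup> nat \<times> 's ring"

definition signature :: "'r signature \<Rightarrow> bool" where
  "signature \<sigma> \<longleftrightarrow> finite (dom \<sigma>)"

definition weight_types :: "'s ring set \<Rightarrow> bool" where
  "weight_types S \<longleftrightarrow> (\<forall>G\<in>S. ring G \<or> abelian_group G)"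

definition weight_symbols :: "'s ring set \<Rightarrow> ('w, 's) weights \<Rightarrow> bool" where
  "weight_symbols S W \<longleftrightarrow>
     finite (dom W) \<and> (\<forall>w m G. W w = Some (m, G) \<longrightarrow> 1 \<le> m \<and> G \<in> S)"

definition tuples :: "nat \<Rightarrow> 'a set \<Rightarrow> 'a list set" where
  "tuples m A = {t. length t = m \<and> set t \<subseteq> A}"

text \<open>
  Universes are finite sets of natural numbers; as logics are isomorphism invariant (see below),
  this covers all finite structures.
\<close>

record ('r, 'w, 's) wstruct =
  univ :: "nat set"
  rel :: "'r \<Rightarrow> nat list set"
  wt :: "'w \<Rightarrow> nat list \<Rightarrow> 's"

text \<open>
  The typing part of the definition of a structure.  Outside the signature and outside the universe
  the components have a fixed default value.
\<close>

definition prestructure ::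
  "('w, 's) weights \<Rightarrow> 'r signature \<Rightarrow> ('r, 'w, 's) wstruct \<Rightarrow> bool" where
  "prestructure W \<sigma> A \<longleftrightarrow>
     finite (univ A) \<and> univ A \<noteq> {} \<and>
     (\<forall>R. case \<sigma> R of None \<Rightarrow> rel A R = {} | Some m \<Rightarrow> rel A R \<subseteq> tuples m (univ A)) \<and>
     (\<forall>w. case W w of None \<Rightarrow> wt A w = (\<lambda>t. undefined)
        | Some (m, G) \<Rightarrow> (\<forall>t. if t \<in> tuples m (univ A) then wt A w t \<in> carrier G
                              else wt A w t = undefined))"

definition wstructure ::
  "('w, 's) weights \<Rightarrow> 'r signature \<Rightarrow> ('r, 'w, 's) wstruct \<Rightarrow> bool" where
  "wstructure W \<sigma> A \<longleftrightarrow> prestructure W \<sigma> A \<and>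
     (\<forall>w m G t. W w = Some (m, G) \<longrightarrow> t \<in> tuples m (univ A) \<longrightarrow> wt A w t \<noteq> \<zero>\<^bsub>G\<^esub> \<longrightarrow>
        m = 1 \<or> (\<forall>a\<in>set t. \<forall>b\<in>set t. a = b) \<or> (\<exists>R. \<exists>u\<in>rel A R. set t \<subseteq> set u))"

definition gaifman :: "('r, 'w, 's) wstruct \<Rightarrow> (nat \<times> nat) set" where
  "gaifman A = {(a, b). a \<noteq> b \<and> (\<exists>R. \<exists>u\<in>rel A R. a \<in> set u \<and> b \<in> set u)}"

definition degree :: "('r, 'w, 's) wstruct \<Rightarrow> nat" where
  "degree A = Max ((\<lambda>a. card (gaifman A `` {a})) ` univ A)"

definition gdist :: "('r, 'w, 's) wstruct \<Rightarrow> nat \<Rightarrow> nat \<Rightarrow> enat" where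
  "gdist A a b = (INF i \<in> {i. (a, b) \<in> gaifman A ^^ i}. enat i)"

text \<open>For tuples, only the set \<open>Z\<close> of entries matters.\<close>

definition nbh_set :: "('r, 'w, 's) wstruct \<Rightarrow> nat \<Rightarrow> nat set \<Rightarrow> nat set" where
  "nbh_set A r Z = {b \<in> univ A. (INF a\<in>Z. gdist A a b) \<le> enat r}"

text \<open>
  The induced substructure restricts all weights.  It need not be a \<open>wstructure\<close> again: the
  relation tuple that justifies a nonzero weight may leave \<open>B\<close>.
\<close>

definition induced :: "('r, 'w, 's) wstruct \<Rightarrow> nat set \<Rightarrow> ('r, 'w, 's) wstruct" where
  "induced A B = \<lparr>univ = univ A \<inter> B,
     rel = (\<lambda>R. {t \<in> rel A R. set t \<subseteq> B}),
     wt = (\<lambda>w t. if set t \<subseteq> B then wt A w t else undefined)\<rparr>"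

definition nbh :: "('r, 'w, 's) wstruct \<Rightarrow> nat \<Rightarrow> nat set \<Rightarrow> ('r, 'w, 's) wstruct" where
  "nbh A r Z = induced A (nbh_set A r Z)"

definition reduct :: "'r signature \<Rightarrow> ('r, 'w, 's) wstruct \<Rightarrow> ('r, 'w, 's) wstruct" where
  "reduct \<sigma> A = A\<lparr>rel := (\<lambda>R. if R \<in> dom \<sigma> then rel A R else {})\<rparr>"

text \<open>
  The sum of two structures with disjoint universes, over the signature extended by the unary
  symbols \<open>X\<close> and \<open>Y\<close>.
\<close>

definition dsum :: "('w, 's) weights \<Rightarrow> 'r \<Rightarrow> 'r \<Rightarrow>
    ('r, 'w, 's) wstruct \<Rightarrow> ('r, 'w, 's) wstruct \<Rightarrow> ('r, 'w, 's) wstruct" where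
  "dsum W X Y A B = \<lparr>univ = univ A \<union> univ B,
     rel = (\<lambda>R. rel A R \<union> rel B R)
             (X := (\<lambda>a. [a]) ` univ A, Y := (\<lambda>b. [b]) ` univ B),
     wt = (\<lambda>w t. case W w of None \<Rightarrow> undefined
       | Some (m, G) \<Rightarrow>
           if t \<in> tuples m (univ A) then wt A w t
           else if t \<in> tuples m (univ B) then wt B w t
           else if t \<in> tuples m (univ A \<union> univ B) then \<zero>\<^bsub>G\<^esub>
           else undefined)\<rparr>"

definition isomorphism :: "('w, 's) weights \<Rightarrow> (nat \<Rightarrow> nat) \<Rightarrow>
    ('r, 'w, 's) wstruct \<Rightarrow> ('r, 'w, 's) wstruct \<Rightarrow> bool" where
  "isomorphism W h A B \<longleftrightarrow>
     bij_betw h (univ A) (univ B) \<and>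
     (\<forall>R. rel B R = map h ` rel A R) \<and>
     (\<forall>w m G t. W w = Some (m, G) \<longrightarrow> t \<in> tuples m (univ A) \<longrightarrow> wt B w (map h t) = wt A w t)"


section \<open>Logics\<close>

text \<open>
  The weight types and weight symbols are fixed throughout, so \<open>formulas L \<sigma>\<close> stands for
  \<open>L[\<sigma>, S, W]\<close>.  A logic is an arbitrary set of formulas with a satisfaction relation subject to
  the usual laws of abstract logics: the truth value depends only on the values of the free
  variables, on the symbols of the formula's signature, and on the structure up to isomorphism.
  The laws are stated for \<open>prestructure\<close>s since formulas get evaluated in induced substructures.
\<close>

record ('f, 'v, 'r, 'w, 's) logic =
  formulas :: "'r signature \<Rightarrow> 'f set"
  free :: "'f \<Rightarrow> 'v set"
  sat :: "('r, 'w, 's) wstruct \<Rightarrow> 'f \<Rightarrow> ('v \<Rightarrow> nat) \<Rightarrow> bool"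

definition is_logic :: "('w, 's) weights \<Rightarrow> ('f, 'v, 'r, 'w, 's) logic \<Rightarrow> bool" where
  "is_logic W L \<longleftrightarrow>
     (\<forall>\<sigma>. \<forall>\<phi>\<in>formulas L \<sigma>. finite (free L \<phi>)) \<and>
     (\<forall>\<sigma>. \<forall>\<phi>\<in>formulas L \<sigma>. \<forall>A s s'. prestructure W \<sigma> A \<longrightarrow> s ` free L \<phi> \<subseteq> univ A \<longrightarrow>
        (\<forall>v\<in>free L \<phi>. s v = s' v) \<longrightarrow> sat L A \<phi> s = sat L A \<phi> s') \<and>
     (\<forall>\<sigma> \<sigma>'. \<forall>\<phi>\<in>formulas L \<sigma>. \<forall>A s. \<sigma> \<subseteq>\<^sub>m \<sigma>' \<longrightarrow> prestructure W \<sigma>' A \<longrightarrow>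
        s ` free L \<phi> \<subseteq> univ A \<longrightarrow> sat L A \<phi> s = sat L (reduct \<sigma> A) \<phi> s) \<and>
     (\<forall>\<sigma>. \<forall>\<phi>\<in>formulas L \<sigma>. \<forall>A B h s. prestructure W \<sigma> A \<longrightarrow> prestructure W \<sigma> B \<longrightarrow>
        isomorphism W h A B \<longrightarrow> s ` free L \<phi> \<subseteq> univ A \<longrightarrow>
        sat L A \<phi> s = sat L B \<phi> (h \<circ> s))"

text \<open>Satisfaction by a tuple of elements, for a list of distinct variables.\<close>

definition models :: "('f, 'v, 'r, 'w, 's) logic \<Rightarrow> ('r, 'w, 's) wstruct \<Rightarrow> 'f \<Rightarrow>
    'v list \<Rightarrow> nat list \<Rightarrow> bool" where
  "models L A \<phi> vs cs = sat L A \<phi> (\<lambda>v. the (map_of (zip vs cs) v))"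

definition formulas_in :: "('f, 'v, 'r, 'w, 's) logic \<Rightarrow> 'r signature \<Rightarrow> 'v list \<Rightarrow>
    'f set \<Rightarrow> bool" where
  "formulas_in L \<sigma> vs \<Phi> \<longleftrightarrow> \<Phi> \<subseteq> formulas L \<sigma> \<and> (\<forall>\<phi>\<in>\<Phi>. free L \<phi> \<subseteq> set vs)"

definition concept_class :: "('f, 'v, 'r, 'w, 's) logic \<Rightarrow> 'f set \<Rightarrow>
    ('r, 'w, 's) wstruct \<Rightarrow> 'v list \<Rightarrow> 'v list \<Rightarrow> (nat list \<Rightarrow> bool) set" where
  "concept_class L \<Phi> A xs ys =
     {(\<lambda>as. models L A \<phi> (xs @ ys) (as @ vs)) | \<phi> vs.
        \<phi> \<in> \<Phi> \<and> vs \<in> tuples (length ys) (univ A)}"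

text \<open>
  Sentences have no neighbourhood to speak of (universes are nonempty), so locality only constrains
  formulas with at least one free variable.
\<close>

definition r_local :: "('w, 's) weights \<Rightarrow> ('f, 'v, 'r, 'w, 's) logic \<Rightarrow> 'r signature \<Rightarrow>
    nat \<Rightarrow> 'f \<Rightarrow> bool" where
  "r_local W L \<sigma> r \<phi> \<longleftrightarrow>
     (\<forall>A s. wstructure W \<sigma> A \<longrightarrow> s ` free L \<phi> \<subseteq> univ A \<longrightarrow> free L \<phi> \<noteq> {} \<longrightarrow>
        sat L A \<phi> s = sat L (nbh A r (s ` free L \<phi>)) \<phi> s)"

definition fv_decomposition :: "('w, 's) weights \<Rightarrow> 'r \<Rightarrow> 'r \<Rightarrow>
    ('f, 'v, 'r, 'w, 's) logic \<Rightarrow> 'r signature \<Rightarrow> 'f set \<Rightarrow> 'f \<Rightarrow> 'v set \<Rightarrow> 'v set \<Rightarrow>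
    ('f \<times> 'f) set \<Rightarrow> bool" where
  "fv_decomposition W X Y L \<tau> L' \<phi> z z' \<Delta> \<longleftrightarrow>
     finite \<Delta> \<and> \<Delta> \<noteq> {} \<and> \<Delta> \<subseteq> L' \<times> L' \<and>
     (\<forall>(\<alpha>, \<beta>)\<in>\<Delta>. free L \<alpha> \<subseteq> z \<and> free L \<beta> \<subseteq> z') \<and>
     (\<forall>A B s. wstructure W \<tau> A \<longrightarrow> wstructure W \<tau> B \<longrightarrow> univ A \<inter> univ B = {} \<longrightarrow>
        s ` z \<subseteq> univ A \<longrightarrow> s ` z' \<subseteq> univ B \<longrightarrow>
        (sat L (dsum W X Y A B) \<phi> s \<longleftrightarrow> (\<exists>(\<alpha>, \<beta>)\<in>\<Delta>. sat L A \<alpha> s \<and> sat L B \<beta> s)))"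

definition equivalent :: "('w, 's) weights \<Rightarrow> 'r signature \<Rightarrow>
    (('r, 'w, 's) wstruct \<Rightarrow> ('v \<Rightarrow> nat) \<Rightarrow> bool) \<Rightarrow>
    (('r, 'w, 's) wstruct \<Rightarrow> ('v \<Rightarrow> nat) \<Rightarrow> bool) \<Rightarrow> bool" where
  "equivalent W \<sigma> P Q \<longleftrightarrow> (\<forall>A s. wstructure W \<sigma> A \<longrightarrow> range s \<subseteq> univ A \<longrightarrow> P A s = Q A s)"

text \<open>
  The assumption on \<open>\<Phi>\<close>, with its witnesses \<open>\<sigma>s\<close>, \<open>Ls\<close>, \<open>r\<close>, \<open>\<Phi>s\<close> and the map \<open>star\<close>
  from structures \<open>A\<close> to the associated structures.
\<close>

definition local_precomputation :: "('w, 's) weights \<Rightarrow> 'r \<Rightarrow> 'r \<Rightarrow>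
    ('f, 'v, 'r, 'w, 's) logic \<Rightarrow> 'r signature \<Rightarrow> 'v list \<Rightarrow> 'v list \<Rightarrow> 'f set \<Rightarrow>
    'r signature \<Rightarrow> ('g, 'v, 'r, 'w, 's) logic \<Rightarrow> nat \<Rightarrow> 'g set \<Rightarrow>
    (('r, 'w, 's) wstruct \<Rightarrow> ('r, 'w, 's) wstruct) \<Rightarrow> bool" where
  "local_precomputation W X Y L \<sigma> xs ys \<Phi> \<sigma>s Ls r \<Phi>s star \<longleftrightarrow>
     signature \<sigma>s \<and> is_logic W Ls \<and> finite \<Phi>s \<and> formulas_in Ls \<sigma>s (xs @ ys) \<Phi>s \<and>
     (\<forall>\<psi>\<in>\<Phi>s. r_local W Ls \<sigma>s r \<psi>) \<and>
     (\<forall>A. wstructure W \<sigma> A \<longrightarrow>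
        wstructure W \<sigma>s (star A) \<and> univ (star A) = univ A \<and>
        (\<forall>\<phi>\<in>\<Phi>. \<exists>\<psi>\<in>\<Phi>s. \<forall>as\<in>tuples (length xs) (univ A). \<forall>bs\<in>tuples (length ys) (univ A).
           models L A \<phi> (xs @ ys) (as @ bs) \<longleftrightarrow> models Ls (star A) \<psi> (xs @ ys) (as @ bs))) \<and>
     (\<forall>\<psi>\<in>\<Phi>s. \<forall>z z'. z \<union> z' = free Ls \<psi> \<longrightarrow> z \<inter> z' = {} \<longrightarrow>
        (\<exists>\<Delta>. fv_decomposition W X Y Ls \<sigma>s \<Phi>s \<psi> z z' \<Delta>)) \<and>
     (\<forall>\<psi>\<in>\<Phi>s. \<exists>\<chi>\<in>\<Phi>s. equivalent W \<sigma>s (\<lambda>A. sat Ls A \<chi>) (\<lambda>A s. \<not> sat Ls A \<psi> s)) \<and>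
     (\<forall>\<psi>1\<in>\<Phi>s. \<forall>\<psi>2\<in>\<Phi>s. \<exists>\<chi>\<in>\<Phi>s. equivalent W \<sigma>s (\<lambda>A. sat Ls A \<chi>)
        (\<lambda>A s. sat Ls A \<psi>1 s \<or> sat Ls A \<psi>2 s))"


section \<open>Algorithms with local access\<close>

text \<open>
  Random access machines under the logarithmic cost criterion, programmed in a while language.  The
  memory consists of banks of cells holding natural numbers (\<open>mem b i\<close> is cell \<open>i\<close> of bank \<open>b\<close>)
  and of banks of cells holding weights.  Banks are named by constants of the program, cells within
  a bank are addressed by computed indices.  The structure is not stored in memory: the only
  commands that depend on it are \<open>AskRel\<close>, \<open>AskWt\<close> and \<open>AskNbrs\<close>.

  Weights are abstract: a program can only apply to them the primitive operations \<open>wop\<close> and tests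
  \<open>wtest\<close> (ring operations, predicates of the logic, ...).  These are parameters of the model and
  cost one unit each.

  \<open>Call p es b e\<close> runs \<open>p\<close> in a fresh memory whose bank 0 holds the values of the arguments \<open>es\<close>,
  and stores the content of its cell 0 of bank 0 to cell \<open>e\<close> of bank \<open>b\<close>.
\<close>

datatype exp =
    Num nat
  | Cell nat exp
  | Add exp exp
  | Sub exp exp
  | Less exp exp

datatype ('r, 'w, 'o) com =
    Skip
  | Assign nat exp exp
  | Seq "('r, 'w, 'o) com" "('r, 'w, 'o) com"
  | If exp "('r, 'w, 'o) com" "('r, 'w, 'o) com"
  | While exp "('r, 'w, 'o) com"
  | Call "('r, 'w, 'o) com" "exp list" nat exp
  | AskRel 'r "exp list" nat exp
  | AskWt 'w "exp list" nat exp
  | AskNbrs exp nat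
  | WApply 'o "(nat \<times> exp) list" nat exp
  | WTest 'o "(nat \<times> exp) list" nat exp

record 's memory =
  mem :: "nat \<Rightarrow> nat \<Rightarrow> nat"
  wmem :: "nat \<Rightarrow> nat \<Rightarrow> 's"

definition store :: "nat \<Rightarrow> nat \<Rightarrow> nat \<Rightarrow> 's memory \<Rightarrow> 's memory" where
  "store b i x m = m\<lparr>mem := (mem m)(b := (mem m b)(i := x))\<rparr>"

definition wstore :: "nat \<Rightarrow> nat \<Rightarrow> 's \<Rightarrow> 's memory \<Rightarrow> 's memory" where
  "wstore b i x m = m\<lparr>wmem := (wmem m)(b := (wmem m b)(i := x))\<rparr>"

definition store_list :: "nat \<Rightarrow> nat list \<Rightarrow> 's memory \<Rightarrow> 's memory" where
  "store_list b xs m =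
     m\<lparr>mem := (mem m)(b := (\<lambda>i. if i < length xs then xs ! i else mem m b i))\<rparr>"

definition initial :: "nat list \<Rightarrow> 's memory" where
  "initial xs = store_list 0 xs \<lparr>mem = (\<lambda>b i. 0), wmem = (\<lambda>b i. undefined)\<rparr>"

fun val :: "'s memory \<Rightarrow> exp \<Rightarrow> nat" where
  "val m (Num x) = x"
| "val m (Cell b e) = mem m b (val m e)"
| "val m (Add e e') = val m e + val m e'"
| "val m (Sub e e') = val m e - val m e'"
| "val m (Less e e') = of_bool (val m e < val m e')"

definition wvals :: "'s memory \<Rightarrow> (nat \<times> exp) list \<Rightarrow> 's list" where
  "wvals m args = map (\<lambda>(b, e). wmem m b (val m e)) args"

text \<open>
  \<open>floorlog 2 x\<close> is the length of \<open>x\<close> in binary.  Every node of an expression costs one plus the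
  length of its value.
\<close>

definition size_cost :: "nat \<Rightarrow> nat" where
  "size_cost x = 1 + floorlog 2 x"

fun cost :: "'s memory \<Rightarrow> exp \<Rightarrow> nat" where
  "cost m (Num x) = size_cost x"
| "cost m (Cell b e) = cost m e + size_cost (val m (Cell b e))"
| "cost m (Add e e') = cost m e + cost m e' + size_cost (val m (Add e e'))"
| "cost m (Sub e e') = cost m e + cost m e' + size_cost (val m (Sub e e'))"
| "cost m (Less e e') = cost m e + cost m e' + size_cost (val m (Less e e'))"

definition costs :: "'s memory \<Rightarrow> exp list \<Rightarrow> nat" where
  "costs m es = sum_list (map (cost m) es)"

text \<open>The reply to a neighbourhood query: the number of neighbours, followed by the neighbours.\<close>

definition nbr_list :: "('r, 'w, 's) wstruct \<Rightarrow> nat \<Rightarrow> nat list" where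
  "nbr_list A a = (let ns = sorted_list_of_set (gaifman A `` {a}) in length ns # ns)"

text \<open>
  \<open>exec wop wtest A p m c m'\<close>: with access to \<open>A\<close>, program \<open>p\<close> started in memory \<open>m\<close> halts in
  memory \<open>m'\<close> after time \<open>c\<close>.
\<close>

inductive exec :: "('o \<Rightarrow> 's list \<Rightarrow> 's) \<Rightarrow> ('o \<Rightarrow> 's list \<Rightarrow> bool) \<Rightarrow> ('r, 'w, 's) wstruct \<Rightarrow>
    ('r, 'w, 'o) com \<Rightarrow> 's memory \<Rightarrow> nat \<Rightarrow> 's memory \<Rightarrow> bool"
  for wop :: "'o \<Rightarrow> 's list \<Rightarrow> 's" and wtest :: "'o \<Rightarrow> 's list \<Rightarrow> bool"
  and A :: "('r, 'w, 's) wstruct" where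
  Skip: "exec wop wtest A Skip m 1 m"
| Assign: "exec wop wtest A (Assign b e e') m (1 + cost m e + cost m e')
     (store b (val m e) (val m e') m)"
| Seq: "exec wop wtest A p m c m' \<Longrightarrow> exec wop wtest A q m' c' m'' \<Longrightarrow>
     exec wop wtest A (Seq p q) m (c + c') m''"
| IfTrue: "val m e \<noteq> 0 \<Longrightarrow> exec wop wtest A p m c m' \<Longrightarrow>
     exec wop wtest A (If e p q) m (1 + cost m e + c) m'"
| IfFalse: "val m e = 0 \<Longrightarrow> exec wop wtest A q m c m' \<Longrightarrow>
     exec wop wtest A (If e p q) m (1 + cost m e + c) m'"
| WhileTrue: "val m e \<noteq> 0 \<Longrightarrow> exec wop wtest A p m c m' \<Longrightarrow>
     exec wop wtest A (While e p) m' c' m'' \<Longrightarrow>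
     exec wop wtest A (While e p) m (1 + cost m e + c + c') m''"
| WhileFalse: "val m e = 0 \<Longrightarrow> exec wop wtest A (While e p) m (1 + cost m e) m"
| Call: "exec wop wtest A p (initial (map (val m) es)) c m' \<Longrightarrow>
     exec wop wtest A (Call p es b e) m
       (1 + costs m es + cost m e + c + size_cost (mem m' 0 0))
       (store b (val m e) (mem m' 0 0) m)"
| AskRel: "exec wop wtest A (AskRel R es b e) m (1 + costs m es + cost m e)
     (store b (val m e) (of_bool (map (val m) es \<in> rel A R)) m)"
| AskWt: "exec wop wtest A (AskWt w es b e) m (1 + costs m es + cost m e)
     (wstore b (val m e) (wt A w (map (val m) es)) m)"
| AskNbrs: "exec wop wtest A (AskNbrs e b) m
     (1 + cost m e + sum_list (map size_cost (nbr_list A (val m e))))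
     (store_list b (nbr_list A (val m e)) m)"
| WApply: "exec wop wtest A (WApply f args b e) m (1 + costs m (map snd args) + cost m e)
     (wstore b (val m e) (wop f (wvals m args)) m)"
| WTest: "exec wop wtest A (WTest f args b e) m (1 + costs m (map snd args) + cost m e)
     (store b (val m e) (of_bool (wtest f (wvals m args))) m)"

inductive_cases exec_elims:
  "exec wop wtest A Skip m c m'"
  "exec wop wtest A (Assign b e e') m c m'"
  "exec wop wtest A (Seq p q) m c m'"
  "exec wop wtest A (If e p q) m c m'"
  "exec wop wtest A (While e p) m c m'"
  "exec wop wtest A (Call p es b e) m c m'"
  "exec wop wtest A (AskRel R es b e) m c m'"
  "exec wop wtest A (AskWt w es b e) m c m'"
  "exec wop wtest A (AskNbrs e b) m c m'"
  "exec wop wtest A (WApply h args b e) m c m'"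
  "exec wop wtest A (WTest h args b e) m c m'"

text \<open>Execution is deterministic, so result and running time are well defined.\<close>

lemma exec_deterministic:
  "exec wop wtest A p m c m' \<Longrightarrow> exec wop wtest A p m d m'' \<Longrightarrow> c = d \<and> m' = m''"
proof (induction arbitrary: d m'' rule: exec.induct)
  case (Skip m)
  from Skip.prems show ?case by (rule exec_elims) simp
next
  case (Assign b e e' m)
  from Assign.prems show ?case by (rule exec_elims) simp
next
  case (Seq p m c m' q c' m'')
  from Seq.prems show ?case by (rule exec_elims) (auto dest!: Seq.IH)
next
  case (IfTrue m e p c m' q)
  from IfTrue.prems show ?case
    by (rule exec_elims) (auto dest!: IfTrue.IH simp: IfTrue.hyps)
next
  case (IfFalse m e q c m' p)
  from IfFalse.prems show ?case
    by (rule exec_elims) (auto dest!: IfFalse.IH simp: IfFalse.hyps)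
next
  case (WhileTrue m e p c m' c' m'')
  from WhileTrue.prems show ?case
    by (rule exec_elims) (auto dest!: WhileTrue.IH simp: WhileTrue.hyps)
next
  case (WhileFalse m e p)
  from WhileFalse.prems show ?case by (rule exec_elims) (auto simp: WhileFalse.hyps)
next
  case (Call p m es c m' b e)
  from Call.prems show ?case by (rule exec_elims) (auto dest!: Call.IH)
next
  case (AskRel R es b e m)
  from AskRel.prems show ?case by (rule exec_elims) simp
next
  case (AskWt w es b e m)
  from AskWt.prems show ?case by (rule exec_elims) simp
next
  case (AskNbrs e b m)
  from AskNbrs.prems show ?case by (rule exec_elims) simp
next
  case (WApply h args b e m)
  from WApply.prems show ?case by (rule exec_elims) simp
next
  case (WTest h args b e m)
  from WTest.prems show ?case by (rule exec_elims) simp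
qed


section \<open>Model checking and learning\<close>

text \<open>
  Structures given to an algorithm have universe \<open>{0, ..., n - 1}\<close>, so that elements have names of
  length \<open>O(log n)\<close>.
\<close>

definition encoded :: "('r, 'w, 's) wstruct \<Rightarrow> bool" where
  "encoded A \<longleftrightarrow> univ A = {..<card (univ A)}"

text \<open>
  The function \<open>f\<close> bounds the time complexity of model checking the formulas of \<open>\<Phi>\<close> on the
  structures in \<open>K\<close>: every such formula has a model checking program, using local access to the
  structure, that runs in time \<open>f A\<close> on \<open>A\<close>.  The clause \<open>1 \<le> f A\<close> matters only for empty \<open>\<Phi>\<close>.
\<close>

definition model_checking_bound :: "('o \<Rightarrow> 's list \<Rightarrow> 's) \<Rightarrow> ('o \<Rightarrow> 's list \<Rightarrow> bool) \<Rightarrow>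
    ('f, 'v, 'r, 'w, 's) logic \<Rightarrow> 'v list \<Rightarrow> 'f set \<Rightarrow> ('r, 'w, 's) wstruct set \<Rightarrow>
    (('r, 'w, 's) wstruct \<Rightarrow> real) \<Rightarrow> bool" where
  "model_checking_bound wop wtest L vs \<Phi> K f \<longleftrightarrow>
     (\<forall>A\<in>K. 1 \<le> f A) \<and>
     (\<forall>\<phi>\<in>\<Phi>. \<exists>p :: ('r, 'w, 'o) com. \<forall>A\<in>K. \<forall>cs\<in>tuples (length vs) (univ A).
        \<exists>c m. exec wop wtest A p (initial cs) c m \<and> real c \<le> f A \<and>
              mem m 0 0 = of_bool (models L A \<phi> vs cs))"

definition consistent :: "(nat list \<Rightarrow> bool) \<Rightarrow> (nat list \<times> bool) list \<Rightarrow> bool" where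
  "consistent h T \<longleftrightarrow> (\<forall>(as, b)\<in>set T. h as = b)"

definition encode_training :: "(nat list \<times> bool) list \<Rightarrow> nat list" where
  "encode_training T = length T # concat (map (\<lambda>(as, b). as @ [of_bool b]) T)"

text \<open>
  Bank 0 holds the output: cell 0 contains 0 if the algorithm rejects; otherwise it contains one
  plus the code of the returned formula, and is followed by the returned parameters.
\<close>

definition rejects :: "'s memory \<Rightarrow> bool" where
  "rejects m \<longleftrightarrow> mem m 0 0 = 0"

definition returns :: "('g \<Rightarrow> nat) \<Rightarrow> 's memory \<Rightarrow> 'g \<Rightarrow> nat list \<Rightarrow> bool" where
  "returns code m \<psi> vs \<longleftrightarrow>
     mem m 0 0 = Suc (code \<psi>) \<and> (\<forall>i<length vs. mem m 0 (Suc i) = vs ! i)"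

text \<open>
  \<open>p\<close> solves Exact Learning with Precomputation for \<open>\<Phi>\<close> and \<open>\<Phi>s\<close>, where \<open>code\<close> is the encoding of
  the formulas in \<open>\<Phi>s\<close> and \<open>time B t\<close> bounds the time on structure \<open>B\<close> and \<open>t\<close> training examples.
\<close>

definition solves_exact_learning :: "('o \<Rightarrow> 's list \<Rightarrow> 's) \<Rightarrow> ('o \<Rightarrow> 's list \<Rightarrow> bool) \<Rightarrow>
    ('w, 's) weights \<Rightarrow> ('f, 'v, 'r, 'w, 's) logic \<Rightarrow> 'r signature \<Rightarrow> 'v list \<Rightarrow> 'v list \<Rightarrow>
    'f set \<Rightarrow> ('g, 'v, 'r, 'w, 's) logic \<Rightarrow> 'g set \<Rightarrow> ('g \<Rightarrow> nat) \<Rightarrow>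
    (('r, 'w, 's) wstruct \<Rightarrow> ('r, 'w, 's) wstruct) \<Rightarrow>
    ('r, 'w, 'o) com \<Rightarrow> (('r, 'w, 's) wstruct \<Rightarrow> nat \<Rightarrow> real) \<Rightarrow> bool" where
  "solves_exact_learning wop wtest W L \<sigma> xs ys \<Phi> Ls \<Phi>s code star p time \<longleftrightarrow>
     (\<forall>A T. wstructure W \<sigma> A \<longrightarrow> encoded A \<longrightarrow>
        set T \<subseteq> tuples (length xs) (univ A) \<times> UNIV \<longrightarrow>
        (\<exists>c m. exec wop wtest (star A) p (initial (encode_training T)) c m \<and>
           real c \<le> time (star A) (length T) \<and>
           (if rejects m then \<not> (\<exists>h\<in>concept_class L \<Phi> A xs ys. consistent h T)
            else \<exists>\<psi>\<in>\<Phi>s. \<exists>vs\<in>tuples (length ys) (univ A). returns code m \<psi> vs \<and>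
                   consistent (\<lambda>as. models Ls (star A) \<psi> (xs @ ys) (as @ vs)) T)))"

end

theory Submission
  imports Defs
begin

text \<open>
  Let \<open>(\<phi>, v)\<close> be consistent with the examples.  Starting from the examples, collect repeatedly the
  entries of \<open>v\<close> at distance at most \<open>2r + 1\<close> from the examples and the entries collected so far.  The
  collected entries have distance at most \<open>l(2r + 1)\<close> from the examples, and the others are far from
  them.  By locality and a Feferman-Vaught decomposition of \<open>\<phi>\<close>, the influence of the far entries,
  which is the same for all examples, is to select a disjunction of formulas \<open>\<alpha>\<close> that only depend on
  the example and the near entries.  Up to equivalence this disjunction is again in \<open>\<Phi>s\<close>, so it is
  enough to try all formulas in \<open>\<Phi>s\<close> and all parameters from a ball of constant radius around the
  examples, which has polynomial size in \<open>d\<close> and \<open>t\<close>, or \<open>0\<close> in place of the far entries.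
\<close>

section \<open>Neighbourhoods and sums of structures\<close>

text \<open>The time may depend on the size \<open>n\<close> only through \<open>log n\<close>. This
  forces the restriction to a ball: its list of candidates has length at most
  \<open>(1 + t * k) * (1 + d) ^ D\<close> for \<open>D = l * (2 * r + 1)\<close>, whatever
  \<open>n\<close> is. Each choice of a formula and \<open>l\<close> candidates costs one model
  checking call per example, so the bound \<open>f\<close> remains a linear factor. Every returned
  pair has been checked against all examples; locality is needed only to justify a rejection. Beyond
  distance \<open>2 * r + 1\<close>, the \<open>r\<close>-neighbourhoods of two groups of elements
  are disjoint and no edge joins them. One disjunction serves all examples because the formulas
  \<beta> of the decomposition mention far variables only: which of them hold is decided by
  \<open>v\<close> alone. On the side of the machine, time is separated from correctness. A program
  has a cost bound computed from its syntax and three numbers, which bound the memory cells, the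
  iterations of a loop and the time of a call. Correctness proofs then only have to show that these
  three bounds are respected.\<close>

lemma relpow_add_elems: "(a, b) \<in> R ^^ i \<Longrightarrow> (b, c) \<in> R ^^ j \<Longrightarrow> (a, c) \<in> R ^^ (i + j)"
  by (auto simp: relpow_add)

lemma sym_gaifman: "sym (gaifman A)"
  by (auto simp: gaifman_def sym_def)

lemma relpow_gaifman_sym: "(a, b) \<in> gaifman A ^^ i \<Longrightarrow> (b, a) \<in> gaifman A ^^ i"
proof (induction i arbitrary: b)
  case (Suc i)
  then obtain c where "(c, a) \<in> gaifman A ^^ i" "(c, b) \<in> gaifman A" by auto
  then show ?case using symD[OF sym_gaifman] relpow_Suc_I2 by metis
qed simp

text \<open>A nonempty set of extended naturals attains its infimum, and the empty set has infimum
  infinity, which exceeds the finite bound \<open>r\<close>.\<close>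

lemma Inf_enat_le_iff: "Inf S \<le> enat r \<longleftrightarrow> (\<exists>x\<in>S. x \<le> enat r)" for S :: "enat set" and r :: nat
proof
  assume *: "Inf S \<le> enat r"
  then have "S \<noteq> {}" by (auto simp: Inf_enat_def)
  then have "Inf S \<in> S" unfolding Inf_enat_def by (auto intro: LeastI)
  then show "\<exists>x\<in>S. x \<le> enat r" using * by blast
qed (auto intro: Inf_lower2)

text \<open>From here on distances are replaced by walks in the Gaifman graph, which can be
  concatenated and reversed.\<close>

lemma mem_nbh_set_iff:
  "b \<in> nbh_set A r Z \<longleftrightarrow> b \<in> univ A \<and> (\<exists>a\<in>Z. \<exists>i\<le>r. (a, b) \<in> gaifman A ^^ i)"
  by (auto simp: nbh_set_def gdist_def Inf_enat_le_iff)

text \<open>Resolving the \<open>case\<close> expressions into separate implications makes the rules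
  \<open>prestructureD\<close> and \<open>prestructureI\<close> immediate.\<close>

lemma prestructure_iff:
  "prestructure W \<sigma> A \<longleftrightarrow> finite (univ A) \<and> univ A \<noteq> {} \<and>
     (\<forall>R. \<sigma> R = None \<longrightarrow> rel A R = {}) \<and>
     (\<forall>R m u. \<sigma> R = Some m \<longrightarrow> u \<in> rel A R \<longrightarrow> u \<in> tuples m (univ A)) \<and>
     (\<forall>w t. W w = None \<longrightarrow> wt A w t = undefined) \<and>
     (\<forall>w m G t. W w = Some (m, G) \<longrightarrow> t \<in> tuples m (univ A) \<longrightarrow> wt A w t \<in> carrier G) \<and>
     (\<forall>w m G t. W w = Some (m, G) \<longrightarrow> t \<notin> tuples m (univ A) \<longrightarrow> wt A w t = undefined)"
 proof -
  have "(\<forall>R. case \<sigma> R of None \<Rightarrow> rel A R = {} | Some m \<Rightarrow> rel A R \<subseteq> tuples m (univ A)) \<longleftrightarrow>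
      (\<forall>R. (\<sigma> R = None \<longrightarrow> rel A R = {}) \<and>
        (\<forall>m u. \<sigma> R = Some m \<longrightarrow> u \<in> rel A R \<longrightarrow> u \<in> tuples m (univ A)))"
    by (intro all_cong1) (auto split: option.split)
  moreover have "(\<forall>w. case W w of None \<Rightarrow> wt A w = (\<lambda>t. undefined)
        | Some (m, G) \<Rightarrow> (\<forall>t. if t \<in> tuples m (univ A) then wt A w t \<in> carrier G
                              else wt A w t = undefined)) \<longleftrightarrow>
      (\<forall>w. (\<forall>t. W w = None \<longrightarrow> wt A w t = undefined) \<and>
        (\<forall>m G t. W w = Some (m, G) \<longrightarrow> t \<in> tuples m (univ A) \<longrightarrow> wt A w t \<in> carrier G) \<and>
        (\<forall>m G t. W w = Some (m, G) \<longrightarrow> t \<notin> tuples m (univ A) \<longrightarrow> wt A w t = undefined))"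
    (is "(\<forall>w. ?L w) \<longleftrightarrow> (\<forall>w. ?R w)")
  proof (intro all_cong1)
    fix w
    show "?L w \<longleftrightarrow> ?R w"
    proof (cases "W w")
      case (Some p)
      then show ?thesis by (cases p) (simp add: all_conj_distrib)
    qed (auto simp: fun_eq_iff)
  qed
  ultimately show ?thesis unfolding prestructure_def by (simp only: all_conj_distrib conj_assoc)
qed

lemma prestructureD:
  assumes "prestructure W \<sigma> A"
  shows "finite (univ A)" and "univ A \<noteq> {}"
    and "\<sigma> R = None \<Longrightarrow> rel A R = {}"
    and "\<sigma> R = Some m \<Longrightarrow> u \<in> rel A R \<Longrightarrow> u \<in> tuples m (univ A)"
    and "W w = None \<Longrightarrow> wt A w t = undefined"
    and "W w = Some (m, G) \<Longrightarrow> t \<in> tuples m (univ A) \<Longrightarrow> wt A w t \<in> carrier G"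
    and "W w = Some (m, G) \<Longrightarrow> t \<notin> tuples m (univ A) \<Longrightarrow> wt A w t = undefined"
  using assms unfolding prestructure_iff by blast+

lemma prestructureI:
  assumes "finite (univ A)" and "univ A \<noteq> {}"
    and "\<And>R. \<sigma> R = None \<Longrightarrow> rel A R = {}"
    and "\<And>R m u. \<sigma> R = Some m \<Longrightarrow> u \<in> rel A R \<Longrightarrow> u \<in> tuples m (univ A)"
    and "\<And>w t. W w = None \<Longrightarrow> wt A w t = undefined"
    and "\<And>w m G t. W w = Some (m, G) \<Longrightarrow> t \<in> tuples m (univ A) \<Longrightarrow> wt A w t \<in> carrier G"
    and "\<And>w m G t. W w = Some (m, G) \<Longrightarrow> t \<notin> tuples m (univ A) \<Longrightarrow> wt A w t = undefined"
  shows "prestructure W \<sigma> A"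
  using assms unfolding prestructure_iff by blast

lemma prestructure_rel_subset: "prestructure W \<sigma> A \<Longrightarrow> u \<in> rel A R \<Longrightarrow> set u \<subseteq> univ A"
  using prestructureD(3)[of W \<sigma> A R] prestructureD(4)[of W \<sigma> A R _ u]
  by (cases "\<sigma> R") (auto simp: tuples_def)

lemma gaifman_subset:
  assumes "prestructure W \<sigma> A"
  shows "gaifman A \<subseteq> univ A \<times> univ A"
  using prestructure_rel_subset[OF assms] unfolding gaifman_def by blast

lemma relpow_subset: "R \<subseteq> U \<times> U \<Longrightarrow> a \<in> U \<Longrightarrow> (a, b) \<in> R ^^ i \<Longrightarrow> b \<in> U"
  by (induction i arbitrary: b) auto

lemma prestructure_induced:
  assumes "prestructure W \<sigma> A" and "univ A \<inter> B \<noteq> {}"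
  shows "prestructure W \<sigma> (induced A B)"
proof (rule prestructureI)
  show "u \<in> tuples m (univ (induced A B))" if "\<sigma> R = Some m" "u \<in> rel (induced A B) R" for R m u
    using that prestructureD(4)[OF assms(1)] by (auto simp: induced_def tuples_def)
  show "wt (induced A B) w t \<in> carrier G"
    if "W w = Some (m, G)" "t \<in> tuples m (univ (induced A B))" for w m G t
    using that prestructureD(6)[OF assms(1), of w m G t] by (auto simp: induced_def tuples_def)
  show "wt (induced A B) w t = undefined"
    if "W w = Some (m, G)" "t \<notin> tuples m (univ (induced A B))" for w m G t
    using that prestructureD(7)[OF assms(1), of w m G t] by (auto simp: induced_def tuples_def)
  show "rel (induced A B) R = {}" if "\<sigma> R = None" for R
    using prestructureD(3)[OF assms(1) that] by (simp add: induced_def)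
  show "wt (induced A B) w t = undefined" if "W w = None" for w t
    using prestructureD(5)[OF assms(1) that] by (simp add: induced_def)
qed (use assms prestructureD(1,2)[OF assms(1)] in \<open>auto simp: induced_def\<close>)

text \<open>An isomorphic copy, disjoint from the original once \<open>c\<close> exceeds all
  elements. Truncated subtraction sends every number below \<open>c\<close> to 0, so without the
  membership test a tuple outside the copy could inherit a weight of \<open>A\<close> instead of the
  default value.\<close>

definition shifted :: "('w, 's) weights \<Rightarrow> nat \<Rightarrow> ('r, 'w, 's) wstruct \<Rightarrow> ('r, 'w, 's) wstruct" where
  "shifted W c A = \<lparr>univ = (\<lambda>x. x + c) ` univ A,
     rel = (\<lambda>R. map (\<lambda>x. x + c) ` rel A R),
     wt = (\<lambda>w t. case W w of None \<Rightarrow> undefined | Some (m, G) \<Rightarrow>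
        if t \<in> tuples m ((\<lambda>x. x + c) ` univ A) then wt A w (map (\<lambda>x. x - c) t) else undefined)\<rparr>"

lemma map_shift: "map (\<lambda>x. x - c) (map (\<lambda>x. x + c) t) = (t :: nat list)"
  by (induction t) auto

lemma tuples_image_iff: "t \<in> tuples m (h ` U) \<longleftrightarrow> (\<exists>u\<in>tuples m U. t = map h u)"
proof
  assume t: "t \<in> tuples m (h ` U)"
  then have "\<forall>x\<in>set t. \<exists>y. y \<in> U \<and> h y = x" by (auto simp: tuples_def)
  then obtain g where g: "\<And>x. x \<in> set t \<Longrightarrow> g x \<in> U \<and> h (g x) = x" by metis
  then have "map h (map g t) = t" by (simp add: map_idI)
  moreover have "map g t \<in> tuples m U" using t g by (auto simp: tuples_def)
  ultimately show "\<exists>u\<in>tuples m U. t = map h u" by metis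
next
  assume "\<exists>u\<in>tuples m U. t = map h u"
  then obtain u where "u \<in> tuples m U" "t = map h u" by blast
  then show "t \<in> tuples m (h ` U)" using image_mono[of "set u" U h] by (simp add: tuples_def)
qed

lemma wt_shifted:
  "W w = Some (m, G) \<Longrightarrow> t \<in> tuples m (univ A) \<Longrightarrow>
     wt (shifted W c A) w (map (\<lambda>x. x + c) t) = wt A w t"
  by (auto simp: shifted_def tuples_def map_shift o_def)

lemma prestructure_shifted:
  assumes A: "prestructure W \<sigma> A"
  shows "prestructure W \<sigma> (shifted W c A)"
proof (rule prestructureI)
  show "wt (shifted W c A) w t \<in> carrier G"
    if w: "W w = Some (m, G)" and t: "t \<in> tuples m (univ (shifted W c A))" for w m G t
  proof -
    from t have "t \<in> tuples m ((\<lambda>x. x + c) ` univ A)" by (simp add: shifted_def)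
    then obtain u where u: "u \<in> tuples m (univ A)" "t = map (\<lambda>x. x + c) u"
      unfolding tuples_image_iff by blast
    then have "wt A w u \<in> carrier G" using prestructureD(6)[OF A w] by blast
    then show ?thesis using wt_shifted[of W w m G u A c] u w by simp
  qed
  show "t \<in> tuples m (univ (shifted W c A))"
    if "\<sigma> R = Some m" "t \<in> rel (shifted W c A) R" for R m t
  proof -
    from that obtain u where u: "u \<in> rel A R" "t = map (\<lambda>x. x + c) u" by (auto simp: shifted_def)
    have "u \<in> tuples m (univ A)" using prestructureD(4)[OF A that(1) u(1)] .
    then have "t \<in> tuples m ((\<lambda>x. x + c) ` univ A)" unfolding tuples_image_iff using u by blast
    then show ?thesis by (simp add: shifted_def)
  qed
  show "wt (shifted W c A) w t = undefined"
    if "W w = Some (m, G)" "t \<notin> tuples m (univ (shifted W c A))" for w m G t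
    using that by (auto simp: shifted_def)
  show "wt (shifted W c A) w t = undefined" if "W w = None" for w t
    using that by (auto simp: shifted_def)
  show "finite (univ (shifted W c A))" "univ (shifted W c A) \<noteq> {}"
    using prestructureD(1,2)[OF A] by (auto simp: shifted_def)
  show "rel (shifted W c A) R = {}" if "\<sigma> R = None" for R
    using prestructureD(3)[OF A that] by (simp add: shifted_def)
qed

lemma wstructure_shifted:
  assumes "wstructure W \<sigma> A"
  shows "wstructure W \<sigma> (shifted W c A)"
proof -
  let ?C = "shifted W c A"
  have "m = 1 \<or> (\<forall>a\<in>set t. \<forall>b\<in>set t. a = b) \<or> (\<exists>R. \<exists>u\<in>rel ?C R. set t \<subseteq> set u)"
    if w: "W w = Some (m, G)" and t: "t \<in> tuples m (univ ?C)" and nz: "wt ?C w t \<noteq> \<zero>\<^bsub>G\<^esub>"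
    for w m G t
  proof -
    from t have "t \<in> tuples m ((\<lambda>x. x + c) ` univ A)" by (simp add: shifted_def)
    then obtain u where u: "u \<in> tuples m (univ A)" "t = map (\<lambda>x. x + c) u"
      unfolding tuples_image_iff by blast
    then have "wt A w u \<noteq> \<zero>\<^bsub>G\<^esub>" using nz wt_shifted[of W w m G u A c] w by simp
    then have "m = 1 \<or> (\<forall>a\<in>set u. \<forall>b\<in>set u. a = b) \<or> (\<exists>R. \<exists>v\<in>rel A R. set u \<subseteq> set v)"
      using assms w u by (auto simp: wstructure_def)
    then show ?thesis
    proof (elim disjE exE bexE)
      fix R v
      assume "v \<in> rel A R" "set u \<subseteq> set v"
      then have "map (\<lambda>x. x + c) v \<in> rel ?C R" "set t \<subseteq> set (map (\<lambda>x. x + c) v)"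
        using u by (auto simp: shifted_def)
      then show ?thesis by blast
    qed (use u in auto)
  qed
  then show ?thesis
    using prestructure_shifted[of W \<sigma> A c] assms unfolding wstructure_def by blast
qed

lemma isomorphism_shifted: "isomorphism W (\<lambda>x. x + c) A (shifted W c A)"
  unfolding isomorphism_def
proof (intro conjI allI impI)
  show "bij_betw (\<lambda>x. x + c) (univ A) (univ (shifted W c A))"
    by (simp add: bij_betw_def shifted_def)
qed (simp add: shifted_def, rule wt_shifted)

section \<open>Sums of structures and their reducts\<close>

lemma prestructure_dsum:
  assumes A: "prestructure W \<sigma> A" and B: "prestructure W \<sigma> B"
    and W: "\<And>w m G. W w = Some (m, G) \<Longrightarrow> \<zero>\<^bsub>G\<^esub> \<in> carrier G"
    and XY: "X \<noteq> Y"
  shows "prestructure W (\<sigma>(X \<mapsto> 1, Y \<mapsto> 1)) (dsum W X Y A B)"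
  (is "prestructure W ?\<tau> ?E")
proof -
  have tup: "t \<in> tuples m (univ A \<union> univ B)" if "t \<in> tuples m (univ A) \<or> t \<in> tuples m (univ B)"
    for t m using that by (auto simp: tuples_def)
  have wt: "wt ?E w t = (if t \<in> tuples m (univ A) then wt A w t
           else if t \<in> tuples m (univ B) then wt B w t
           else if t \<in> tuples m (univ A \<union> univ B) then \<zero>\<^bsub>G\<^esub>
           else undefined)" if "W w = Some (m, G)" for w m G t
    using that by (simp add: dsum_def)
  have univ: "univ ?E = univ A \<union> univ B" by (simp add: dsum_def)
  show ?thesis
  proof (rule prestructureI)
    show "u \<in> tuples m (univ ?E)" if R: "?\<tau> R = Some m" and u: "u \<in> rel ?E R" for R m u
    proof (cases "R = X \<or> R = Y")
      case True
      then show ?thesis using R u XY by (auto simp: dsum_def tuples_def split: if_splits)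
    next
      case False
      then have "u \<in> rel A R \<or> u \<in> rel B R" "\<sigma> R = Some m" using R u by (auto simp: dsum_def)
      then have "u \<in> tuples m (univ A) \<or> u \<in> tuples m (univ B)"
        using prestructureD(4)[OF A] prestructureD(4)[OF B] by blast
      then show ?thesis unfolding univ by (rule tup)
    qed
    show "wt ?E w t \<in> carrier G" if w: "W w = Some (m, G)" and t: "t \<in> tuples m (univ ?E)"
      for w m G t
      using prestructureD(6)[OF A w] prestructureD(6)[OF B w] W[OF w] t unfolding wt[OF w] univ by auto
    show "wt ?E w t = undefined" if w: "W w = Some (m, G)" and t: "t \<notin> tuples m (univ ?E)"
      for w m G t
      using tup t unfolding wt[OF w] univ by auto
    show "wt ?E w t = undefined" if "W w = None" for w t
      using that by (simp add: dsum_def)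
    show "rel ?E R = {}" if "?\<tau> R = None" for R
      using prestructureD(3)[OF A] prestructureD(3)[OF B] that by (auto simp: dsum_def split: if_splits)
    show "finite (univ ?E)" "univ ?E \<noteq> {}"
      using prestructureD(1,2)[OF A] prestructureD(1,2)[OF B] by (auto simp: univ)
  qed
qed

lemma prestructure_reduct:
  assumes A: "prestructure W \<tau> A" and le: "\<sigma> \<subseteq>\<^sub>m \<tau>"
  shows "prestructure W \<sigma> (reduct \<sigma> A)"
proof (rule prestructureI)
  show "u \<in> tuples m (univ (reduct \<sigma> A))" if "\<sigma> R = Some m" "u \<in> rel (reduct \<sigma> A) R" for R m u
    using that prestructureD(4)[OF A, of R m u] le domI[of \<sigma> R m]
    by (auto simp: reduct_def map_le_def)
  show "wt (reduct \<sigma> A) w t \<in> carrier G" if "W w = Some (m, G)" "t \<in> tuples m (univ (reduct \<sigma> A))"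
    for w m G t using prestructureD(6)[OF A that(1), of t] that(2) by (simp add: reduct_def)
  show "wt (reduct \<sigma> A) w t = undefined" if "W w = Some (m, G)" "t \<notin> tuples m (univ (reduct \<sigma> A))"
    for w m G t using prestructureD(7)[OF A that(1), of t] that(2) by (simp add: reduct_def)
  show "wt (reduct \<sigma> A) w t = undefined" if "W w = None" for w t
    using prestructureD(5)[OF A that] by (simp add: reduct_def)
qed (use prestructureD(1,2)[OF A] in \<open>auto simp: reduct_def\<close>)

text \<open>Decompositions speak about the sum, over the signature extended by \<open>X\<close> and
  \<open>Y\<close>, whereas locality is given for structures over \<open>\<sigma>\<close>; the
  reduct mediates between the two. A nonzero weight lives inside one summand, and the relation tuple
  that justifies it there survives because \<open>X\<close> and \<open>Y\<close> are fresh.\<close>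

lemma wstructure_reduct_dsum:
  assumes A: "wstructure W \<sigma> A" and B: "wstructure W \<sigma> B"
    and W: "\<And>w m G. W w = Some (m, G) \<Longrightarrow> \<zero>\<^bsub>G\<^esub> \<in> carrier G"
    and XY: "X \<noteq> Y" "X \<notin> dom \<sigma>" "Y \<notin> dom \<sigma>"
  shows "wstructure W \<sigma> (reduct \<sigma> (dsum W X Y A B))"
proof -
  let ?E = "reduct \<sigma> (dsum W X Y A B)"
  have "prestructure W (\<sigma>(X \<mapsto> 1, Y \<mapsto> 1)) (dsum W X Y A B)"
    using A B W XY by (intro prestructure_dsum) (auto simp: wstructure_def)
  then have pre: "prestructure W \<sigma> ?E"
    using XY by (intro prestructure_reduct) (auto simp: map_le_def)
  have rel: "rel A R \<subseteq> rel ?E R" "rel B R \<subseteq> rel ?E R" for R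
  proof -
    have "R \<notin> dom \<sigma> \<Longrightarrow> rel A R = {} \<and> rel B R = {}"
      using prestructureD(3)[of W \<sigma> A R] prestructureD(3)[of W \<sigma> B R] A B
      by (auto simp: wstructure_def domIff)
    then show "rel A R \<subseteq> rel ?E R" "rel B R \<subseteq> rel ?E R"
      using XY by (auto simp: reduct_def dsum_def)
  qed
  have "m = 1 \<or> (\<forall>a\<in>set t. \<forall>b\<in>set t. a = b) \<or> (\<exists>R. \<exists>u\<in>rel ?E R. set t \<subseteq> set u)"
    if w: "W w = Some (m, G)" and t: "t \<in> tuples m (univ ?E)" and nz: "wt ?E w t \<noteq> \<zero>\<^bsub>G\<^esub>"
    for w m G t
  proof -
    have "t \<in> tuples m (univ A) \<and> wt A w t \<noteq> \<zero>\<^bsub>G\<^esub> \<or> t \<in> tuples m (univ B) \<and> wt B w t \<noteq> \<zero>\<^bsub>G\<^esub>"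
      using w t nz by (auto simp: reduct_def dsum_def split: if_splits)
    then have "m = 1 \<or> (\<forall>a\<in>set t. \<forall>b\<in>set t. a = b) \<or>
        (\<exists>R. \<exists>u\<in>rel A R \<union> rel B R. set t \<subseteq> set u)"
      using A B w unfolding wstructure_def by blast
    then show ?thesis using rel by blast
  qed
  then show ?thesis using pre unfolding wstructure_def by blast
qed

section \<open>Decomposing a formula whose variables form two groups that are far apart\<close>

lemma is_logicD:
  assumes "is_logic W L" and "\<phi> \<in> formulas L \<sigma>"
  shows "finite (free L \<phi>)"
    and "prestructure W \<sigma> A \<Longrightarrow> s ` free L \<phi> \<subseteq> univ A \<Longrightarrow> (\<And>v. v \<in> free L \<phi> \<Longrightarrow> s v = s' v) \<Longrightarrow>
      sat L A \<phi> s = sat L A \<phi> s'"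
    and "\<sigma> \<subseteq>\<^sub>m \<sigma>' \<Longrightarrow> prestructure W \<sigma>' A \<Longrightarrow> s ` free L \<phi> \<subseteq> univ A \<Longrightarrow>
      sat L A \<phi> s = sat L (reduct \<sigma> A) \<phi> s"
    and "prestructure W \<sigma> A \<Longrightarrow> prestructure W \<sigma> B \<Longrightarrow> isomorphism W h A B \<Longrightarrow>
      s ` free L \<phi> \<subseteq> univ A \<Longrightarrow> sat L A \<phi> s = sat L B \<phi> (h \<circ> s)"
  using assms unfolding is_logic_def by blast+

text \<open>
  Induced substructures need not be structures, so the decomposition cannot be applied to the
  neighbourhoods of the two groups of elements.  Instead, it is applied to the sum of \<open>B\<close> and a
  disjoint copy of \<open>B\<close>, where the second group is moved to the copy: the neighbourhood of all
  elements is the same there as in \<open>B\<close>, if the two groups are far apart.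
\<close>

lemma sat_fv_decomposition_far:
  assumes L: "is_logic W L" and B: "wstructure W \<sigma> B"
    and zero: "\<And>w m G. W w = Some (m, G) \<Longrightarrow> \<zero>\<^bsub>G\<^esub> \<in> carrier G"
    and XY: "X \<noteq> Y" "X \<notin> dom \<sigma>" "Y \<notin> dom \<sigma>"
    and \<phi>: "\<phi> \<in> formulas L \<sigma>" "r_local W L \<sigma> r \<phi>" and \<Phi>: "\<Phi> \<subseteq> formulas L \<sigma>"
    and fv: "fv_decomposition W X Y L \<sigma> \<Phi> \<phi> z z' \<Delta>"
    and free: "free L \<phi> = z \<union> z'" "z \<inter> z' = {}" "free L \<phi> \<noteq> {}"
    and s: "s ` free L \<phi> \<subseteq> univ B"
    and far: "\<And>u v i. u \<in> z \<Longrightarrow> v \<in> z' \<Longrightarrow> i \<le> 2 * r + 1 \<Longrightarrow> (s u, s v) \<notin> gaifman B ^^ i"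
  shows "sat L B \<phi> s \<longleftrightarrow> (\<exists>(\<alpha>, \<beta>)\<in>\<Delta>. sat L B \<alpha> s \<and> sat L B \<beta> s)"
proof -
  define c where "c = Suc (Max (univ B))"
  define h where "h = (\<lambda>x. x + c)"
  define C where "C = shifted W c B"
  define D where "D = dsum W X Y B C"
  define E where "E = reduct \<sigma> D"
  have pB: "prestructure W \<sigma> B" using B by (simp add: wstructure_def)
  have C: "wstructure W \<sigma> C" unfolding C_def by (rule wstructure_shifted[OF B])
  then have pC: "prestructure W \<sigma> C" by (simp add: wstructure_def)
  have isoC: "isomorphism W h B C" unfolding C_def h_def by (rule isomorphism_shifted)
  have inj_h: "h x = h y \<longleftrightarrow> x = y" for x y by (simp add: h_def)
  have h_notin: "h x \<notin> univ B" for x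
  proof
    assume "h x \<in> univ B"
    then have "h x \<le> Max (univ B)" using prestructureD(1)[OF pB] by simp
    then show False by (simp add: h_def c_def)
  qed
  have univC: "univ C = h ` univ B" by (simp add: C_def shifted_def h_def)
  have relC: "rel C R = map h ` rel B R" for R by (simp add: C_def shifted_def h_def)
  have disj: "univ B \<inter> univ C = {}" using h_notin by (auto simp: univC)
  have pD: "prestructure W (\<sigma>(X \<mapsto> 1, Y \<mapsto> 1)) D"
    unfolding D_def using pB pC zero XY(1) by (rule prestructure_dsum)
  have E: "wstructure W \<sigma> E" unfolding E_def D_def using B C zero XY by (rule wstructure_reduct_dsum)
  then have pE: "prestructure W \<sigma> E" by (simp add: wstructure_def)
  have univE: "univ E = univ B \<union> h ` univ B" by (simp add: E_def D_def reduct_def dsum_def univC)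
  have relE: "rel E R = rel B R \<union> map h ` rel B R" for R
  proof (cases "R \<in> dom \<sigma>")
    case True
    then have "R \<noteq> X" "R \<noteq> Y" using XY by auto
    then show ?thesis using True by (simp add: E_def D_def reduct_def dsum_def relC)
  next
    case False
    then have "rel B R = {}" using prestructureD(3)[OF pB] by auto
    then show ?thesis using False by (simp add: E_def reduct_def)
  qed
  have GB: "gaifman B \<subseteq> univ B \<times> univ B" by (rule gaifman_subset[OF pB])
  have gaifE: "gaifman E = gaifman B \<union> (\<lambda>(a, b). (h a, h b)) ` gaifman B"
  proof (intro Set.set_eqI iffI)
    fix p
    assume "p \<in> gaifman E"
    then obtain a b R u where p: "p = (a, b)" "a \<noteq> b" "u \<in> rel E R" "a \<in> set u" "b \<in> set u"
      unfolding gaifman_def by blast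
    from p(3) consider "u \<in> rel B R" | v where "v \<in> rel B R" "u = map h v"
      unfolding relE by blast
    then show "p \<in> gaifman B \<union> (\<lambda>(a, b). (h a, h b)) ` gaifman B"
    proof cases
      case 1
      then show ?thesis using p unfolding gaifman_def by blast
    next
      case 2
      then obtain a' b' where "a = h a'" "b = h b'" "a' \<in> set v" "b' \<in> set v" using p by auto
      moreover from this have "(a', b') \<in> gaifman B" using p 2 unfolding gaifman_def by blast
      ultimately show ?thesis using p(1) by auto
    qed
  next
    fix p
    assume "p \<in> gaifman B \<union> (\<lambda>(a, b). (h a, h b)) ` gaifman B"
    then show "p \<in> gaifman E"
    proof
      assume "p \<in> gaifman B"
      then show ?thesis unfolding gaifman_def relE by blast
    next
      assume "p \<in> (\<lambda>(a, b). (h a, h b)) ` gaifman B"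
      then obtain a b R u where "p = (h a, h b)" "a \<noteq> b" "u \<in> rel B R" "a \<in> set u" "b \<in> set u"
        unfolding gaifman_def by auto
      moreover from this have "map h u \<in> rel E R" "h a \<in> set (map h u)" "h b \<in> set (map h u)" "h a \<noteq> h b"
        by (auto simp: relE inj_h)
      ultimately show ?thesis unfolding gaifman_def by blast
    qed
  qed
  \<comment> \<open>By \<open>gaifE\<close>, an edge of \<open>E\<close> stays within
    \<open>univ B\<close> or within the copy, so a walk never changes sides; this and
    \<open>powC\<close> follow by induction on the length.\<close>
  have powB: "(a, b) \<in> gaifman E ^^ i \<longleftrightarrow> (a, b) \<in> gaifman B ^^ i" if a: "a \<in> univ B" for a b i
  proof (induction i arbitrary: b)
    case (Suc i)
    have "(a, b) \<in> gaifman E ^^ Suc i \<longleftrightarrow> (\<exists>x. (a, x) \<in> gaifman B ^^ i \<and> (x, b) \<in> gaifman E)"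
      using Suc by auto
    also have "\<dots> \<longleftrightarrow> (\<exists>x. (a, x) \<in> gaifman B ^^ i \<and> (x, b) \<in> gaifman B)"
      using relpow_subset[OF GB a] h_notin unfolding gaifE by fast
    finally show ?case by auto
  qed simp
  have powC: "(h a, y) \<in> gaifman E ^^ i \<longleftrightarrow> (\<exists>b. y = h b \<and> (a, b) \<in> gaifman B ^^ i)" for a y i
  proof (induction i arbitrary: y)
    case (Suc i)
    have step: "(h x, y) \<in> gaifman E \<longleftrightarrow> (\<exists>b. y = h b \<and> (x, b) \<in> gaifman B)" for x
      unfolding gaifE using GB h_notin by (auto simp: inj_h)
    have "(h a, y) \<in> gaifman E ^^ Suc i \<longleftrightarrow> (\<exists>x. (a, x) \<in> gaifman B ^^ i \<and> (h x, y) \<in> gaifman E)"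
      using Suc by auto
    also have "\<dots> \<longleftrightarrow> (\<exists>b. y = h b \<and> (a, b) \<in> gaifman B ^^ Suc i)"
      unfolding step by auto
    finally show ?case .
  qed (auto simp: inj_h)
  define N where "N = nbh_set B r (s ` z)"
  define N' where "N' = nbh_set B r (s ` z')"
  have N_sub: "N \<subseteq> univ B" "N' \<subseteq> univ B" by (auto simp: N_def N'_def nbh_set_def)
  have nbhB: "nbh_set B r (s ` free L \<phi>) = N \<union> N'"
    unfolding free N_def N'_def set_eq_iff Un_iff mem_nbh_set_iff by blast
  have s_univ: "s u \<in> univ B" if "u \<in> z \<union> z'" for u using s that by (auto simp: free)
  have nbhE: "nbh_set E r (s ` z \<union> h ` s ` z') = N \<union> h ` N'"
  proof (intro equalityI subsetI)
    fix b
    assume "b \<in> nbh_set E r (s ` z \<union> h ` s ` z')"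
    then consider u i where "u \<in> z" "i \<le> r" "(s u, b) \<in> gaifman E ^^ i"
      | u i where "u \<in> z'" "i \<le> r" "(h (s u), b) \<in> gaifman E ^^ i"
      unfolding mem_nbh_set_iff by blast
    then show "b \<in> N \<union> h ` N'"
    proof cases
      case 1
      then have "(s u, b) \<in> gaifman B ^^ i" using s_univ by (simp add: powB)
      moreover from this have "b \<in> univ B" using relpow_subset[OF GB s_univ] 1 by blast
      ultimately show ?thesis using 1 unfolding N_def Un_iff mem_nbh_set_iff by blast
    next
      case 2
      then obtain b' where b': "b = h b'" "(s u, b') \<in> gaifman B ^^ i" by (auto simp: powC)
      moreover from this have "b' \<in> univ B" using relpow_subset[OF GB s_univ] 2 by blast
      ultimately have "b' \<in> N'" using 2 unfolding N'_def mem_nbh_set_iff by blast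
      then show ?thesis using b' by blast
    qed
  next
    fix b
    assume "b \<in> N \<union> h ` N'"
    then show "b \<in> nbh_set E r (s ` z \<union> h ` s ` z')"
    proof
      assume "b \<in> N"
      then obtain u i where "u \<in> z" "i \<le> r" "(s u, b) \<in> gaifman B ^^ i" "b \<in> univ B"
        unfolding N_def mem_nbh_set_iff by blast
      moreover from this have "(s u, b) \<in> gaifman E ^^ i" using s_univ by (simp add: powB)
      ultimately show ?thesis unfolding mem_nbh_set_iff univE by blast
    next
      assume "b \<in> h ` N'"
      then obtain b' where "b' \<in> N'" and b': "b = h b'" by blast
      then obtain u i where "u \<in> z'" "i \<le> r" "(s u, b') \<in> gaifman B ^^ i" "b' \<in> univ B"
        unfolding N'_def mem_nbh_set_iff by blast
      moreover from this have "(h (s u), b) \<in> gaifman E ^^ i" using b' by (auto simp: powC)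
      ultimately show ?thesis unfolding mem_nbh_set_iff univE using b' by blast
    qed
  qed
  \<comment> \<open>Here the constant arises: a walk of length at most 1 between the neighbourhoods
    extends to one of length at most \<open>r + 1 + r\<close> between the groups. Length 0 gives
    disjointness, length 1 the absence of edges.\<close>
  have sep: "(a, b) \<notin> gaifman B ^^ i" if a: "a \<in> N" and b: "b \<in> N'" and i: "i \<le> 1" for a b i
  proof
    assume ab: "(a, b) \<in> gaifman B ^^ i"
    from a obtain u j where u: "u \<in> z" "j \<le> r" "(s u, a) \<in> gaifman B ^^ j"
      by (auto simp: N_def mem_nbh_set_iff)
    from b obtain v k where v: "v \<in> z'" "k \<le> r" "(s v, b) \<in> gaifman B ^^ k"
      by (auto simp: N'_def mem_nbh_set_iff)
    have "(s u, s v) \<in> gaifman B ^^ (j + i + k)"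
      using relpow_add_elems[OF relpow_add_elems[OF u(3) ab] relpow_gaifman_sym[OF v(3)]] .
    then show False using far[OF u(1) v(1)] u(2) v(2) i by auto
  qed
  have NN': "a \<notin> N'" if "a \<in> N" for a using sep[of a a 0] that by auto
  have no_rel: False if "u \<in> rel B R" "a \<in> set u" "b \<in> set u" "a \<in> N" "b \<in> N'" for u R a b
  proof -
    have "(a, b) \<in> gaifman B" using that NN' unfolding gaifman_def by blast
    then show False using sep[of a b 1] that by simp
  qed
  \<comment> \<open>Moving only the second neighbourhood into the copy is an isomorphism onto its
    image exactly because nothing in \<open>B\<close> ties the two neighbourhoods together.\<close>
  define g where "g = (\<lambda>x. if x \<in> N' then h x else x)"
  have g_map: "set u \<subseteq> N \<Longrightarrow> map g u = u" "set u \<subseteq> N' \<Longrightarrow> map g u = map h u" for u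
    using NN' by (auto simp: g_def intro!: map_idI)
  have univs: "univ (nbh B r (s ` free L \<phi>)) = N \<union> N'" "univ (nbh E r (s ` z \<union> h ` s ` z')) = N \<union> h ` N'"
    unfolding nbh_def induced_def nbhB nbhE univE using N_sub by auto
  have rels: "rel (nbh B r (s ` free L \<phi>)) R = {u \<in> rel B R. set u \<subseteq> N \<union> N'}"
    "rel (nbh E r (s ` z \<union> h ` s ` z')) R = {u \<in> rel E R. set u \<subseteq> N \<union> h ` N'}" for R
    unfolding nbh_def induced_def nbhB nbhE by auto
  have wts: "wt (nbh B r (s ` free L \<phi>)) w t = (if set t \<subseteq> N \<union> N' then wt B w t else undefined)"
    "wt (nbh E r (s ` z \<union> h ` s ` z')) w t = (if set t \<subseteq> N \<union> h ` N' then wt E w t else undefined)" for w t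
    unfolding nbh_def induced_def nbhB nbhE by auto
  have iso: "isomorphism W g (nbh B r (s ` free L \<phi>)) (nbh E r (s ` z \<union> h ` s ` z'))"
    unfolding isomorphism_def
  proof (intro conjI allI impI)
    have "inj_on g (N \<union> N')"
      using N_sub h_notin by (auto simp: inj_on_def g_def inj_h split: if_splits)
    moreover have "g ` (N \<union> N') = N \<union> h ` N'"
      using NN' by (auto simp: g_def)
    ultimately show "bij_betw g (univ (nbh B r (s ` free L \<phi>))) (univ (nbh E r (s ` z \<union> h ` s ` z')))"
      unfolding univs bij_betw_def by blast
  next
    fix R
    show "rel (nbh E r (s ` z \<union> h ` s ` z')) R = map g ` rel (nbh B r (s ` free L \<phi>)) R"
      unfolding rels
    proof (intro Set.set_eqI iffI)
      fix u
      assume "u \<in> {u \<in> rel E R. set u \<subseteq> N \<union> h ` N'}"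
      then have u: "u \<in> rel E R" "set u \<subseteq> N \<union> h ` N'" by auto
      from u(1) consider "u \<in> rel B R" | v where "v \<in> rel B R" "u = map h v" unfolding relE by blast
      then show "u \<in> map g ` {u \<in> rel B R. set u \<subseteq> N \<union> N'}"
      proof cases
        case 1
        then have "set u \<subseteq> univ B" by (rule prestructure_rel_subset[OF pB])
        then have "set u \<subseteq> N" using u(2) h_notin by blast
        then show ?thesis using 1 g_map(1)[of u] by (intro image_eqI[of _ _ u]) auto
      next
        case 2
        have "x \<in> N'" if "x \<in> set v" for x
        proof -
          have "h x \<in> N \<union> h ` N'" using u(2) 2 that by auto
          then have "h x \<in> h ` N'" using N_sub h_notin by blast
          then show ?thesis by (auto simp: inj_h)
        qed
        then have "set v \<subseteq> N'" by blast
        then show ?thesis using 2 g_map(2)[of v] by (intro image_eqI[of _ _ v]) auto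
      qed
    next
      fix u
      assume "u \<in> map g ` {u \<in> rel B R. set u \<subseteq> N \<union> N'}"
      then obtain v where v: "v \<in> rel B R" "set v \<subseteq> N \<union> N'" "u = map g v" by auto
      then consider "set v \<subseteq> N" | "set v \<subseteq> N'" using no_rel[OF v(1)] by blast
      then show "u \<in> {u \<in> rel E R. set u \<subseteq> N \<union> h ` N'}"
      proof cases
        case 1
        then show ?thesis using v g_map(1)[of v] by (auto simp: relE)
      next
        case 2
        then show ?thesis using v g_map(2)[of v] by (auto simp: relE)
      qed
    qed
  next
    fix w m G t
    assume w: "W w = Some (m, G)" and t: "t \<in> tuples m (univ (nbh B r (s ` free L \<phi>)))"
    then have t: "length t = m" "set t \<subseteq> N \<union> N'" by (auto simp: tuples_def univs)
    then have tB: "t \<in> tuples m (univ B)" using N_sub by (auto simp: tuples_def)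
    have wtE: "wt E w u = (if u \<in> tuples m (univ B) then wt B w u
        else if u \<in> tuples m (univ C) then wt C w u
        else if u \<in> tuples m (univ B \<union> univ C) then \<zero>\<^bsub>G\<^esub> else undefined)" for u
      using w by (simp add: E_def D_def reduct_def dsum_def)
    have gt: "set (map g t) \<subseteq> N \<union> h ` N'" using t by (auto simp: g_def)
    have "wt E w (map g t) = wt B w t"
    proof -
      \<comment> \<open>The empty tuple falls under the first case, since the weights of the sum are
        looked up in \<open>B\<close> first.\<close>
      consider "set t \<subseteq> N" | "set t \<subseteq> N'" "t \<noteq> []" | a b where "a \<in> set t" "b \<in> set t" "a \<in> N" "b \<in> N'"
        using t(2) by fastforce
      then show ?thesis
      proof cases
        case 1
        then show ?thesis using tB by (simp add: g_map wtE)
      next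
        case 2
        have hd: "h (hd t) \<in> set (map h t)" using 2 by simp
        then have "map h t \<notin> tuples m (univ B)" using h_notin unfolding tuples_def by blast
        moreover have "map h t \<in> tuples m (univ C)" using tB by (auto simp: tuples_def univC)
        moreover have "wt C w (map h t) = wt B w t"
          using isoC w tB unfolding isomorphism_def by blast
        ultimately show ?thesis using 2 by (simp add: g_map wtE)
      next
        case 3
        have "a \<noteq> b" using 3 NN' by blast
        have "g b \<notin> univ B" "g b \<in> set (map g t)" using 3 h_notin by (auto simp: g_def)
        then have 1: "map g t \<notin> tuples m (univ B)" unfolding tuples_def by blast
        have "a \<notin> h ` univ B" "a \<in> set (map g t)"
          using 3 NN' N_sub h_notin by (auto simp: g_def image_iff)
        then have 2: "map g t \<notin> tuples m (univ C)" unfolding tuples_def univC by blast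
        have 4: "map g t \<in> tuples m (univ B \<union> univ C)"
          using t tB by (auto simp: tuples_def univC g_def)
        \<comment> \<open>The sum assigns zero to tuples that meet both sides. A nonzero weight in
          \<open>B\<close> would need a relation tuple containing both \<open>a\<close> and
          \<open>b\<close>, hence an edge between the neighbourhoods.\<close>
        have "wt B w t = \<zero>\<^bsub>G\<^esub>"
        proof (rule ccontr)
          assume "wt B w t \<noteq> \<zero>\<^bsub>G\<^esub>"
          then have "m = 1 \<or> (\<forall>a\<in>set t. \<forall>b\<in>set t. a = b) \<or> (\<exists>R. \<exists>u\<in>rel B R. set t \<subseteq> set u)"
            using B w tB unfolding wstructure_def by blast
          moreover have "m \<noteq> 1"
          proof
            assume "m = 1"
            then obtain x where "t = [x]" using t(1) by (auto simp: length_Suc_conv)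
            then show False using 3 \<open>a \<noteq> b\<close> by simp
          qed
          ultimately show False using 3 \<open>a \<noteq> b\<close> no_rel by blast
        qed
        then show ?thesis using 1 2 4 by (simp add: wtE)
      qed
    qed
    then show "wt (nbh E r (s ` z \<union> h ` s ` z')) w (map g t) = wt (nbh B r (s ` free L \<phi>)) w t"
      unfolding wts using gt t(2) by simp
  qed
  define s' where "s' = (\<lambda>v. if v \<in> z' then h (s v) else s v)"
  have s'_z: "s' v = s v" if "v \<in> z" for v using that free(2) by (auto simp: s'_def)
  have s'_free: "s' ` free L \<phi> = s ` z \<union> h ` s ` z'"
  proof -
    have "s' ` z = s ` z" using s'_z by (rule image_cong[OF refl])
    moreover have "s' ` z' = h ` s ` z'"
      unfolding image_image by (rule image_cong) (simp_all add: s'_def)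
    ultimately show ?thesis by (simp add: free image_Un)
  qed
  have s'_E: "s' ` free L \<phi> \<subseteq> univ E" unfolding s'_free univE using s free by auto
  have in_N: "s ` z \<subseteq> N" "s ` z' \<subseteq> N'"
  proof -
    have "x \<in> nbh_set B r Z" if "x \<in> Z" "x \<in> univ B" for x Z
      unfolding mem_nbh_set_iff using that relpow_0_I[of x "gaifman B"] by blast
    then show "s ` z \<subseteq> N" "s ` z' \<subseteq> N'" using s_univ unfolding N_def N'_def by blast+
  qed
  have s_nbh: "s ` free L \<phi> \<subseteq> univ (nbh B r (s ` free L \<phi>))"
    unfolding univs unfolding free using in_N by auto
  have "s' ` free L \<phi> \<subseteq> N \<union> h ` N'" unfolding s'_free using in_N by auto
  then have s'_nbh: "s' ` free L \<phi> \<subseteq> univ (nbh E r (s ` z \<union> h ` s ` z'))" unfolding univs .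
  have pnB: "prestructure W \<sigma> (nbh B r (s ` free L \<phi>))"
    unfolding nbh_def using s_nbh free(3)
    by (intro prestructure_induced[OF pB]) (auto simp: nbh_def induced_def)
  have pnE: "prestructure W \<sigma> (nbh E r (s ` z \<union> h ` s ` z'))"
    unfolding nbh_def using s'_nbh free(3)
    by (intro prestructure_induced[OF pE]) (auto simp: nbh_def induced_def)
  \<comment> \<open>Locality is applied twice, in \<open>B\<close> and in \<open>E\<close>: these
    structures differ globally, but the neighbourhoods of the assigned elements are isomorphic. From
    \<open>E\<close> one returns to the sum \<open>D\<close>, of which it is a reduct, and splits
    \<phi> there.\<close>
  have "sat L B \<phi> s = sat L (nbh B r (s ` free L \<phi>)) \<phi> s"
    using \<phi>(2) B s free(3) unfolding r_local_def by blast
  also have "\<dots> = sat L (nbh E r (s ` z \<union> h ` s ` z')) \<phi> (g \<circ> s)"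
    by (rule is_logicD(4)[OF L \<phi>(1) pnB pnE iso s_nbh])
  also have "\<dots> = sat L (nbh E r (s ` z \<union> h ` s ` z')) \<phi> s'"
  proof (rule sym, rule is_logicD(2)[OF L \<phi>(1) pnE s'_nbh])
    fix v
    assume "v \<in> free L \<phi>"
    then show "s' v = (g \<circ> s) v"
      unfolding free s'_def g_def using in_N NN' by auto
  qed
  also have "\<dots> = sat L E \<phi> s'"
    using \<phi>(2) E s'_E free(3) s'_free unfolding r_local_def by metis
  also have "\<dots> = sat L D \<phi> s'"
    unfolding E_def using s'_E XY(2,3)
    by (intro is_logicD(3)[OF L \<phi>(1) _ pD, symmetric])
      (auto simp: map_le_def E_def reduct_def)
  also have "\<dots> \<longleftrightarrow> (\<exists>(\<alpha>, \<beta>)\<in>\<Delta>. sat L B \<alpha> s' \<and> sat L C \<beta> s')"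
  proof -
    have "s' ` z \<subseteq> univ B" "s' ` z' \<subseteq> univ C"
      using s free s'_z by (auto simp: univC s'_def)
    then show ?thesis using fv B C disj unfolding fv_decomposition_def D_def by blast
  qed
  also have "\<dots> \<longleftrightarrow> (\<exists>(\<alpha>, \<beta>)\<in>\<Delta>. sat L B \<alpha> s \<and> sat L B \<beta> s)"
  proof -
    have "sat L B \<alpha> s' = sat L B \<alpha> s \<and> sat L C \<beta> s' = sat L B \<beta> s" if "(\<alpha>, \<beta>) \<in> \<Delta>" for \<alpha> \<beta>
    proof
      have ab: "\<alpha> \<in> formulas L \<sigma>" "\<beta> \<in> formulas L \<sigma>" "free L \<alpha> \<subseteq> z" "free L \<beta> \<subseteq> z'"
        using fv \<Phi> that unfolding fv_decomposition_def by blast+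
      show "sat L B \<alpha> s' = sat L B \<alpha> s"
        using s ab(3) s'_z by (intro sym[OF is_logicD(2)[OF L ab(1) pB]]) (auto simp: free)
      have sz: "s ` free L \<beta> \<subseteq> univ B" using s ab(4) by (auto simp: free)
      have "sat L B \<beta> s = sat L C \<beta> (h \<circ> s)"
        by (rule is_logicD(4)[OF L ab(2) pB pC isoC sz])
      also have "\<dots> = sat L C \<beta> s'"
        using sz ab(4) by (intro is_logicD(2)[OF L ab(2) pC]) (auto simp: univC s'_def)
      finally show "sat L C \<beta> s' = sat L B \<beta> s" ..
    qed
    then show ?thesis by fast
  qed
  finally show ?thesis .
qed

section \<open>Parameters near the examples\<close>

text \<open>The set is a maximal one with the first two properties.\<close>

lemma ex_closed_near_set:
  fixes G :: "('a \<times> 'a) set" and v :: "nat \<Rightarrow> 'a"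
  obtains I where "I \<subseteq> {..<l}" and "\<And>j. j \<in> I \<Longrightarrow> \<exists>z\<in>Z. \<exists>i\<le>card I * R. (z, v j) \<in> G ^^ i"
    and "\<And>j z i. j < l \<Longrightarrow> j \<notin> I \<Longrightarrow> z \<in> Z \<union> v ` I \<Longrightarrow> i \<le> R \<Longrightarrow> (z, v j) \<notin> G ^^ i"
proof -
  define F where "F = {I. I \<subseteq> {..<l} \<and> (\<forall>j\<in>I. \<exists>z\<in>Z. \<exists>i\<le>card I * R. (z, v j) \<in> G ^^ i)}"
  have "finite F" unfolding F_def by (rule finite_subset[of _ "Pow {..<l}"]) auto
  moreover have "{} \<in> F" by (simp add: F_def)
  ultimately obtain I where I: "I \<in> F" "\<And>J. J \<in> F \<Longrightarrow> I \<subseteq> J \<Longrightarrow> I = J"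
    using finite_has_maximal[of F] by blast
  have sub: "I \<subseteq> {..<l}" and near: "\<And>j. j \<in> I \<Longrightarrow> \<exists>z\<in>Z. \<exists>i\<le>card I * R. (z, v j) \<in> G ^^ i"
    using I(1) by (auto simp: F_def)
  have fin: "finite I" using sub finite_subset by blast
  have "(z, v j) \<notin> G ^^ i" if j: "j < l" "j \<notin> I" and z: "z \<in> Z \<union> v ` I" and i: "i \<le> R" for j z i
  proof
    assume edge: "(z, v j) \<in> G ^^ i"
    have card: "card (insert j I) = Suc (card I)" using fin j by simp
    \<comment> \<open>The radius in \<open>F\<close> grows with the cardinality of the set, so a
      further index is granted \<open>R\<close> additional steps. An index within \<open>R\<close>
      of the examples or of a collected entry could thus be added, against maximality.\<close>
    have "\<exists>z\<in>Z. \<exists>i\<le>Suc (card I) * R. (z, v j) \<in> G ^^ i"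
    proof (cases "z \<in> Z")
      case True
      then show ?thesis using edge i by (intro bexI[of _ z] exI[of _ i]) auto
    next
      case False
      then obtain j' where "j' \<in> I" "z = v j'" using z by auto
      then obtain z' i' where "z' \<in> Z" "i' \<le> card I * R" "(z', z) \<in> G ^^ i'" using near by blast
      moreover from this have "(z', v j) \<in> G ^^ (i' + i)" using relpow_add_elems edge by metis
      ultimately show ?thesis using i by (intro bexI[of _ z'] exI[of _ "i' + i"]) auto
    qed
    moreover have "\<exists>z\<in>Z. \<exists>i\<le>Suc (card I) * R. (z, v j') \<in> G ^^ i" if j': "j' \<in> I" for j'
    proof -
      obtain z i where "z \<in> Z" "i \<le> card I * R" "(z, v j') \<in> G ^^ i" using near[OF j'] by blast
      moreover from this have "i \<le> Suc (card I) * R" by simp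
      ultimately show ?thesis by blast
    qed
    ultimately have "insert j I \<in> F" using sub j(1) unfolding F_def mem_Collect_eq card by blast
    then show False using I(2)[of "insert j I"] j(2) by blast
  qed
  then show ?thesis using sub near that by blast
qed

text \<open>The empty disjunction has to be falsity. It is obtained as the negation of a tautology
  \<open>\<phi> \<or> \<not> \<phi>\<close>, for which some member \<phi> of the set must be at
  hand.\<close>

lemma ex_finite_disjunction:
  assumes "finite D" and "D \<subseteq> \<Phi>" and "\<phi> \<in> \<Phi>"
    and neg: "\<And>\<psi>. \<psi> \<in> \<Phi> \<Longrightarrow> \<exists>\<chi>\<in>\<Phi>. equivalent W \<sigma> (\<lambda>A. sat L A \<chi>) (\<lambda>A s. \<not> sat L A \<psi> s)"
    and disj: "\<And>\<psi>1 \<psi>2. \<psi>1 \<in> \<Phi> \<Longrightarrow> \<psi>2 \<in> \<Phi> \<Longrightarrow>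
      \<exists>\<chi>\<in>\<Phi>. equivalent W \<sigma> (\<lambda>A. sat L A \<chi>) (\<lambda>A s. sat L A \<psi>1 s \<or> sat L A \<psi>2 s)"
  shows "\<exists>\<chi>\<in>\<Phi>. equivalent W \<sigma> (\<lambda>A. sat L A \<chi>) (\<lambda>A s. \<exists>\<alpha>\<in>D. sat L A \<alpha> s)"
  using assms(1,2)
proof (induction D rule: finite_induct)
  case empty
  obtain \<psi>1 where 1: "\<psi>1 \<in> \<Phi>" "equivalent W \<sigma> (\<lambda>A. sat L A \<psi>1) (\<lambda>A s. \<not> sat L A \<phi> s)"
    using neg[OF assms(3)] by blast
  obtain \<psi>2 where 2: "\<psi>2 \<in> \<Phi>" "equivalent W \<sigma> (\<lambda>A. sat L A \<psi>2) (\<lambda>A s. sat L A \<phi> s \<or> sat L A \<psi>1 s)"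
    using disj[OF assms(3) 1(1)] by blast
  obtain \<chi> where "\<chi> \<in> \<Phi>" "equivalent W \<sigma> (\<lambda>A. sat L A \<chi>) (\<lambda>A s. \<not> sat L A \<psi>2 s)"
    using neg[OF 2(1)] by blast
  moreover from this have "equivalent W \<sigma> (\<lambda>A. sat L A \<chi>) (\<lambda>A s. \<exists>\<alpha>\<in>{}. sat L A \<alpha> s)"
    using 1(2) 2(2) unfolding equivalent_def by simp
  ultimately show ?case by blast
next
  case (insert \<alpha> D)
  then obtain \<psi> where \<psi>: "\<psi> \<in> \<Phi>" "equivalent W \<sigma> (\<lambda>A. sat L A \<psi>) (\<lambda>A s. \<exists>\<alpha>\<in>D. sat L A \<alpha> s)"
    by blast
  obtain \<chi> where "\<chi> \<in> \<Phi>" "equivalent W \<sigma> (\<lambda>A. sat L A \<chi>) (\<lambda>A s. sat L A \<alpha> s \<or> sat L A \<psi> s)"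
    using disj[of \<alpha> \<psi>] insert.prems \<psi>(1) by blast
  moreover from this have
    "equivalent W \<sigma> (\<lambda>A. sat L A \<chi>) (\<lambda>A s. \<exists>\<alpha>\<in>insert \<alpha> D. sat L A \<alpha> s)"
    using \<psi>(2) unfolding equivalent_def by simp
  ultimately show ?case by blast
qed

lemma map_of_zip_append_nth:
  assumes "distinct (xs @ ys)" and "length as = length xs" and "length ws = length ys"
  shows "i < length xs \<Longrightarrow> the (map_of (zip (xs @ ys) (as @ ws)) (xs ! i)) = as ! i"
    and "j < length ys \<Longrightarrow> the (map_of (zip (xs @ ys) (as @ ws)) (ys ! j)) = ws ! j"
  using map_of_zip_nth[of "xs @ ys" "as @ ws" i] map_of_zip_nth[of "xs @ ys" "as @ ws" "length xs + j"]
    assms by (auto simp: nth_append)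

text \<open>This is what makes a rejection sound. The new formula may still have far variables free,
  but it is equivalent to a disjunction of formulas \<alpha> without them; hence any element
  \<open>c\<close> can be put in the far positions.\<close>

lemma ex_near_parameters:
  assumes L: "is_logic W L" and B: "wstructure W \<sigma> B"
    and zero: "\<And>w m G. W w = Some (m, G) \<Longrightarrow> \<zero>\<^bsub>G\<^esub> \<in> carrier G"
    and XY: "X \<noteq> Y" "X \<notin> dom \<sigma>" "Y \<notin> dom \<sigma>"
    and \<Phi>: "formulas_in L \<sigma> (xs @ ys) \<Phi>" and dist: "distinct (xs @ ys)"
    and loc: "\<And>\<psi>. \<psi> \<in> \<Phi> \<Longrightarrow> r_local W L \<sigma> r \<psi>"
    and fv: "\<And>\<psi> z z'. \<psi> \<in> \<Phi> \<Longrightarrow> z \<union> z' = free L \<psi> \<Longrightarrow> z \<inter> z' = {} \<Longrightarrow>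
      \<exists>\<Delta>. fv_decomposition W X Y L \<sigma> \<Phi> \<psi> z z' \<Delta>"
    and neg: "\<And>\<psi>. \<psi> \<in> \<Phi> \<Longrightarrow> \<exists>\<chi>\<in>\<Phi>. equivalent W \<sigma> (\<lambda>A. sat L A \<chi>) (\<lambda>A s. \<not> sat L A \<psi> s)"
    and disj: "\<And>\<psi>1 \<psi>2. \<psi>1 \<in> \<Phi> \<Longrightarrow> \<psi>2 \<in> \<Phi> \<Longrightarrow>
      \<exists>\<chi>\<in>\<Phi>. equivalent W \<sigma> (\<lambda>A. sat L A \<chi>) (\<lambda>A s. sat L A \<psi>1 s \<or> sat L A \<psi>2 s)"
    and \<phi>: "\<phi> \<in> \<Phi>" and vs: "vs \<in> tuples (length ys) (univ B)"
    and T: "T \<subseteq> tuples (length xs) (univ B)" and c: "c \<in> univ B"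
  shows "\<exists>\<psi>\<in>\<Phi>. \<exists>us\<in>tuples (length ys) (univ B).
     (\<forall>u\<in>set us. u = c \<or> (\<exists>z\<in>\<Union> (set ` T). \<exists>i\<le>length ys * (2 * r + 1). (z, u) \<in> gaifman B ^^ i)) \<and>
     (\<forall>as\<in>T. models L B \<psi> (xs @ ys) (as @ us) \<longleftrightarrow> models L B \<phi> (xs @ ys) (as @ vs))"
proof -
  define l where "l = length ys"
  define R where "R = 2 * r + 1"
  define Z where "Z = \<Union> (set ` T)"
  have pB: "prestructure W \<sigma> B" using B by (simp add: wstructure_def)
  have \<Phi>f: "\<Phi> \<subseteq> formulas L \<sigma>" and free: "\<psi> \<in> \<Phi> \<Longrightarrow> free L \<psi> \<subseteq> set (xs @ ys)" for \<psi>
    using \<Phi> unfolding formulas_in_def by blast+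
  obtain I where I: "I \<subseteq> {..<l}" "\<And>j. j \<in> I \<Longrightarrow> \<exists>z\<in>Z. \<exists>i\<le>card I * R. (z, vs ! j) \<in> gaifman B ^^ i"
    and far: "\<And>j z i. j < l \<Longrightarrow> j \<notin> I \<Longrightarrow> z \<in> Z \<union> (!) vs ` I \<Longrightarrow> i \<le> R \<Longrightarrow> (z, vs ! j) \<notin> gaifman B ^^ i"
    by (rule ex_closed_near_set[of l Z R "(!) vs" "gaifman B"]) (rule that; assumption)
  define us where "us = map (\<lambda>j. if j \<in> I then vs ! j else c) [0..<l]"
  have len: "length vs = l" "length us = l" using vs by (auto simp: tuples_def l_def us_def)
  have vs_in: "vs ! j \<in> univ B" if "j < l" for j
    using vs that len(1) nth_mem[of j vs] unfolding tuples_def by blast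
  have us_nth: "us ! j = (if j \<in> I then vs ! j else c)" if "j < l" for j using that by (simp add: us_def)
  have us: "us \<in> tuples l (univ B)" using vs_in c by (auto simp: tuples_def us_def)
  have near: "u = c \<or> (\<exists>z\<in>Z. \<exists>i\<le>l * R. (z, u) \<in> gaifman B ^^ i)" if "u \<in> set us" for u
  proof -
    from that obtain j where j: "j < l" "u = us ! j" by (auto simp: us_def)
    show ?thesis
    proof (cases "j \<in> I")
      case True
      then obtain z i where "z \<in> Z" "i \<le> card I * R" "(z, u) \<in> gaifman B ^^ i"
        using I(2) us_nth j by metis
      moreover have "card I * R \<le> l * R" using card_mono[OF _ I(1)] by simp
      ultimately show ?thesis using order_trans by blast
    qed (use j us_nth in auto)
  qed
  define asg where "asg = (\<lambda>as (ws :: nat list) v. the (map_of (zip (xs @ ys) (as @ ws)) v))"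
  have models: "models L B \<psi> (xs @ ys) (as @ ws) = sat L B \<psi> (asg as ws)" for \<psi> as ws
    by (simp add: models_def asg_def)
  have asg_x: "asg as ws (xs ! i) = as ! i" if "as \<in> T" "length ws = l" "i < length xs" for as ws i
    unfolding asg_def using map_of_zip_append_nth(1)[OF dist] that T by (auto simp: tuples_def l_def)
  have asg_y: "asg as ws (ys ! j) = ws ! j" if "as \<in> T" "length ws = l" "j < l" for as ws j
    unfolding asg_def using map_of_zip_append_nth(2)[OF dist] that T by (auto simp: tuples_def l_def)
  have asg_univ: "asg as ws v \<in> univ B"
    if as: "as \<in> T" and ws: "ws \<in> tuples l (univ B)" and v: "v \<in> set (xs @ ys)" for as ws v
  proof -
    have len: "length ws = l" "length as = length xs" using as ws T by (auto simp: tuples_def)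
    have "set as \<subseteq> univ B" "set ws \<subseteq> univ B" using as ws T by (auto simp: tuples_def)
    moreover consider i where "i < length xs" "v = xs ! i" | j where "j < l" "v = ys ! j"
      using v unfolding l_def by (auto simp: in_set_conv_nth)
    then have "asg as ws v \<in> set as \<union> set ws"
      by cases (auto simp: asg_x asg_y as len)
    ultimately show ?thesis by blast
  qed
  have vs_l: "vs \<in> tuples l (univ B)" using vs by (simp add: l_def)
  show ?thesis
  \<comment> \<open>Locality says nothing about sentences. Their truth does not depend on the
    assignment, so \<phi> itself can be kept.\<close>
  proof (cases "free L \<phi> = {}")
    case True
    then have "models L B \<phi> (xs @ ys) (as @ us) = models L B \<phi> (xs @ ys) (as @ vs)" for as
      unfolding models using \<Phi>f \<phi> by (intro is_logicD(2)[OF L _ pB]) auto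
    then show ?thesis using \<phi> us near unfolding l_def Z_def R_def by blast
  next
    case False
    \<comment> \<open>The variables of the far parameters. All others count as near, including those
      of the example, so that the first half of the decomposition sees the whole example.\<close>
    define Yf where "Yf = (!) ys ` ({..<l} - I)"
    have Yf: "ys ! j \<in> Yf \<longleftrightarrow> j \<notin> I" if "j < l" for j
      using that dist unfolding Yf_def l_def by (auto simp: nth_eq_iff_index_eq)
    define z where "z = free L \<phi> - Yf"
    define z' where "z' = free L \<phi> \<inter> Yf"
    have zz': "z \<union> z' = free L \<phi>" "z \<inter> z' = {}" by (auto simp: z_def z'_def)
    obtain \<Delta> where \<Delta>: "fv_decomposition W X Y L \<sigma> \<Phi> \<phi> z z' \<Delta>" using fv[OF \<phi> zz'] by blast
    then have fin\<Delta>: "finite \<Delta>" and \<Delta>\<Phi>: "\<Delta> \<subseteq> \<Phi> \<times> \<Phi>"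
      and \<Delta>free: "\<And>\<alpha> \<beta>. (\<alpha>, \<beta>) \<in> \<Delta> \<Longrightarrow> free L \<alpha> \<subseteq> z \<and> free L \<beta> \<subseteq> z'"
      unfolding fv_decomposition_def by blast+
    \<comment> \<open>This assignment uses the parameters only. It agrees with
      \<open>asg as vs\<close> on far variables for every example, so the set \<open>D\<close> below
      is the same for all examples.\<close>
    define sv where "sv = (\<lambda>v. the (map_of (zip ys vs) v))"
    have sv: "sv (ys ! j) = vs ! j" if "j < l" for j
      unfolding sv_def using map_of_zip_nth[of ys vs j] dist len that by (simp add: l_def)
    define D where "D = {\<alpha>. \<exists>\<beta>. (\<alpha>, \<beta>) \<in> \<Delta> \<and> sat L B \<beta> sv}"
    have "D \<subseteq> fst ` \<Delta>" by (force simp: D_def)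
    then have finD: "finite D" using fin\<Delta> finite_surj by blast
    have D\<Phi>: "D \<subseteq> \<Phi>" using \<Delta>\<Phi> by (auto simp: D_def)
    obtain \<chi> where \<chi>: "\<chi> \<in> \<Phi>" "equivalent W \<sigma> (\<lambda>A. sat L A \<chi>) (\<lambda>A s. \<exists>\<alpha>\<in>D. sat L A \<alpha> s)"
      using ex_finite_disjunction[OF finD D\<Phi> \<phi> neg disj] by blast
    have "models L B \<chi> (xs @ ys) (as @ us) \<longleftrightarrow> models L B \<phi> (xs @ ys) (as @ vs)" if as: "as \<in> T" for as
    proof -
      have sub: "asg as vs ` free L \<phi> \<subseteq> univ B"
        using asg_univ[OF as vs_l] free[OF \<phi>] by blast
      have fars: "(asg as vs u, asg as vs v) \<notin> gaifman B ^^ i"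
        if u: "u \<in> z" and v: "v \<in> z'" and i: "i \<le> 2 * r + 1" for u v i
      proof -
        obtain j where j: "j < l" "j \<notin> I" "v = ys ! j" using v by (auto simp: z'_def Yf_def)
        have "u \<in> set (xs @ ys)" using u free[OF \<phi>] by (auto simp: z_def)
        then consider i where "i < length xs" "u = xs ! i" | j where "j < l" "u = ys ! j"
          unfolding l_def by (auto simp: in_set_conv_nth)
        then have "asg as vs u \<in> Z \<union> (!) vs ` I"
        proof cases
          case 1
          then have "asg as vs u \<in> set as" using asg_x[OF as len(1)] as T by (auto simp: tuples_def)
          then show ?thesis using as by (auto simp: Z_def)
        next
          case 2
          then have "j \<in> I" using u Yf by (auto simp: z_def)
          then show ?thesis using 2 asg_y[OF as len(1)] by auto
        qed
        then show ?thesis using far[OF j(1,2)] asg_y[OF as len(1) j(1)] i j(3) by (auto simp: R_def)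
      qed
      have \<phi>f: "\<phi> \<in> formulas L \<sigma>" using \<phi> \<Phi>f by blast
      have "sat L B \<phi> (asg as vs) \<longleftrightarrow>
          (\<exists>(\<alpha>, \<beta>)\<in>\<Delta>. sat L B \<alpha> (asg as vs) \<and> sat L B \<beta> (asg as vs))"
        by (rule sat_fv_decomposition_far[OF L B _ XY \<phi>f loc[OF \<phi>] \<Phi>f \<Delta> zz'(1)[symmetric] zz'(2) False sub])
          (rule zero fars; assumption)+
      also have "\<dots> \<longleftrightarrow> (\<exists>\<alpha>\<in>D. sat L B \<alpha> (asg as vs))"
      proof -
        have "sat L B \<beta> (asg as vs) = sat L B \<beta> sv" if "(\<alpha>, \<beta>) \<in> \<Delta>" for \<alpha> \<beta>
        proof (rule is_logicD(2)[OF L _ pB])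
          show "\<beta> \<in> formulas L \<sigma>" using that \<Delta>\<Phi> \<Phi>f by blast
          show "asg as vs ` free L \<beta> \<subseteq> univ B" using \<Delta>free[OF that] sub zz'(1) by blast
          show "asg as vs v = sv v" if "v \<in> free L \<beta>" for v
          proof -
            have "v \<in> Yf" using that \<Delta>free[OF \<open>(\<alpha>, \<beta>) \<in> \<Delta>\<close>] by (auto simp: z'_def)
            then obtain j where "j < l" "v = ys ! j" by (auto simp: Yf_def)
            then show ?thesis using asg_y[OF as len(1)] sv by simp
          qed
        qed
        then show ?thesis unfolding D_def by blast
      qed
      also have "\<dots> \<longleftrightarrow> sat L B \<chi> (asg as us)"
      proof -
        \<comment> \<open>\<open>equivalent\<close> quantifies over assignments that map all
          variables into the universe, whereas \<open>asg\<close> is unspecified outside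
          \<open>xs @ ys\<close>; there \<open>c\<close> is substituted.\<close>
        define t where "t = (\<lambda>v. if v \<in> set (xs @ ys) then asg as us v else c)"
        have t: "range t \<subseteq> univ B" using asg_univ[OF as us] c by (auto simp: t_def)
        have "sat L B \<chi> (asg as us) = sat L B \<chi> t"
          using \<chi>(1) \<Phi>f free[OF \<chi>(1)] asg_univ[OF as us]
          by (intro is_logicD(2)[OF L _ pB]) (auto simp: t_def)
        also have "\<dots> \<longleftrightarrow> (\<exists>\<alpha>\<in>D. sat L B \<alpha> t)"
          using \<chi>(2) B t unfolding equivalent_def by blast
        also have "\<dots> \<longleftrightarrow> (\<exists>\<alpha>\<in>D. sat L B \<alpha> (asg as vs))"
        proof (intro bex_cong refl)
          fix \<alpha>
          assume "\<alpha> \<in> D"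
          then have fz: "free L \<alpha> \<subseteq> z" using \<Delta>free by (auto simp: D_def)
          show "sat L B \<alpha> t = sat L B \<alpha> (asg as vs)"
          proof (rule is_logicD(2)[OF L _ pB])
            show "\<alpha> \<in> formulas L \<sigma>" using \<open>\<alpha> \<in> D\<close> D\<Phi> \<Phi>f by blast
            show "t ` free L \<alpha> \<subseteq> univ B" using t by blast
            show "t v = asg as vs v" if "v \<in> free L \<alpha>" for v
            proof -
              have v: "v \<in> z" "v \<in> set (xs @ ys)" using that fz free[OF \<phi>] by (auto simp: z_def)
              then consider i where "i < length xs" "v = xs ! i" | j where "j < l" "v = ys ! j"
                unfolding l_def by (auto simp: in_set_conv_nth)
              then show ?thesis
              proof cases
                case 1
                then show ?thesis using v asg_x[OF as] len by (simp add: t_def)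
              next
                case 2
                then have "j \<in> I" using v(1) Yf by (auto simp: z_def)
                then show ?thesis using 2 v(2) asg_y[OF as] len us_nth by (simp add: t_def)
              qed
            qed
          qed
        qed
        finally show ?thesis ..
      qed
      finally show ?thesis unfolding models ..
    qed
    then show ?thesis using \<chi>(1) us near unfolding l_def Z_def R_def by blast
  qed
qed

section \<open>Cost bounds for programs\<close>

text \<open>The cost of an expression in units of the length of the largest cell. An intermediate
  sum may exceed every cell, but its length is at most the sum of the lengths of its operands, each
  of which is bounded by the cost of that operand; hence the doubling. A comparison yields a single
  bit, of cost at most 2.\<close>

fun exp_size :: "exp \<Rightarrow> nat" where
  "exp_size (Num x) = size_cost x"
| "exp_size (Cell b e) = exp_size e + 1"
| "exp_size (Add e e') = 2 * (exp_size e + exp_size e')"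
| "exp_size (Sub e e') = 2 * (exp_size e + exp_size e')"
| "exp_size (Less e e') = exp_size e + exp_size e' + 2"

lemma size_cost_mono: "x \<le> y \<Longrightarrow> size_cost x \<le> size_cost y"
  by (simp add: size_cost_def floorlog_mono)

text \<open>A sum has at most one bit more than its longer summand, and the constant 1 in the other
  \<open>size_cost\<close> pays for it.\<close>

lemma size_cost_add: "size_cost (x + y) \<le> size_cost x + size_cost y"
proof -
  have "x + y < 2 ^ Suc (max (floorlog 2 x) (floorlog 2 y))"
  proof -
    have "x < 2 ^ max (floorlog 2 x) (floorlog 2 y)" "y < 2 ^ max (floorlog 2 x) (floorlog 2 y)"
      using floorlog_leD[of 2 x] floorlog_leD[of 2 y] by auto
    then show ?thesis by simp
  qed
  then have "floorlog 2 (x + y) \<le> Suc (max (floorlog 2 x) (floorlog 2 y))"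
    by (intro floorlog_leI) auto
  then show ?thesis by (auto simp: size_cost_def)
qed

lemma size_cost_le_Suc: "size_cost x \<le> Suc x"
proof -
  have "floorlog 2 x \<le> x" by (rule floorlog_leI) (auto simp: less_exp)
  then show ?thesis by (simp add: size_cost_def)
qed

lemma size_cost_of_bool: "size_cost (of_bool b) \<le> 2"
  using size_cost_le_Suc[of "of_bool b"] by (cases b) auto

lemma size_cost_val_le: "size_cost (val m e) \<le> cost m e"
  by (cases e) auto

lemma cost_le_exp_size:
  assumes "\<And>b i. mem m b i \<le> M"
  shows "cost m e \<le> exp_size e * size_cost M"
proof (induction e)
  case (Num x)
  have "1 \<le> size_cost M" by (simp add: size_cost_def)
  then show ?case by (simp add: size_cost_def)
next
  case (Cell b e)
  then show ?case using size_cost_mono[OF assms, of b "val m e"] by simp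
next
  case (Add e e')
  then show ?case
    using size_cost_add[of "val m e" "val m e'"] size_cost_val_le[of m e] size_cost_val_le[of m e']
    by (simp add: algebra_simps)
next
  case (Sub e e')
  then show ?case
    using size_cost_mono[of "val m e - val m e'" "val m e"] size_cost_val_le[of m e]
    by (simp add: algebra_simps)
next
  case (Less e e')
  have "1 \<le> size_cost M" by (simp add: size_cost_def)
  then show ?case
    using Less size_cost_of_bool[of "val m e < val m e'"] by (simp add: algebra_simps)
qed

fun banks :: "exp \<Rightarrow> nat set" where
  "banks (Num x) = {}"
| "banks (Cell b e) = insert b (banks e)"
| "banks (Add e e') = banks e \<union> banks e'"
| "banks (Sub e e') = banks e \<union> banks e'"
| "banks (Less e e') = banks e \<union> banks e'"

lemma val_cong: "(\<And>b. b \<in> banks e \<Longrightarrow> mem m b = mem m' b) \<Longrightarrow> val m e = val m' e"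
  by (induction e) auto

text \<open>
  The cost of a program all of whose numbers have length at most \<open>s\<close>, whose loops make at most \<open>L\<close>
  iterations, whose neighbourhood queries return at most \<open>L\<close> elements, and whose calls take time at
  most \<open>G\<close>.  The other constructors are not used by the algorithm.
\<close>

fun com_cost :: "nat \<Rightarrow> nat \<Rightarrow> real \<Rightarrow> ('r, 'w, 'o) com \<Rightarrow> real" where
  "com_cost s L G Skip = 1"
| "com_cost s L G (Assign b e e') = real ((1 + exp_size e + exp_size e') * s)"
| "com_cost s L G (Seq p q) = com_cost s L G p + com_cost s L G q"
| "com_cost s L G (If e p q) = real ((1 + exp_size e) * s) + com_cost s L G p + com_cost s L G q"
| "com_cost s L G (While e p) = real (L + 1) * (real ((1 + exp_size e) * s) + com_cost s L G p)"
| "com_cost s L G (Call p es b e) =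
     real ((2 + sum_list (map exp_size es) + exp_size e) * s) + G"
| "com_cost s L G (AskNbrs e b) = real ((1 + exp_size e) * s) + real (L + 1) * real s"
| "com_cost s L G _ = 0"

lemma com_cost_nonneg: "0 \<le> G \<Longrightarrow> 0 \<le> com_cost s L G p"
  by (induction p) auto

text \<open>Constants are absorbed into the exponent. This needs a base of at least 2 and explains
  the summand 2 in the time bound.\<close>

lemma const_le_power: "2 \<le> N \<Longrightarrow> real c \<le> N ^ c" for N :: real
proof -
  assume N: "2 \<le> N"
  have "real c \<le> 2 ^ c" using less_exp[of c] by (metis of_nat_less_numeral_power_cancel_iff less_imp_le)
  also have "\<dots> \<le> N ^ c" using N by (intro power_mono) auto
  finally show ?thesis .
qed

text \<open>The exponent depends on \<open>p\<close> and \<open>a\<close> alone. The bound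
  \<open>G\<close> remains a linear factor: a call contributes it additively, and it is multiplied
  only by iteration counts.\<close>

lemma com_cost_polynomial:
  fixes p :: "('r, 'w, 'o) com"
  shows "\<exists>e. \<forall>s L G (N :: real). 2 \<le> N \<longrightarrow> 1 \<le> G \<longrightarrow> real s \<le> N ^ a \<longrightarrow> real (L + 1) \<le> N ^ a \<longrightarrow>
     com_cost s L G p \<le> G * N ^ e"
proof -
  define B where "B = (\<lambda>(g :: nat \<Rightarrow> nat \<Rightarrow> real \<Rightarrow> real) e. \<forall>s L G (N :: real). 2 \<le> N \<longrightarrow> 1 \<le> G \<longrightarrow>
     real s \<le> N ^ a \<longrightarrow> real (L + 1) \<le> N ^ a \<longrightarrow> g s L G \<le> G * N ^ e)"
  \<comment> \<open>\<open>P\<close> holds of the basic costs and is closed under sums and under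
    multiplication by an iteration count. These are the operations from which
    \<open>com_cost\<close> is built.\<close>
  define P where "P = (\<lambda>g. \<exists>e. B g e)"
  have BD: "g s L G \<le> G * N ^ e"
    if "B g e" "2 \<le> N" "1 \<le> G" "real s \<le> N ^ a" "real (L + 1) \<le> N ^ a" for g s L G e and N :: real
    using that unfolding B_def by blast
  have const: "P (\<lambda>s L G. real (c * s))" for c :: nat
  proof -
    have "real (c * s) \<le> G * N ^ (c + a)" if "2 \<le> N" "1 \<le> G" "real s \<le> N ^ a" for s and G N :: real
    proof -
      have "real (c * s) \<le> 1 * (N ^ c * N ^ a)"
        using const_le_power[OF that(1), of c] that by (auto intro!: mult_mono)
      also have "\<dots> \<le> G * (N ^ c * N ^ a)" using that by (intro mult_right_mono) auto
      finally show ?thesis by (simp add: power_add)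
    qed
    then show ?thesis unfolding P_def B_def by blast
  qed
  have one: "P (\<lambda>s L G. 1)"
  proof -
    have "1 \<le> G * N ^ 0" if "1 \<le> G" for G N :: real using that by simp
    then show ?thesis unfolding P_def B_def by blast
  qed
  have G: "P (\<lambda>s L G. G)"
  proof -
    have "G \<le> G * N ^ 0" for G N :: real by simp
    then show ?thesis unfolding P_def B_def by blast
  qed
  have add: "P (\<lambda>s L G. g s L G + h s L G)" if g: "P g" and h: "P h" for g h
  proof -
    obtain e e' where e: "B g e" and e': "B h e'"
      using g h unfolding P_def by blast
    have "g s L G + h s L G \<le> G * N ^ (1 + e + e')"
      if *: "2 \<le> N" "1 \<le> G" "real s \<le> N ^ a" "real (L + 1) \<le> N ^ a" for s L G and N :: real
    proof -
      have "g s L G + h s L G \<le> G * N ^ e + G * N ^ e'" using BD[OF e *] BD[OF e' *] by simp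
      also have "\<dots> \<le> G * N ^ (e + e') + G * N ^ (e + e')"
        using * by (intro add_mono mult_left_mono power_increasing) auto
      also have "\<dots> = 2 * (G * N ^ (e + e'))" by simp
      also have "\<dots> \<le> N * (G * N ^ (e + e'))" using * by (intro mult_right_mono) auto
      finally show ?thesis by (simp add: mult_ac)
    qed
    then show ?thesis unfolding P_def B_def by blast
  qed
  have loop: "P (\<lambda>s L G. real (L + 1) * g s L G)" if g: "P g" for g
  proof -
    obtain e where e: "B g e" using g unfolding P_def by blast
    have "real (L + 1) * g s L G \<le> G * N ^ (a + e)"
      if *: "2 \<le> N" "1 \<le> G" "real s \<le> N ^ a" "real (L + 1) \<le> N ^ a" for s L G and N :: real
    proof -
      have "real (L + 1) * g s L G \<le> real (L + 1) * (G * N ^ e)"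
        using BD[OF e *] by (intro mult_left_mono) auto
      also have "\<dots> \<le> N ^ a * (G * N ^ e)" using * by (intro mult_right_mono) auto
      finally show ?thesis by (simp add: mult_ac power_add)
    qed
    then show ?thesis unfolding P_def B_def by blast
  qed
  have zero: "P (\<lambda>s L G. 0)" using const[of 0] by simp
  have "P (\<lambda>s L G. com_cost s L G p)"
  proof (induction p)
    case (AskNbrs e b)
    show ?case using add[OF const[of "1 + exp_size e"] loop[OF const[of 1]]] by simp
  next
    case (While e p)
    show ?case using loop[OF add[OF const[of "1 + exp_size e"] While]] by simp
  next
    case (If e p q)
    show ?case using add[OF add[OF const[of "1 + exp_size e"] If(1)] If(2)] by simp
  next
    case (Seq p q)
    show ?case using add[OF Seq] by simp
  next
    case (Call p es b e)
    show ?case using add[OF const[of "2 + sum_list (map exp_size es) + exp_size e"] G] by simp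
  next
    case (Assign b e e')
    show ?case using const[of "1 + exp_size e + exp_size e'"] by simp
  qed (use one zero in simp_all)
  then show ?thesis unfolding P_def B_def .
qed

section \<open>Total correctness with a built-in time bound\<close>

locale bounded_ram =
  fixes wop :: "'o \<Rightarrow> 's list \<Rightarrow> 's" and wtest :: "'o \<Rightarrow> 's list \<Rightarrow> bool"
    and A :: "('r, 'w, 's) wstruct" and M L :: nat and G :: real
  assumes M_pos: "1 \<le> M" and G_nonneg: "0 \<le> G"
begin

definition bounded :: "'s memory \<Rightarrow> bool" where
  "bounded m \<longleftrightarrow> (\<forall>b i. mem m b i \<le> M)"

text \<open>A total correctness triple. As its time bound is a function of the program,
  postconditions never mention time; the price is that the bound \<open>M\<close> on memory cells
  has to be preserved throughout.\<close>

definition runs :: "'s memory \<Rightarrow> ('r, 'w, 'o) com \<Rightarrow> ('s memory \<Rightarrow> bool) \<Rightarrow> bool" where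
  "runs m p Q \<longleftrightarrow> (\<exists>c m'. exec wop wtest A p m c m' \<and> real c \<le> com_cost (size_cost M) L G p \<and>
     bounded m' \<and> Q m')"

lemma cost_le: "bounded m \<Longrightarrow> cost m e \<le> exp_size e * size_cost M"
  by (rule cost_le_exp_size) (simp add: bounded_def)

lemma size_cost_M: "1 \<le> size_cost M"
  by (simp add: size_cost_def)

lemma runs_mono: "runs m p Q \<Longrightarrow> (\<And>m'. bounded m' \<Longrightarrow> Q m' \<Longrightarrow> Q' m') \<Longrightarrow> runs m p Q'"
  unfolding runs_def by blast

lemma runs_Skip: "bounded m \<Longrightarrow> Q m \<Longrightarrow> runs m Skip Q"
  unfolding runs_def using exec.Skip by (metis com_cost.simps(1) of_nat_1 order_refl)

lemma runs_Assign:
  assumes "bounded m" and "val m e' \<le> M" and "Q (store b (val m e) (val m e') m)"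
  shows "runs m (Assign b e e') Q"
proof -
  have "1 + cost m e + cost m e' \<le> (1 + exp_size e + exp_size e') * size_cost M"
    using cost_le[OF assms(1), of e] cost_le[OF assms(1), of e'] size_cost_M by (simp add: algebra_simps)
  then have "real (1 + cost m e + cost m e') \<le> real ((1 + exp_size e + exp_size e') * size_cost M)"
    by (simp only: of_nat_le_iff)
  moreover have "bounded (store b (val m e) (val m e') m)"
    using assms by (simp add: bounded_def store_def)
  ultimately show ?thesis
    unfolding runs_def com_cost.simps using exec.Assign assms(3) by blast
qed

lemma runs_Seq:
  assumes "runs m p R" and "\<And>m'. bounded m' \<Longrightarrow> R m' \<Longrightarrow> runs m' q Q"
  shows "runs m (Seq p q) Q"
proof -
  obtain c m1 where 1: "exec wop wtest A p m c m1" "real c \<le> com_cost (size_cost M) L G p" "bounded m1" "R m1"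
    using assms(1) unfolding runs_def by blast
  obtain d m2 where 2: "exec wop wtest A q m1 d m2" "real d \<le> com_cost (size_cost M) L G q" "bounded m2" "Q m2"
    using assms(2)[OF 1(3,4)] unfolding runs_def by blast
  have "real (c + d) \<le> com_cost (size_cost M) L G (Seq p q)" using 1(2) 2(2) by simp
  then show ?thesis unfolding runs_def using exec.Seq[OF 1(1) 2(1)] 2(3,4) by blast
qed

lemma runs_If:
  assumes "bounded m" and "val m e \<noteq> 0 \<Longrightarrow> runs m p Q" and "val m e = 0 \<Longrightarrow> runs m q Q"
  shows "runs m (If e p q) Q"
proof -
  have "1 + cost m e \<le> (1 + exp_size e) * size_cost M"
    using cost_le[OF assms(1), of e] size_cost_M by (simp add: algebra_simps)
  then have *: "real (1 + cost m e) \<le> real ((1 + exp_size e) * size_cost M)"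
    by (simp only: of_nat_le_iff)
  have nn: "0 \<le> com_cost (size_cost M) L G p" "0 \<le> com_cost (size_cost M) L G q"
    using com_cost_nonneg[OF G_nonneg] by blast+
  show ?thesis
  proof (cases "val m e = 0")
    case True
    then obtain c m' where c: "exec wop wtest A q m c m'" "real c \<le> com_cost (size_cost M) L G q"
      "bounded m'" "Q m'"
      using assms(3) unfolding runs_def by blast
    have "real (1 + cost m e + c) \<le> com_cost (size_cost M) L G (If e p q)" using * c(2) nn by simp
    then show ?thesis unfolding runs_def using exec.IfFalse[OF True c(1)] c(3,4) by blast
  next
    case False
    then obtain c m' where c: "exec wop wtest A p m c m'" "real c \<le> com_cost (size_cost M) L G p"
      "bounded m'" "Q m'"
      using assms(2) unfolding runs_def by blast
    have "real (1 + cost m e + c) \<le> com_cost (size_cost M) L G (If e p q)" using * c(2) nn by simp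
    then show ?thesis unfolding runs_def using exec.IfTrue[OF False c(1)] c(3,4) by blast
  qed
qed

text \<open>The invariant is indexed by the number of completed iterations and determines the guard,
  so that \<open>n\<close> is the exact number of iterations.\<close>

lemma runs_While:
  assumes "bounded m" and "I 0 m" and "n \<le> L"
    and step: "\<And>i m. i < n \<Longrightarrow> bounded m \<Longrightarrow> I i m \<Longrightarrow> val m e \<noteq> 0 \<and> runs m p (I (Suc i))"
    and exit: "\<And>m. bounded m \<Longrightarrow> I n m \<Longrightarrow> val m e = 0 \<and> Q m"
  shows "runs m (While e p) Q"
proof -
  define u where "u = real ((1 + exp_size e) * size_cost M) + com_cost (size_cost M) L G p"
  have nn: "0 \<le> com_cost (size_cost M) L G p" by (rule com_cost_nonneg[OF G_nonneg])
  have e: "real (1 + cost m e) \<le> real ((1 + exp_size e) * size_cost M)" if "bounded m" for m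
  proof -
    have "1 + cost m e \<le> (1 + exp_size e) * size_cost M"
      using cost_le[OF that, of e] size_cost_M by (simp add: algebra_simps)
    then show ?thesis by (simp only: of_nat_le_iff)
  qed
  \<comment> \<open>Here \<open>j\<close> counts the iterations still to come. The successor pays
    for the last, failing test of the guard.\<close>
  have "\<exists>c m'. exec wop wtest A (While e p) m c m' \<and> real c \<le> real (Suc j) * u \<and> bounded m' \<and> Q m'"
    if "j \<le> n" "bounded m" "I (n - j) m" for j m
    using that
  proof (induction j arbitrary: m)
    case 0
    then have "val m e = 0" "Q m" using exit by auto
    moreover have "real (1 + cost m e) \<le> real (Suc 0) * u" using e[OF 0(2)] nn by (simp add: u_def)
    ultimately show ?case using exec.WhileFalse 0 by blast
  next
    case (Suc j)
    have "val m e \<noteq> 0" "runs m p (I (n - j))"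
      using step[of "n - Suc j" m] Suc.prems by (auto simp: Suc_diff_Suc)
    then obtain c m1 where 1: "exec wop wtest A p m c m1" "real c \<le> com_cost (size_cost M) L G p"
      "bounded m1" "I (n - j) m1"
      unfolding runs_def by blast
    then obtain d m2 where 2: "exec wop wtest A (While e p) m1 d m2" "real d \<le> real (Suc j) * u"
      "bounded m2" "Q m2"
      using Suc.IH[of m1] Suc.prems by auto
    have "real (1 + cost m e + c + d) = real (1 + cost m e) + real c + real d" by simp
    also have "\<dots> \<le> u + real (Suc j) * u" using e[OF Suc.prems(2)] 1(2) 2(2) by (simp add: u_def)
    also have "\<dots> = real (Suc (Suc j)) * u" by (simp add: algebra_simps)
    finally show ?case using exec.WhileTrue[OF \<open>val m e \<noteq> 0\<close> 1(1) 2(1)] 2(3,4) by blast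
  qed
  from this[of n m] obtain c m' where c: "exec wop wtest A (While e p) m c m'"
    "real c \<le> real (Suc n) * u" "bounded m'" "Q m'"
    using assms(1,2) by auto
  have "real (Suc n) * u \<le> real (L + 1) * u"
    using assms(3) nn by (intro mult_right_mono) (auto simp: u_def)
  then have "real c \<le> com_cost (size_cost M) L G (While e p)" using c(2) by (simp add: u_def)
  then show ?thesis unfolding runs_def using c by blast
qed

text \<open>The callee works in a memory of its own, whose cells may exceed \<open>M\<close>. Only
  its time and the returned number enter.\<close>

lemma runs_Call:
  assumes "bounded m" and p: "exec wop wtest A p (initial (map (val m) es)) c m'" "real c \<le> G"
    "mem m' 0 0 = x" and "x \<le> M" and "Q (store b (val m e) x m)"
  shows "runs m (Call p es b e) Q"
proof -
  have "costs m es \<le> sum_list (map exp_size es) * size_cost M"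
    unfolding costs_def using cost_le[OF assms(1)] by (induction es) (auto simp: algebra_simps add_mono)
  then have "1 + costs m es + cost m e + size_cost x \<le>
      (2 + sum_list (map exp_size es) + exp_size e) * size_cost M"
    using cost_le[OF assms(1), of e] size_cost_M size_cost_mono[OF assms(5)]
    by (simp add: algebra_simps)
  then have "real (1 + costs m es + cost m e + size_cost x) \<le>
      real ((2 + sum_list (map exp_size es) + exp_size e) * size_cost M)"
    by (simp only: of_nat_le_iff)
  then have "real (1 + costs m es + cost m e + c + size_cost x) \<le>
      com_cost (size_cost M) L G (Call p es b e)"
    using p(2) by simp
  moreover have "bounded (store b (val m e) x m)"
    using assms by (simp add: bounded_def store_def)
  moreover have "exec wop wtest A (Call p es b e) m (1 + costs m es + cost m e + c + size_cost x)
      (store b (val m e) x m)"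
    using exec.Call[OF p(1), of b e] p(3) by simp
  ultimately show ?thesis unfolding runs_def using assms(6) by blast
qed

lemma runs_AskNbrs:
  assumes "bounded m" and len: "length (nbr_list A (val m e)) \<le> L + 1"
    and M: "\<And>x. x \<in> set (nbr_list A (val m e)) \<Longrightarrow> x \<le> M"
    and "Q (store_list b (nbr_list A (val m e)) m)"
  shows "runs m (AskNbrs e b) Q"
proof -
  define xs where "xs = nbr_list A (val m e)"
  have "sum_list (map size_cost ys) \<le> length ys * size_cost M" if "\<And>x. x \<in> set ys \<Longrightarrow> x \<le> M" for ys
    using that
  proof (induction ys)
    case (Cons y ys)
    then show ?case using size_cost_mono[of y M] by (simp add: add_mono)
  qed simp
  then have "sum_list (map size_cost xs) \<le> length xs * size_cost M" using M by (simp add: xs_def)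
  also have "\<dots> \<le> (L + 1) * size_cost M" using len by (intro mult_right_mono) (auto simp: xs_def)
  finally have "1 + cost m e + sum_list (map size_cost xs) \<le> (1 + exp_size e) * size_cost M + (L + 1) * size_cost M"
    using cost_le[OF assms(1), of e] size_cost_M by (simp add: algebra_simps)
  then have "real (1 + cost m e + sum_list (map size_cost xs)) \<le>
      real ((1 + exp_size e) * size_cost M + (L + 1) * size_cost M)"
    by (simp only: of_nat_le_iff)
  then have "real (1 + cost m e + sum_list (map size_cost xs)) \<le> com_cost (size_cost M) L G (AskNbrs e b)"
    by (simp only: com_cost.simps of_nat_add of_nat_mult)
  moreover have "bounded (store_list b xs m)"
    using assms(1) M nth_mem by (auto simp: bounded_def store_list_def xs_def)
  ultimately show ?thesis
    unfolding runs_def using exec.AskNbrs[of wop wtest A e b m] assms(4) xs_def by blast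
qed

end

text \<open>The blocks to be written have length \<open>k\<close> or \<open>l\<close>, which are
  constants of the program, so they are unrolled instead of being written by a loop.\<close>

fun puts :: "nat \<Rightarrow> exp \<Rightarrow> exp list \<Rightarrow> ('r, 'w, 'o) com" where
  "puts b a [] = Skip"
| "puts b a (e # es) = Seq (Assign b a e) (puts b (Add a (Num 1)) es)"

definition store_block :: "nat \<Rightarrow> nat \<Rightarrow> nat list \<Rightarrow> 's memory \<Rightarrow> 's memory" where
  "store_block b k xs m = m\<lparr>mem := (mem m)(b :=
     (\<lambda>i. if k \<le> i \<and> i < k + length xs then xs ! (i - k) else mem m b i))\<rparr>"

text \<open>The expressions are evaluated one after the other between the writes. The values are
  those in the original memory because none of them reads the bank being written.\<close>

lemma (in bounded_ram) runs_puts: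
  assumes "bounded m" and "b \<notin> banks a" and "\<And>e. e \<in> set es \<Longrightarrow> b \<notin> banks e \<and> val m e \<le> M"
    and "Q (store_block b (val m a) (map (val m) es) m)"
  shows "runs m (puts b a es) Q"
  using assms
proof (induction es arbitrary: a m)
  case Nil
  have "store_block b k [] m = m" for k
    unfolding store_block_def by (rule memory.equality) (auto simp: fun_eq_iff)
  then show ?case using Nil by (simp add: runs_Skip)
next
  case (Cons e es)
  define m' where "m' = store b (val m a) (val m e) m"
  have val: "val m' e' = val m e'" if "b \<notin> banks e'" for e'
    using that by (intro val_cong) (auto simp: m'_def store_def)
  have es: "map (val m') es = map (val m) es" using Cons.prems(3) val by auto
  have 1: "runs m (Assign b a e) (\<lambda>m1. m1 = m')"
    using Cons.prems by (intro runs_Assign) (auto simp: m'_def)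
  have 2: "runs m' (puts b (Add a (Num 1)) es) Q" if "bounded m'"
  proof (rule Cons.IH[OF that])
    show "b \<notin> banks (Add a (Num 1))" using Cons.prems(2) by simp
    show "b \<notin> banks e' \<and> val m' e' \<le> M" if "e' \<in> set es" for e'
      using Cons.prems(3)[of e'] that val by simp
    have "store_block b (val m' (Add a (Num 1))) (map (val m') es) m' =
        store_block b (val m a) (map (val m) (e # es)) m"
      unfolding es using val[OF Cons.prems(2)]
      by (auto simp: store_block_def m'_def store_def fun_eq_iff nth_Cons' Suc_le_eq)
    then show "Q (store_block b (val m' (Add a (Num 1))) (map (val m') es) m')"
      using Cons.prems(4) by simp
  qed
  show ?case unfolding puts.simps using 2 by (intro runs_Seq[OF 1]) simp
qed

section \<open>The learning algorithm\<close>

text \<open>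
  The candidates for parameters are listed in \<open>cand_bank\<close>; there are \<open>len_bank\<close> many, with repetitions.
  Cell \<open>j\<close> of \<open>idx_bank\<close> is the index in this list of the parameter number \<open>j\<close> that is being tried, and
  \<open>sol_bank\<close> holds the last solution found, in the output format.  Banks other than these, \<open>io_bank\<close>
  and \<open>nbr_bank\<close> are registers: only cell 0 is used.
\<close>

abbreviation (input) "io_bank \<equiv> 0 :: nat"
abbreviation (input) "cand_bank \<equiv> 1 :: nat"
abbreviation (input) "len_bank \<equiv> 2 :: nat"
abbreviation (input) "nbr_bank \<equiv> 3 :: nat"
abbreviation (input) "idx_bank \<equiv> 4 :: nat"
abbreviation (input) "sol_bank \<equiv> 5 :: nat"
abbreviation (input) "i_bank \<equiv> 6 :: nat"
abbreviation (input) "j_bank \<equiv> 7 :: nat"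
abbreviation (input) "old_bank \<equiv> 8 :: nat"
abbreviation (input) "pos_bank \<equiv> 9 :: nat"
abbreviation (input) "ok_bank \<equiv> 10 :: nat"
abbreviation (input) "res_bank \<equiv> 11 :: nat"

abbreviation "reg b \<equiv> Cell b (Num 0)"
abbreviation "set_reg b e \<equiv> Assign b (Num 0) e"
abbreviation "incr_reg b c \<equiv> Assign b (Num 0) (Add (reg b) (Num c))"

text \<open>The length starts at 1 because cell 0 of a fresh \<open>cand_bank\<close> holds 0, the
  substitute for far parameters. The counter \<open>i_bank\<close> likewise starts from its initial
  value 0. The position starts at 1 because cell 0 of the input is the number of examples.\<close>

definition collect :: "nat \<Rightarrow> ('r, 'w, 'o) com" where
  "collect k = Seq (set_reg len_bank (Num 1)) (Seq (set_reg pos_bank (Num 1))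
     (While (Less (reg i_bank) (reg io_bank))
       (Seq (puts cand_bank (reg len_bank)
               (map (\<lambda>j. Cell io_bank (Add (reg pos_bank) (Num j))) [0..<k]))
       (Seq (incr_reg len_bank k) (Seq (incr_reg pos_bank (k + 1)) (incr_reg i_bank 1))))))"

text \<open>The old length is saved since the list grows while it is traversed; elements appended in
  this round are expanded only in the next one.\<close>

definition grow :: "('r, 'w, 'o) com" where
  "grow = Seq (set_reg old_bank (reg len_bank)) (Seq (set_reg i_bank (Num 0))
     (While (Less (reg i_bank) (reg old_bank))
       (Seq (AskNbrs (Cell cand_bank (reg i_bank)) nbr_bank) (Seq (set_reg j_bank (Num 0))
       (Seq (While (Less (reg j_bank) (reg nbr_bank))
              (Seq (Assign cand_bank (reg len_bank) (Cell nbr_bank (Add (reg j_bank) (Num 1))))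
              (Seq (incr_reg len_bank 1) (incr_reg j_bank 1))))
       (incr_reg i_bank 1))))))"

fun grows :: "nat \<Rightarrow> ('r, 'w, 'o) com" where
  "grows 0 = Skip"
| "grows (Suc n) = Seq grow (grows n)"

definition params :: "nat \<Rightarrow> exp list" where
  "params l = map (\<lambda>j. Cell cand_bank (Cell idx_bank (Num j))) [0..<l]"

text \<open>In place of an equality test, the sum of the two strict comparisons is nonzero iff the
  computed value differs from the label. \<open>sol_bank\<close> is written only after all examples
  have passed.\<close>

definition check :: "nat \<Rightarrow> nat \<Rightarrow> nat \<Rightarrow> ('r, 'w, 'o) com \<Rightarrow> ('r, 'w, 'o) com" where
  "check k l c p = (let label = Cell io_bank (Add (reg pos_bank) (Num k)) in
     Seq (set_reg i_bank (Num 0)) (Seq (set_reg pos_bank (Num 1)) (Seq (set_reg ok_bank (Num 1))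
     (Seq (While (Less (reg i_bank) (reg io_bank))
       (Seq (Call p (map (\<lambda>j. Cell io_bank (Add (reg pos_bank) (Num j))) [0..<k] @ params l)
               res_bank (Num 0))
       (Seq (If (Add (Less (reg res_bank) label) (Less label (reg res_bank)))
               (set_reg ok_bank (Num 0)) Skip)
       (Seq (incr_reg pos_bank (k + 1)) (incr_reg i_bank 1)))))
     (If (reg ok_bank)
       (Seq (set_reg sol_bank (Num (Suc c))) (puts sol_bank (Num 1) (params l))) Skip)))))"

fun checks :: "nat \<Rightarrow> nat \<Rightarrow> (nat \<times> ('r, 'w, 'o) com) list \<Rightarrow> ('r, 'w, 'o) com" where
  "checks k l [] = Skip"
| "checks k l ((c, p) # cps) = Seq (check k l c p) (checks k l cps)"

text \<open>One nested loop per parameter, with position 0 innermost. The nesting depth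
  \<open>l\<close> is fixed in the program, so the number of choices is polynomial in the number of
  candidates. The search does not stop at a solution; later ones overwrite earlier ones.\<close>

fun search :: "nat \<Rightarrow> nat \<Rightarrow> (nat \<times> ('r, 'w, 'o) com) list \<Rightarrow> nat \<Rightarrow> ('r, 'w, 'o) com" where
  "search k l cps 0 = checks k l cps"
| "search k l cps (Suc j) = Seq (Assign idx_bank (Num j) (Num 0))
     (While (Less (Cell idx_bank (Num j)) (reg len_bank))
       (Seq (search k l cps j)
            (Assign idx_bank (Num j) (Add (Cell idx_bank (Num j)) (Num 1)))))"

text \<open>If nothing was found, cell 0 of \<open>sol_bank\<close> still has its initial value 0,
  which is the code of rejection.\<close>

definition emit :: "nat \<Rightarrow> ('r, 'w, 'o) com" where
  "emit l = Seq (set_reg io_bank (reg sol_bank))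
     (puts io_bank (Num 1) (map (\<lambda>j. Cell sol_bank (Num (Suc j))) [0..<l]))"

definition learner :: "nat \<Rightarrow> nat \<Rightarrow> nat \<Rightarrow> (nat \<times> ('r, 'w, 'o) com) list \<Rightarrow> ('r, 'w, 'o) com" where
  "learner k l D cps = Seq (collect k) (Seq (grows D) (Seq (search k l cps l) (emit l)))"

section \<open>Frames and the representation of data in memory\<close>

definition frame :: "nat set \<Rightarrow> 's memory \<Rightarrow> 's memory \<Rightarrow> bool" where
  "frame Bs m m' \<longleftrightarrow> (\<forall>b. b \<notin> Bs \<longrightarrow> mem m' b = mem m b)"

lemma frame_refl: "frame Bs m m"
  by (simp add: frame_def)

lemma frame_trans: "frame Bs m m' \<Longrightarrow> frame Bs m' m'' \<Longrightarrow> frame Bs m m''"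
  by (simp add: frame_def)

lemma frame_weaken: "frame Bs m m' \<Longrightarrow> Bs \<subseteq> Bs' \<Longrightarrow> frame Bs' m m'"
  unfolding frame_def by blast

lemma frameD: "frame Bs m m' \<Longrightarrow> b \<notin> Bs \<Longrightarrow> mem m' b = mem m b"
  by (simp add: frame_def)

lemma mem_store: "mem (store b i x m) b' = (if b' = b then (mem m b)(i := x) else mem m b')"
  by (simp add: store_def)

lemma mem_store_list: "mem (store_list b xs m) b' =
    (if b' = b then (\<lambda>i. if i < length xs then xs ! i else mem m b i) else mem m b')"
  by (simp add: store_list_def)

lemma mem_store_block: "mem (store_block b k xs m) b' =
    (if b' = b then (\<lambda>i. if k \<le> i \<and> i < k + length xs then xs ! (i - k) else mem m b i) else mem m b')"
  by (simp add: store_block_def)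

lemma frame_store:
  "frame Bs m0 m \<Longrightarrow> b \<in> Bs \<Longrightarrow> frame Bs m0 (store b i x m)"
  "frame Bs m0 m \<Longrightarrow> b \<in> Bs \<Longrightarrow> frame Bs m0 (store_list b xs m)"
  "frame Bs m0 m \<Longrightarrow> b \<in> Bs \<Longrightarrow> frame Bs m0 (store_block b i xs m)"
  by (auto simp: frame_def mem_store mem_store_list mem_store_block)

lemma nth_concat_uniform:
  assumes "\<And>xs. xs \<in> set xss \<Longrightarrow> length xs = n" and "i < length xss" and "j < n"
  shows "i * n + j < length (concat xss)" and "concat xss ! (i * n + j) = xss ! i ! j"
proof -
  have "i * n + j < length (concat xss) \<and> concat xss ! (i * n + j) = xss ! i ! j"
    using assms
  proof (induction xss arbitrary: i)
    case (Cons xs xss)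
    then show ?case
    proof (cases i)
      case (Suc i')
      then show ?thesis using Cons.IH[of i'] Cons.prems by (auto simp: nth_append)
    qed (auto simp: nth_append)
  qed simp
  then show "i * n + j < length (concat xss)" "concat xss ! (i * n + j) = xss ! i ! j" by blast+
qed

text \<open>Example \<open>i\<close> begins at cell \<open>1 + i * (k + 1)\<close>: cell 0 is the
  count, and each example takes \<open>k\<close> cells for its entries and one for its
  label.\<close>

definition holds_input :: "nat \<Rightarrow> (nat list \<times> bool) list \<Rightarrow> 's memory \<Rightarrow> bool" where
  "holds_input k T m \<longleftrightarrow> mem m io_bank 0 = length T \<and>
     (\<forall>i<length T. (\<forall>j<k. mem m io_bank (1 + i * (k + 1) + j) = fst (T ! i) ! j) \<and>
        mem m io_bank (1 + i * (k + 1) + k) = of_bool (snd (T ! i)))"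

lemma holds_input_initial:
  assumes "\<And>as b. (as, b) \<in> set T \<Longrightarrow> length as = k"
  shows "holds_input k T (initial (encode_training T))"
proof -
  define xss where "xss = map (\<lambda>(as, b). as @ [of_bool b :: nat]) T"
  have len: "length xs = k + 1" if "xs \<in> set xss" for xs
    using that assms by (auto simp: xss_def)
  have nth: "xss ! i = fst (T ! i) @ [of_bool (snd (T ! i))]" "length (fst (T ! i)) = k"
    if "i < length T" for i
    using that assms[of "fst (T ! i)" "snd (T ! i)"] by (auto simp: xss_def split_beta)
  have cell: "mem (initial (encode_training T)) io_bank (1 + i * (k + 1) + j) = xss ! i ! j"
    if "i < length T" "j < k + 1" for i j
    using nth_concat_uniform[of xss "k + 1" i j, OF len] that
    by (simp add: initial_def store_list_def encode_training_def xss_def[symmetric])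
      (auto simp: xss_def)
  have "mem (initial (encode_training T)) io_bank 0 = length T"
    by (simp add: initial_def store_list_def encode_training_def)
  moreover have "mem (initial (encode_training T)) io_bank (1 + i * (k + 1) + j) = fst (T ! i) ! j"
    if "i < length T" "j < k" for i j
    using cell[of i j] nth[of i] that by (simp add: nth_append)
  moreover have "mem (initial (encode_training T)) io_bank (1 + i * (k + 1) + k) = of_bool (snd (T ! i))"
    if "i < length T" for i
    using cell[of i k] nth[of i] that by (simp add: nth_append)
  ultimately show ?thesis
    unfolding holds_input_def by blast
qed

definition holds_list :: "nat list \<Rightarrow> 's memory \<Rightarrow> bool" where
  "holds_list ps m \<longleftrightarrow> mem m len_bank 0 = length ps \<and> (\<forall>i<length ps. mem m cand_bank i = ps ! i)"

definition nbrs :: "('r, 'w, 's) wstruct \<Rightarrow> nat \<Rightarrow> nat list" where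
  "nbrs A a = sorted_list_of_set (gaifman A `` {a})"

text \<open>The old list remains a prefix, so earlier entries keep their indices and shorter walks
  remain covered. Repetitions are harmless: the length grows by a factor of at most
  \<open>1 + d\<close> per round.\<close>

definition expand :: "('r, 'w, 's) wstruct \<Rightarrow> nat list \<Rightarrow> nat list" where
  "expand A ps = ps @ concat (map (nbrs A) ps)"

lemma nbr_list_nbrs: "nbr_list A a = length (nbrs A a) # nbrs A a"
  by (simp add: nbr_list_def nbrs_def)

context bounded_ram
begin

text \<open>In these variants of the rules, values and successor memories are named by equations. A
  block is then verified from its last command backwards, with the invariant checked once on the
  final memory.\<close>

lemma runs_Assign_eq:
  assumes "bounded m" and "val m e = i" and "val m e' = x" and "x \<le> M"
    and "m' = store b i x m" and "Q m'"
  shows "runs m (Assign b e e') Q"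
  using assms by (intro runs_Assign) auto

lemma runs_Assign_Seq:
  assumes "bounded m" and "val m e = i" and "val m e' = x" and "x \<le> M"
    and "m' = store b i x m" and "bounded m' \<Longrightarrow> runs m' q Q"
  shows "runs m (Seq (Assign b e e') q) Q"
proof (rule runs_Seq[where R = "\<lambda>x. x = m'"])
  show "runs m (Assign b e e') (\<lambda>x. x = m')" using assms(1-5) by (rule runs_Assign_eq) simp
qed (use assms(6) in blast)

lemma runs_puts_eq:
  assumes "bounded m" and "b \<notin> banks a" and "\<forall>e\<in>set es. b \<notin> banks e"
    and "val m a = i" and "map (val m) es = xs" and "\<forall>x\<in>set xs. x \<le> M"
    and "m' = store_block b i xs m" and "Q m'"
  shows "runs m (puts b a es) Q"
  using assms by (intro runs_puts) auto

lemma runs_puts_Seq: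
  assumes "bounded m" and "b \<notin> banks a" and "\<forall>e\<in>set es. b \<notin> banks e"
    and "val m a = i" and "map (val m) es = xs" and "\<forall>x\<in>set xs. x \<le> M"
    and "m' = store_block b i xs m" and "bounded m' \<Longrightarrow> runs m' q Q"
  shows "runs m (Seq (puts b a es) q) Q"
proof (rule runs_Seq[where R = "\<lambda>x. x = m'"])
  show "runs m (puts b a es) (\<lambda>x. x = m')" using assms(1-7) by (rule runs_puts_eq) simp
qed (use assms(8) in blast)

lemma mem_le: "bounded m \<Longrightarrow> mem m b i \<le> M"
  by (simp add: bounded_def)

end

text \<open>The logic is abstracted to a predicate \<open>H\<close> that \<open>prog\<close> decides
  within time \<open>G\<close>. The assumption \<open>T_M\<close> leaves room for the position
  register, which runs past the last example.\<close>

locale learning_ram = bounded_ram wop wtest A M L G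
  for wop :: "'o \<Rightarrow> 's list \<Rightarrow> 's" and wtest :: "'o \<Rightarrow> 's list \<Rightarrow> bool"
    and A :: "('r, 'w, 's) wstruct" and M L :: nat and G :: real +
  fixes T :: "(nat list \<times> bool) list" and k l :: nat
    and \<psi>s :: "'g list" and code :: "'g \<Rightarrow> nat" and prog :: "'g \<Rightarrow> ('r, 'w, 'o) com"
    and H :: "'g \<Rightarrow> nat list \<Rightarrow> bool"
  assumes finite_univ: "finite (univ A)" and gaifman: "gaifman A \<subseteq> univ A \<times> univ A"
    and univ_le: "\<And>a. a \<in> univ A \<Longrightarrow> a \<le> M"
    and nbrs_le: "\<And>a. a \<in> univ A \<Longrightarrow> card (gaifman A `` {a}) \<le> L"
    and zero_in: "0 \<in> univ A" and L_le: "L \<le> M"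
    and T: "\<And>as b. (as, b) \<in> set T \<Longrightarrow> as \<in> tuples k (univ A)"
    and T_L: "length T \<le> L" and T_M: "1 + (length T + 1) * (k + 1) \<le> M"
    and prog: "\<And>\<psi> cs. \<psi> \<in> set \<psi>s \<Longrightarrow> cs \<in> tuples (k + l) (univ A) \<Longrightarrow>
      \<exists>c m. exec wop wtest A (prog \<psi>) (initial cs) c m \<and> real c \<le> G \<and> mem m 0 0 = of_bool (H \<psi> cs)"
    and code_le: "\<And>\<psi>. \<psi> \<in> set \<psi>s \<Longrightarrow> Suc (code \<psi>) \<le> M"
begin

section \<open>Collecting the candidates\<close>

lemma set_nbrs: "set (nbrs A a) = gaifman A `` {a}"
  and length_nbrs: "length (nbrs A a) = card (gaifman A `` {a})"
proof -
  have "gaifman A `` {a} \<subseteq> univ A" using gaifman by auto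
  then have "finite (gaifman A `` {a})" using finite_univ finite_subset by blast
  then show "set (nbrs A a) = gaifman A `` {a}" "length (nbrs A a) = card (gaifman A `` {a})"
    by (simp_all add: nbrs_def)
qed

lemma T_nth:
  assumes "i < length T"
  shows "length (fst (T ! i)) = k" and "set (fst (T ! i)) \<subseteq> univ A"
  using T[of "fst (T ! i)" "snd (T ! i)"] assms by (auto simp: tuples_def)

lemma pos_le: "i \<le> length T \<Longrightarrow> 1 + i * (k + 1) \<le> M"
  using T_M mult_le_mono1[of i "length T" "k + 1"] by (simp add: algebra_simps)

lemma input_frame: "holds_input k T m \<Longrightarrow> frame Bs m m' \<Longrightarrow> io_bank \<notin> Bs \<Longrightarrow> holds_input k T m'"
  by (simp add: holds_input_def frame_def)

lemma list_frame: "holds_list ps m \<Longrightarrow> frame Bs m m' \<Longrightarrow> cand_bank \<notin> Bs \<Longrightarrow> len_bank \<notin> Bs \<Longrightarrow>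
    holds_list ps m'"
  by (simp add: holds_list_def frame_def)

lemma args_eq:
  assumes "holds_input k T m" and "i < length T" and "mem m pos_bank 0 = 1 + i * (k + 1)"
  shows "map (val m) (map (\<lambda>j. Cell io_bank (Add (reg pos_bank) (Num j))) [0..<k]) = fst (T ! i)"
  using assms T_nth by (intro nth_equalityI) (auto simp: holds_input_def add_ac)

lemma runs_collect:
  assumes m: "bounded m" and inp: "holds_input k T m"
    and zero: "mem m i_bank 0 = 0" "mem m cand_bank 0 = 0"
    and len: "1 + length T * k \<le> L"
  shows "runs m (collect k) (\<lambda>m'. frame {cand_bank, len_bank, i_bank, pos_bank} m m' \<and>
     holds_list (0 # concat (map fst T)) m')"
proof -
  define ps where "ps i = 0 # concat (map fst (take i T))" for i
  define F where "F = {cand_bank, len_bank, i_bank, pos_bank}"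
  define Inv where "Inv i m' \<longleftrightarrow> frame F m m' \<and> mem m' i_bank 0 = i \<and>
    mem m' pos_bank 0 = 1 + i * (k + 1) \<and> holds_list (ps i) m'" for i m'
  have len_ps: "length (ps i) = 1 + i * k" if "i \<le> length T" for i
    using that
  proof (induction i)
    case (Suc i)
    then show ?case using T_nth(1)[of i] by (simp add: ps_def take_Suc_conv_app_nth)
  qed (simp add: ps_def)
  have ps_le: "1 + i * k \<le> M" if "i \<le> length T" for i
    using mult_le_mono1[OF that, of k] len L_le by linarith
  define m1 where "m1 = store pos_bank 0 1 (store len_bank 0 1 m)"
  have m1: "Inv 0 m1" using zero
    by (auto simp: Inv_def m1_def ps_def holds_list_def mem_store F_def intro!: frame_store frame_refl)
  have step: "val m' (Less (reg i_bank) (reg io_bank)) \<noteq> 0 \<and>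
      runs m' (Seq (puts cand_bank (reg len_bank)
               (map (\<lambda>j. Cell io_bank (Add (reg pos_bank) (Num j))) [0..<k]))
       (Seq (incr_reg len_bank k) (Seq (incr_reg pos_bank (k + 1)) (incr_reg i_bank 1)))) (Inv (Suc i))"
    if i: "i < length T" and m': "bounded m'" and inv: "Inv i m'" for i m'
  proof
    have fr: "frame F m m'" and ci: "mem m' i_bank 0 = i" and cp: "mem m' pos_bank 0 = 1 + i * (k + 1)"
      and hl: "holds_list (ps i) m'" using inv by (auto simp: Inv_def)
    have inp': "holds_input k T m'" using input_frame[OF inp fr] by (simp add: F_def)
    show "val m' (Less (reg i_bank) (reg io_bank)) \<noteq> 0"
      using i ci inp' by (simp add: holds_input_def)
    let ?es = "map (\<lambda>j. Cell io_bank (Add (reg pos_bank) (Num j))) [0..<k]"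
    have args: "map (val m') ?es = fst (T ! i)" by (rule args_eq[OF inp' i cp])
    have cl: "mem m' len_bank 0 = 1 + i * k"
      using hl i by (simp add: holds_list_def len_ps)
    have lenT: "length (fst (T ! i)) = k" by (rule T_nth(1)[OF i])
    have b1: "1 + i * k + k \<le> M" using ps_le[of "Suc i"] i by (simp add: add_ac)
    have b2: "1 + i * (k + 1) + (k + 1) \<le> M" using pos_le[of "Suc i"] i by (simp add: add_ac)
    have b3: "Suc i \<le> M" using i T_L L_le by linarith
    have psS: "ps (Suc i) = ps i @ fst (T ! i)" using i by (simp add: ps_def take_Suc_conv_app_nth)
    show "runs m' (Seq (puts cand_bank (reg len_bank) ?es)
       (Seq (incr_reg len_bank k) (Seq (incr_reg pos_bank (k + 1)) (incr_reg i_bank 1)))) (Inv (Suc i))"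
    proof -
      define m2 where "m2 = store_block cand_bank (1 + i * k) (fst (T ! i)) m'"
      define m3 where "m3 = store len_bank 0 (1 + i * k + k) m2"
      define m4 where "m4 = store pos_bank 0 (1 + i * (k + 1) + (k + 1)) m3"
      define m5 where "m5 = store i_bank 0 (Suc i) m4"
      note defs = m2_def m3_def m4_def m5_def mem_store mem_store_block
      have T_le: "\<forall>x\<in>set (fst (T ! i)). x \<le> M"
        using T_nth(2)[OF i] univ_le by blast
      have "frame F m m5"
        unfolding m2_def m3_def m4_def m5_def using fr by (intro frame_store) (auto simp: F_def)
      moreover have "holds_list (ps (Suc i)) m5"
        using hl i lenT len_ps[of i] by (auto simp: defs holds_list_def psS nth_append)
      ultimately have "Inv (Suc i) m5" by (simp add: Inv_def defs)
      then have "runs m4 (incr_reg i_bank 1) (Inv (Suc i))" if "bounded m4"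
        by (rule runs_Assign_eq[OF that _ _ b3 m5_def, rotated 2]) (simp_all add: ci defs)
      then have "runs m3 (Seq (incr_reg pos_bank (k + 1)) (incr_reg i_bank 1)) (Inv (Suc i))" if "bounded m3"
        by (rule runs_Assign_Seq[OF that _ _ b2 m4_def, rotated 2]) (simp_all add: cp defs)
      then have "runs m2 (Seq (incr_reg len_bank k) (Seq (incr_reg pos_bank (k + 1)) (incr_reg i_bank 1)))
          (Inv (Suc i))" if "bounded m2"
        by (rule runs_Assign_Seq[OF that _ _ b1 m3_def, rotated 2]) (simp_all add: cl defs)
      then show ?thesis
        by (rule runs_puts_Seq[OF m' _ _ _ args T_le m2_def, rotated 3]) (use cl in auto)
    qed
  qed
  have "runs m1 (While (Less (reg i_bank) (reg io_bank))
       (Seq (puts cand_bank (reg len_bank)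
               (map (\<lambda>j. Cell io_bank (Add (reg pos_bank) (Num j))) [0..<k]))
       (Seq (incr_reg len_bank k) (Seq (incr_reg pos_bank (k + 1)) (incr_reg i_bank 1)))))
       (\<lambda>m'. frame F m m' \<and> holds_list (0 # concat (map fst T)) m')" if "bounded m1"
  proof (rule runs_While[where I = Inv and n = "length T", OF that m1 T_L step])
    fix m'
    assume inv: "Inv (length T) m'"
    then have "holds_input k T m'" using input_frame[OF inp, of F m'] by (simp add: Inv_def F_def)
    then show "val m' (Less (reg i_bank) (reg io_bank)) = 0 \<and>
        frame F m m' \<and> holds_list (0 # concat (map fst T)) m'"
      using inv by (simp add: Inv_def holds_input_def ps_def)
  qed
  then have "runs (store len_bank 0 1 m) (Seq (set_reg pos_bank (Num 1)) (While (Less (reg i_bank) (reg io_bank))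
       (Seq (puts cand_bank (reg len_bank)
               (map (\<lambda>j. Cell io_bank (Add (reg pos_bank) (Num j))) [0..<k]))
       (Seq (incr_reg len_bank k) (Seq (incr_reg pos_bank (k + 1)) (incr_reg i_bank 1))))))
       (\<lambda>m'. frame F m m' \<and> holds_list (0 # concat (map fst T)) m')" if "bounded (store len_bank 0 1 m)"
    by (rule runs_Assign_Seq[OF that _ _ M_pos m1_def, rotated 2]) simp_all
  then show ?thesis
    unfolding collect_def F_def[symmetric]
    by (rule runs_Assign_Seq[OF m _ _ M_pos refl, rotated 2]) simp_all
qed

end

lemma holds_list_snoc:
  "holds_list ps m \<Longrightarrow> mem m' cand_bank = (mem m cand_bank)(length ps := x) \<Longrightarrow>
   mem m' len_bank 0 = Suc (length ps) \<Longrightarrow> holds_list (ps @ [x]) m'"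
  by (auto simp: holds_list_def nth_append)

definition fits :: "(nat list \<times> bool) list \<Rightarrow> (nat list \<Rightarrow> bool) \<Rightarrow> nat list \<Rightarrow> bool" where
  "fits T h us \<longleftrightarrow> (\<forall>(as, b)\<in>set T. h (as @ us) = b)"

text \<open>\<open>S\<close> is the set of solutions met on the way. That \<open>sol_bank\<close>
  holds some member, without saying which, composes under unions and still suffices: an unchanged
  cell 0 reveals that \<open>S\<close> is empty.\<close>

definition advances :: "nat \<Rightarrow> (nat \<times> nat list) set \<Rightarrow> 's memory \<Rightarrow> 's memory \<Rightarrow> bool" where
  "advances l S m m' \<longleftrightarrow> S = {} \<and> mem m' sol_bank = mem m sol_bank \<or>
     (\<exists>(c, us)\<in>S. mem m' sol_bank 0 = Suc c \<and> (\<forall>j<l. mem m' sol_bank (Suc j) = us ! j))"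

lemma advances_refl: "mem m' sol_bank = mem m sol_bank \<Longrightarrow> advances l {} m m'"
  by (simp add: advances_def)

text \<open>A later find overwrites an earlier one, and a later phase without finds leaves the
  earlier one in place.\<close>

lemma advances_trans: "advances l S m m' \<Longrightarrow> advances l S' m' m'' \<Longrightarrow> advances l (S \<union> S') m m''"
  unfolding advances_def by (elim disjE) auto

lemma advances_cong:
  "advances l S m m' \<Longrightarrow> mem m1 sol_bank = mem m sol_bank \<Longrightarrow> mem m2 sol_bank = mem m' sol_bank \<Longrightarrow>
   advances l S m1 m2"
  by (simp add: advances_def)

context bounded_ram
begin

lemma runs_AskNbrs_Seq:
  assumes "bounded m" and "val m e = a" and "length (nbrs A a) \<le> L" and "L \<le> M"
    and "\<forall>x\<in>set (nbrs A a). x \<le> M" and "m' = store_list b (nbr_list A a) m"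
    and "bounded m' \<Longrightarrow> runs m' q Q"
  shows "runs m (Seq (AskNbrs e b) q) Q"
proof (rule runs_Seq[where R = "\<lambda>x. x = m'"])
  show "runs m (AskNbrs e b) (\<lambda>x. x = m')"
    using assms by (intro runs_AskNbrs) (auto simp: nbr_list_nbrs)
qed (use assms(7) in blast)

lemma runs_Call_Seq:
  assumes "bounded m" and "exec wop wtest A p (initial xs) c m''" and "real c \<le> G" and "mem m'' 0 0 = x"
    and "map (val m) es = xs" and "val m e = i" and "x \<le> M" and "m' = store b i x m"
    and "bounded m' \<Longrightarrow> runs m' q Q"
  shows "runs m (Seq (Call p es b e) q) Q"
proof (rule runs_Seq[where R = "\<lambda>x. x = m'"])
  show "runs m (Call p es b e) (\<lambda>x. x = m')"
    using assms by (intro runs_Call[where c = c and m' = m'' and x = x]) auto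
qed (use assms(9) in blast)

end

context learning_ram
begin

lemma runs_grow:
  assumes m: "bounded m" and hl: "holds_list ps m" and ps: "set ps \<subseteq> univ A"
    and len: "length (expand A ps) \<le> L"
  shows "runs m grow (\<lambda>m'.
     frame {cand_bank, len_bank, nbr_bank, i_bank, j_bank, old_bank} m m' \<and> holds_list (expand A ps) m')"
proof -
  define F where "F = {cand_bank, len_bank, nbr_bank, i_bank, j_bank, old_bank}"
  define qs where "qs i = ps @ concat (map (nbrs A) (take i ps))" for i
  have qs_Suc: "qs (Suc i) = qs i @ nbrs A (ps ! i)" if "i < length ps" for i
    using that by (simp add: qs_def take_Suc_conv_app_nth)
  \<comment> \<open>The lists during the round are prefixes of the final one, so its length bounds
    them all.\<close>
  have qs_len: "length (qs i) \<le> L" for i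
  proof -
    have "concat (map (nbrs A) ps) = concat (map (nbrs A) (take i ps)) @ concat (map (nbrs A) (drop i ps))"
      by (metis append_take_drop_id concat_append map_append)
    then have "length (qs i) \<le> length (expand A ps)" by (simp add: qs_def expand_def)
    then show ?thesis using len by simp
  qed
  have len_ps: "length ps \<le> L" using len by (simp add: expand_def)
  define Inv where "Inv i m' \<longleftrightarrow> frame F m m' \<and> mem m' i_bank 0 = i \<and>
    mem m' old_bank 0 = length ps \<and> holds_list (qs i) m'" for i m'
  let ?copy = "Seq (Assign cand_bank (reg len_bank) (Cell nbr_bank (Add (reg j_bank) (Num 1))))
              (Seq (incr_reg len_bank 1) (incr_reg j_bank 1)) :: ('r, 'w, 'o) com"
  let ?inner = "While (Less (reg j_bank) (reg nbr_bank)) ?copy"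
  let ?body = "Seq (AskNbrs (Cell cand_bank (reg i_bank)) nbr_bank) (Seq (set_reg j_bank (Num 0))
       (Seq ?inner (incr_reg i_bank 1)))"
  have step: "val m' (Less (reg i_bank) (reg old_bank)) \<noteq> 0 \<and> runs m' ?body (Inv (Suc i))"
    if i: "i < length ps" and m': "bounded m'" and inv: "Inv i m'" for i m'
  proof
    have fr: "frame F m m'" and ci: "mem m' i_bank 0 = i" and co: "mem m' old_bank 0 = length ps"
      and hl': "holds_list (qs i) m'" using inv by (auto simp: Inv_def)
    show "val m' (Less (reg i_bank) (reg old_bank)) \<noteq> 0" using i ci co by simp
    define ns where "ns = nbrs A (ps ! i)"
    have psi: "ps ! i \<in> univ A" using i ps nth_mem by blast
    have len_ns: "length ns \<le> L" using nbrs_le[OF psi] by (simp add: ns_def length_nbrs)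
    have ns_le: "\<forall>x\<in>set ns. x \<le> M" using gaifman univ_le by (auto simp: ns_def set_nbrs)
    have cc: "val m' (Cell cand_bank (reg i_bank)) = ps ! i"
      using hl' i ci by (simp add: holds_list_def qs_def nth_append)
    have qs_ns: "qs (Suc i) = qs i @ ns" using qs_Suc[OF i] by (simp add: ns_def)
    define m1 where "m1 = store_list nbr_bank (nbr_list A (ps ! i)) m'"
    define m2 where "m2 = store j_bank 0 0 m1"
    define Inv2 where "Inv2 j m' \<longleftrightarrow> frame F m m' \<and> mem m' i_bank 0 = i \<and>
      mem m' old_bank 0 = length ps \<and> mem m' j_bank 0 = j \<and> mem m' nbr_bank 0 = length ns \<and>
      (\<forall>x<length ns. mem m' nbr_bank (Suc x) = ns ! x) \<and> holds_list (qs i @ take j ns) m'" for j m'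
    have Inv2_0: "Inv2 0 m2"
      unfolding Inv2_def
    proof (intro conjI)
      show "frame F m m2" unfolding m2_def m1_def using fr by (intro frame_store) (auto simp: F_def)
      show "holds_list (qs i @ take 0 ns) m2"
        using hl' by (simp add: holds_list_def m2_def m1_def mem_store mem_store_list)
    qed (use ci co in \<open>auto simp: m2_def m1_def mem_store mem_store_list nbr_list_nbrs ns_def\<close>)
    have step2: "val m' (Less (reg j_bank) (reg nbr_bank)) \<noteq> 0 \<and> runs m' ?copy (Inv2 (Suc j))"
      if j: "j < length ns" and m': "bounded m'" and inv: "Inv2 j m'" for j m'
    proof
      show "val m' (Less (reg j_bank) (reg nbr_bank)) \<noteq> 0" using inv j by (simp add: Inv2_def)
      define len' where "len' = length (qs i @ take j ns)"
      have cl: "mem m' len_bank 0 = len'" using inv by (simp add: Inv2_def holds_list_def len'_def)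
      have "Suc len' \<le> L" using qs_len[of "Suc i"] j by (simp add: qs_ns len'_def)
      then have b2: "Suc len' \<le> M" using L_le by simp
      have b1: "ns ! j \<le> M" using ns_le j by simp
      have b3: "Suc j \<le> M" using j len_ns L_le by simp
      define m3 where "m3 = store cand_bank len' (ns ! j) m'"
      define m4 where "m4 = store len_bank 0 (Suc len') m3"
      define m5 where "m5 = store j_bank 0 (Suc j) m4"
      note defs = m3_def m4_def m5_def mem_store
      have "holds_list ((qs i @ take j ns) @ [ns ! j]) m5"
        using inv by (intro holds_list_snoc[of _ m']) (auto simp: Inv2_def defs len'_def)
      then have "holds_list (qs i @ take (Suc j) ns) m5" using j by (simp add: take_Suc_conv_app_nth)
      moreover have "frame F m m5" unfolding m3_def m4_def m5_def
        using inv by (intro frame_store) (auto simp: F_def Inv2_def)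
      ultimately have "Inv2 (Suc j) m5" using inv by (simp add: Inv2_def defs)
      then have "runs m4 (incr_reg j_bank 1) (Inv2 (Suc j))" if "bounded m4"
        by (rule runs_Assign_eq[OF that _ _ b3 m5_def, rotated 2]) (use inv in \<open>simp_all add: Inv2_def defs\<close>)
      then have "runs m3 (Seq (incr_reg len_bank 1) (incr_reg j_bank 1)) (Inv2 (Suc j))" if "bounded m3"
        by (rule runs_Assign_Seq[OF that _ _ b2 m4_def, rotated 2]) (use cl in \<open>simp_all add: defs\<close>)
      then show "runs m' ?copy (Inv2 (Suc j))"
        by (rule runs_Assign_Seq[OF m' _ _ b1 m3_def, rotated 2])
          (use cl inv j in \<open>simp_all add: Inv2_def\<close>)
    qed
    have exit2: "runs m' (incr_reg i_bank 1) (Inv (Suc i))"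
      if m': "bounded m'" and inv: "Inv2 (length ns) m'" for m'
    proof (rule runs_Assign_eq[OF m' _ _ _ refl])
      show "Suc i \<le> M" using i len_ps L_le by simp
      have "frame F m (store i_bank 0 (Suc i) m')"
        using inv by (intro frame_store) (auto simp: Inv2_def F_def)
      then show "Inv (Suc i) (store i_bank 0 (Suc i) m')"
        using inv by (simp add: Inv_def Inv2_def mem_store qs_ns holds_list_def)
    qed (use inv in \<open>simp_all add: Inv2_def\<close>)
    have inner: "runs m2 ?inner (Inv2 (length ns))" if "bounded m2"
      by (rule runs_While[where I = Inv2 and n = "length ns", OF that Inv2_0 len_ns step2])
        (auto simp: Inv2_def)
    have "runs m2 (Seq ?inner (incr_reg i_bank 1)) (Inv (Suc i))" if "bounded m2"
      by (rule runs_Seq[OF inner[OF that] exit2])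
    then have "runs m1 (Seq (set_reg j_bank (Num 0)) (Seq ?inner (incr_reg i_bank 1))) (Inv (Suc i))"
      if "bounded m1"
      by (rule runs_Assign_Seq[OF that _ _ _ m2_def, rotated 3]) simp_all
    then show "runs m' ?body (Inv (Suc i))"
      by (rule runs_AskNbrs_Seq[OF m' cc _ L_le _ m1_def, rotated 2])
        (use len_ns ns_le in \<open>simp_all add: ns_def\<close>)
  qed
  define m1 where "m1 = store old_bank 0 (length ps) m"
  define m2 where "m2 = store i_bank 0 0 m1"
  have Inv_0: "Inv 0 m2"
    using hl unfolding Inv_def m2_def m1_def
    by (auto simp: F_def holds_list_def mem_store qs_def intro!: frame_store frame_refl)
  have "runs m2 (While (Less (reg i_bank) (reg old_bank)) ?body)
      (\<lambda>m'. frame F m m' \<and> holds_list (expand A ps) m')" if "bounded m2"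
    by (rule runs_While[where I = Inv and n = "length ps", OF that Inv_0 len_ps step])
      (auto simp: Inv_def qs_def expand_def)
  then have "runs m1 (Seq (set_reg i_bank (Num 0)) (While (Less (reg i_bank) (reg old_bank)) ?body))
      (\<lambda>m'. frame F m m' \<and> holds_list (expand A ps) m')" if "bounded m1"
    by (rule runs_Assign_Seq[OF that _ _ _ m2_def, rotated 3]) simp_all
  then show ?thesis
    unfolding grow_def F_def[symmetric]
    by (rule runs_Assign_Seq[OF m _ _ _ m1_def, rotated 3])
      (use hl len_ps L_le in \<open>simp_all add: holds_list_def\<close>)
qed

lemma set_expand: "set (expand A ps) = set ps \<union> gaifman A `` set ps"
  by (auto simp: expand_def set_nbrs)

lemma runs_grows:
  assumes "bounded m" and "holds_list ps m" and "set ps \<subseteq> univ A"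
    and "length ((expand A ^^ D) ps) \<le> L"
  shows "runs m (grows D) (\<lambda>m'.
     frame {cand_bank, len_bank, nbr_bank, i_bank, j_bank, old_bank} m m' \<and>
     holds_list ((expand A ^^ D) ps) m')"
  using assms
proof (induction D arbitrary: ps m)
  case 0
  then show ?case by (simp add: runs_Skip frame_refl)
next
  case (Suc D)
  have mono: "length qs \<le> length ((expand A ^^ n) qs)" for n qs
    by (induction n) (auto simp: expand_def)
  have eq: "(expand A ^^ D) (expand A ps) = (expand A ^^ Suc D) ps" by (simp add: funpow_swap1)
  have set: "set (expand A ps) \<subseteq> univ A" using Suc.prems(3) gaifman unfolding set_expand by blast
  have "length (expand A ps) \<le> L"
    using mono[of "expand A ps" D] Suc.prems(4) unfolding eq by linarith
  then have "runs m grow (\<lambda>m'. frame {cand_bank, len_bank, nbr_bank, i_bank, j_bank, old_bank} m m' \<and>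
      holds_list (expand A ps) m')"
    by (rule runs_grow[OF Suc.prems(1-3)])
  then show ?case
    unfolding grows.simps
  proof (rule runs_Seq)
    fix m'
    assume m': "bounded m'" and *: "frame {cand_bank, len_bank, nbr_bank, i_bank, j_bank, old_bank} m m' \<and>
      holds_list (expand A ps) m'"
    have "runs m' (grows D) (\<lambda>m''. frame {cand_bank, len_bank, nbr_bank, i_bank, j_bank, old_bank} m' m'' \<and>
        holds_list ((expand A ^^ D) (expand A ps)) m'')"
      using * Suc.prems(4) set unfolding eq[symmetric] by (intro Suc.IH[OF m']) auto
    then show "runs m' (grows D) (\<lambda>m''. frame {cand_bank, len_bank, nbr_bank, i_bank, j_bank, old_bank} m m'' \<and>
        holds_list ((expand A ^^ Suc D) ps) m'')"
      unfolding eq[symmetric] by (rule runs_mono) (use * frame_trans in blast)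
  qed
qed

section \<open>Trying all formulas and parameters\<close>

definition chosen :: "nat list \<Rightarrow> (nat \<Rightarrow> nat) \<Rightarrow> nat list" where
  "chosen ps g = map (\<lambda>i. ps ! g i) [0..<l]"

lemma params_eq:
  assumes "holds_list ps m" and "\<And>i. i < l \<Longrightarrow> mem m idx_bank i < length ps"
  shows "map (val m) (params l) = chosen ps (mem m idx_bank)"
  using assms by (simp add: params_def chosen_def holds_list_def)

lemma banks_params: "e \<in> set (params l) \<Longrightarrow> banks e = {cand_bank, idx_bank}"
  by (auto simp: params_def)

lemma runs_check:
  assumes m: "bounded m" and inp: "holds_input k T m" and hl: "holds_list ps m"
    and ps: "set ps \<subseteq> univ A" and idx: "\<And>i. i < l \<Longrightarrow> mem m idx_bank i < length ps"
    and \<psi>: "\<psi> \<in> set \<psi>s"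
  defines "us \<equiv> chosen ps (mem m idx_bank)"
  shows "runs m (check k l (code \<psi>) (prog \<psi>)) (\<lambda>m'.
     frame {i_bank, pos_bank, ok_bank, res_bank, sol_bank} m m' \<and>
     advances l (if fits T (H \<psi>) us then {(code \<psi>, us)} else {}) m m')"
proof -
  define F where "F = {i_bank, pos_bank, ok_bank, res_bank}"
  define F' where "F' = {i_bank, pos_bank, ok_bank, res_bank, sol_bank}"
  have FF': "frame F m m' \<Longrightarrow> frame F' m m'" for m' by (rule frame_weaken) (auto simp: F_def F'_def)
  define label where "label = Cell io_bank (Add (reg pos_bank) (Num k))"
  let ?args = "map (\<lambda>j. Cell io_bank (Add (reg pos_bank) (Num j))) [0..<k] @ params l"
  define passed where "passed i \<longleftrightarrow> fits (take i T) (H \<psi>) us" for i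
  define Inv where "Inv i m' \<longleftrightarrow> frame F m m' \<and> mem m' i_bank 0 = i \<and>
    mem m' pos_bank 0 = 1 + i * (k + 1) \<and> mem m' ok_bank 0 = of_bool (passed i)" for i m'
  have us: "us \<in> tuples l (univ A)"
    using ps idx nth_mem by (auto simp: us_def chosen_def tuples_def)
  have params': "map (val m') (params l) = us" if "frame F m m'" for m'
  proof -
    have "map (val m') (params l) = map (val m) (params l)"
    proof (rule map_cong[OF refl])
      fix e
      assume "e \<in> set (params l)"
      then show "val m' e = val m e"
        using that by (intro val_cong) (auto simp: banks_params F_def frame_def)
    qed
    also have "\<dots> = us" unfolding us_def using hl idx by (rule params_eq)
    finally show ?thesis .
  qed
  let ?tail = "Seq (incr_reg pos_bank (k + 1)) (incr_reg i_bank 1) :: ('r, 'w, 'o) com"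
  let ?test = "If (Add (Less (reg res_bank) label) (Less label (reg res_bank)))
               (set_reg ok_bank (Num 0)) Skip :: ('r, 'w, 'o) com"
  let ?body = "Seq (Call (prog \<psi>) ?args res_bank (Num 0)) (Seq ?test ?tail)"
  have step: "val m' (Less (reg i_bank) (reg io_bank)) \<noteq> 0 \<and> runs m' ?body (Inv (Suc i))"
    if i: "i < length T" and m': "bounded m'" and inv: "Inv i m'" for i m'
  proof
    have fr: "frame F m m'" and ci: "mem m' i_bank 0 = i" and cp: "mem m' pos_bank 0 = 1 + i * (k + 1)"
      and ck: "mem m' ok_bank 0 = of_bool (passed i)" using inv by (auto simp: Inv_def)
    have inp': "holds_input k T m'" using input_frame[OF inp fr] by (simp add: F_def)
    show "val m' (Less (reg i_bank) (reg io_bank)) \<noteq> 0"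
      using i ci inp' by (simp add: holds_input_def)
    obtain as b where Ti: "T ! i = (as, b)" by force
    have args: "map (val m') ?args = as @ us"
      using args_eq[OF inp' i cp] params'[OF fr] Ti by simp
    have "as @ us \<in> tuples (k + l) (univ A)"
      using us T_nth[OF i] Ti by (auto simp: tuples_def)
    then obtain c m'' where c: "exec wop wtest A (prog \<psi>) (initial (as @ us)) c m''" "real c \<le> G"
      "mem m'' 0 0 = of_bool (H \<psi> (as @ us))"
      using prog[OF \<psi>] by blast
    define m1 where "m1 = store res_bank 0 (of_bool (H \<psi> (as @ us))) m'"
    have passed_Suc: "passed (Suc i) \<longleftrightarrow> passed i \<and> H \<psi> (as @ us) = b"
      using i Ti by (auto simp: passed_def fits_def take_Suc_conv_app_nth)
    have io1: "mem m1 io_bank = mem m' io_bank" by (simp add: m1_def mem_store)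
    have lab: "val m1 label = of_bool b"
      using inp' i Ti cp by (simp add: label_def m1_def mem_store holds_input_def)
    define R where "R m2 \<longleftrightarrow> frame F m m2 \<and> mem m2 i_bank 0 = i \<and>
      mem m2 pos_bank 0 = 1 + i * (k + 1) \<and> mem m2 ok_bank 0 = of_bool (passed (Suc i))" for m2
    have fr1: "frame F m m1" unfolding m1_def using fr by (intro frame_store) (auto simp: F_def)
    have A: "runs m1 ?test R" if b1: "bounded m1"
    proof (rule runs_If[OF b1])
      assume "val m1 (Add (Less (reg res_bank) label) (Less label (reg res_bank))) \<noteq> 0"
      then have "\<not> passed (Suc i)"
        unfolding passed_Suc using lab by (auto simp: m1_def mem_store)
      moreover have "frame F m (store ok_bank 0 0 m1)"
        using fr1 by (intro frame_store) (auto simp: F_def)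
      ultimately have "R (store ok_bank 0 0 m1)"
        using ci cp by (simp add: R_def m1_def mem_store)
      then show "runs m1 (set_reg ok_bank (Num 0)) R"
        by (intro runs_Assign_eq[OF b1 _ _ _ refl]) simp_all
    next
      assume "val m1 (Add (Less (reg res_bank) label) (Less label (reg res_bank))) = 0"
      then have "H \<psi> (as @ us) = b"
        using lab by (auto simp: m1_def mem_store split: if_splits)
      then have "R m1" using fr1 ci cp ck by (simp add: R_def m1_def mem_store passed_Suc)
      then show "runs m1 Skip R" by (rule runs_Skip[OF b1])
    qed
    have B: "runs m2 ?tail (Inv (Suc i))" if b2: "bounded m2" and R: "R m2" for m2
    proof -
      have le: "1 + i * (k + 1) + (k + 1) \<le> M" using pos_le[of "Suc i"] i by (simp add: add_ac)
      have le': "Suc i \<le> M" using i T_L L_le by linarith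
      define m3 where "m3 = store pos_bank 0 (1 + i * (k + 1) + (k + 1)) m2"
      define m4 where "m4 = store i_bank 0 (Suc i) m3"
      have "frame F m m4" unfolding m3_def m4_def
        using R by (intro frame_store) (auto simp: F_def R_def)
      then have "Inv (Suc i) m4" using R by (simp add: Inv_def R_def m3_def m4_def mem_store)
      then have "runs m3 (incr_reg i_bank 1) (Inv (Suc i))" if "bounded m3"
        by (rule runs_Assign_eq[OF that _ _ le' m4_def, rotated 2])
          (use R in \<open>simp_all add: R_def m3_def mem_store\<close>)
      then show ?thesis
        by (rule runs_Assign_Seq[OF b2 _ _ le m3_def, rotated 2]) (use R in \<open>simp_all add: R_def\<close>)
    qed
    have "runs m1 (Seq ?test ?tail) (Inv (Suc i))" if "bounded m1"
      by (rule runs_Seq[OF A[OF that] B])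
    then show "runs m' ?body (Inv (Suc i))"
      by (rule runs_Call_Seq[OF m' c args _ _ m1_def, rotated 2]) (use M_pos in simp_all)
  qed
  let ?loop = "While (Less (reg i_bank) (reg io_bank)) ?body"
  let ?save = "Seq (set_reg sol_bank (Num (Suc (code \<psi>)))) (puts sol_bank (Num 1) (params l)) :: ('r, 'w, 'o) com"
  define Q where "Q m' \<longleftrightarrow> frame F' m m' \<and>
     advances l (if fits T (H \<psi>) us then {(code \<psi>, us)} else {}) m m'" for m'
  have final: "runs m' (If (reg ok_bank) ?save Skip) Q" if m': "bounded m'" and inv: "Inv (length T) m'" for m'
  proof (rule runs_If[OF m'])
    have fr: "frame F m m'" and ck: "mem m' ok_bank 0 = of_bool (fits T (H \<psi>) us)"
      using inv by (auto simp: Inv_def passed_def)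
    {
      assume "val m' (reg ok_bank) = 0"
      then have "\<not> fits T (H \<psi>) us" using ck by (cases "fits T (H \<psi>) us") simp_all
      then have "Q m'" using FF'[OF fr] frameD[OF fr, of sol_bank] by (simp add: Q_def advances_def F_def)
      then show "runs m' Skip Q" by (rule runs_Skip[OF m'])
    }
    assume "val m' (reg ok_bank) \<noteq> 0"
    then have fit: "fits T (H \<psi>) us" using ck by (cases "fits T (H \<psi>) us") simp_all
    define m1 where "m1 = store sol_bank 0 (Suc (code \<psi>)) m'"
    define m2 where "m2 = store_block sol_bank 1 us m1"
    have fr1: "frame F' m m1" "frame F' m m2" unfolding m1_def m2_def
      using FF'[OF fr] by (auto intro!: frame_store simp: F'_def)
    have len_us: "length us = l" by (simp add: us_def chosen_def)
    have "Q m2"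
      unfolding Q_def advances_def using fit fr1 len_us
      by (auto simp: m2_def m1_def mem_store mem_store_block)
    moreover have "map (val m1) (params l) = us"
    proof -
      have "map (val m1) (params l) = map (val m') (params l)"
      proof (rule map_cong[OF refl])
        fix e
        assume "e \<in> set (params l)"
        then show "val m1 e = val m' e" by (intro val_cong) (auto simp: banks_params m1_def mem_store)
      qed
      then show ?thesis using params'[OF fr] by simp
    qed
    moreover have "\<forall>x\<in>set us. x \<le> M" using us univ_le by (auto simp: tuples_def)
    ultimately have "runs m1 (puts sol_bank (Num 1) (params l)) Q" if "bounded m1"
      using that by (intro runs_puts_eq[OF _ _ _ _ _ _ m2_def]) (auto simp: banks_params)
    then show "runs m' ?save Q"
      by (rule runs_Assign_Seq[OF m' _ _ code_le[OF \<psi>] m1_def, rotated 2]) simp_all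
  qed
  define m1 where "m1 = store i_bank 0 0 m"
  define m2 where "m2 = store pos_bank 0 1 m1"
  define m3 where "m3 = store ok_bank 0 1 m2"
  have "frame F m m3" unfolding m1_def m2_def m3_def
    by (intro frame_store frame_refl) (auto simp: F_def)
  then have Inv_0: "Inv 0 m3"
    by (simp add: Inv_def m1_def m2_def m3_def mem_store passed_def fits_def)
  have loop: "runs m3 ?loop (Inv (length T))" if "bounded m3"
  proof (rule runs_While[where I = Inv and n = "length T", OF that Inv_0 T_L step])
    fix m'
    assume inv: "Inv (length T) m'"
    then have "holds_input k T m'" using input_frame[OF inp, of F m'] by (simp add: Inv_def F_def)
    then show "val m' (Less (reg i_bank) (reg io_bank)) = 0 \<and> Inv (length T) m'"
      using inv by (simp add: Inv_def holds_input_def)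
  qed
  have "runs m3 (Seq ?loop (If (reg ok_bank) ?save Skip)) Q" if "bounded m3"
    by (rule runs_Seq[OF loop[OF that] final])
  then have "runs m2 (Seq (set_reg ok_bank (Num 1)) (Seq ?loop (If (reg ok_bank) ?save Skip))) Q" if "bounded m2"
    by (rule runs_Assign_Seq[OF that _ _ M_pos m3_def, rotated 2]) simp_all
  then have "runs m1 (Seq (set_reg pos_bank (Num 1)) (Seq (set_reg ok_bank (Num 1))
      (Seq ?loop (If (reg ok_bank) ?save Skip)))) Q" if "bounded m1"
    by (rule runs_Assign_Seq[OF that _ _ M_pos m2_def, rotated 2]) simp_all
  then have "runs m (check k l (code \<psi>) (prog \<psi>)) Q"
    unfolding check_def Let_def label_def
    by (rule runs_Assign_Seq[OF m _ _ _ m1_def, rotated 3]) simp_all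
  then show ?thesis unfolding Q_def F'_def .
qed

lemma runs_checks:
  assumes "bounded m" and "holds_input k T m" and "holds_list ps m"
    and ps: "set ps \<subseteq> univ A" and idx: "\<And>i. i < l \<Longrightarrow> mem m idx_bank i < length ps"
    and "set \<chi>s \<subseteq> set \<psi>s"
  shows "runs m (checks k l (map (\<lambda>\<psi>. (code \<psi>, prog \<psi>)) \<chi>s)) (\<lambda>m'.
     frame {i_bank, pos_bank, ok_bank, res_bank, sol_bank} m m' \<and>
     advances l {(code \<psi>, chosen ps (mem m idx_bank)) | \<psi>.
       \<psi> \<in> set \<chi>s \<and> fits T (H \<psi>) (chosen ps (mem m idx_bank))} m m')"
  using assms
proof (induction \<chi>s arbitrary: m)
  case Nil
  then show ?case by (simp add: runs_Skip frame_refl advances_refl)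
next
  case (Cons \<psi> \<chi>s)
  let ?F = "{i_bank, pos_bank, ok_bank, res_bank, sol_bank}"
  let ?us = "chosen ps (mem m idx_bank)"
  let ?S = "if fits T (H \<psi>) ?us then {(code \<psi>, ?us)} else {}"
  let ?S' = "{(code \<chi>, ?us) | \<chi>. \<chi> \<in> set \<chi>s \<and> fits T (H \<chi>) ?us}"
  have 1: "runs m (check k l (code \<psi>) (prog \<psi>)) (\<lambda>m'. frame ?F m m' \<and> advances l ?S m m')"
    using Cons.prems by (intro runs_check) auto
  have 2: "runs m' (checks k l (map (\<lambda>\<psi>. (code \<psi>, prog \<psi>)) \<chi>s))
      (\<lambda>m''. frame ?F m m'' \<and> advances l (?S \<union> ?S') m m'')"
    if b: "bounded m'" and R: "frame ?F m m' \<and> advances l ?S m m'" for m'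
  proof -
    have fr: "frame ?F m m'" and adv: "advances l ?S m m'" using R by blast+
    have idx': "mem m' idx_bank = mem m idx_bank" using frameD[OF fr] by simp
    have inp: "holds_input k T m'" using input_frame[OF Cons.prems(2) fr] by simp
    have hl: "holds_list ps m'" using list_frame[OF Cons.prems(3) fr] by simp
    have "runs m' (checks k l (map (\<lambda>\<psi>. (code \<psi>, prog \<psi>)) \<chi>s)) (\<lambda>m''. frame ?F m' m'' \<and>
        advances l ?S' m' m'')"
      using Cons.IH[OF b inp hl ps] Cons.prems(5,6) unfolding idx' by simp
    then show ?thesis
      by (rule runs_mono) (use frame_trans[OF fr] advances_trans[OF adv] in blast)
  qed
  have "?S \<union> ?S' = {(code \<chi>, ?us) | \<chi>. \<chi> \<in> set (\<psi> # \<chi>s) \<and> fits T (H \<chi>) ?us}"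
    by auto
  then show ?case
    using runs_Seq[OF 1 2] by simp
qed

text \<open>The solutions met by the \<open>j\<close> innermost loops while the entries of
  \<open>g\<close> from \<open>j\<close> on stay fixed.\<close>

fun sols :: "nat list \<Rightarrow> nat \<Rightarrow> (nat \<Rightarrow> nat) \<Rightarrow> (nat \<times> nat list) set" where
  "sols ps 0 g = {(code \<psi>, chosen ps g) | \<psi>. \<psi> \<in> set \<psi>s \<and> fits T (H \<psi>) (chosen ps g)}"
| "sols ps (Suc j) g = (\<Union>x<length ps. sols ps j (g(j := x)))"

text \<open>The entries below \<open>j\<close> are overwritten before they are used. The loops may
  therefore start from arbitrary leftovers in \<open>idx_bank\<close>.\<close>

lemma sols_cong: "(\<And>i. j \<le> i \<Longrightarrow> g i = g' i) \<Longrightarrow> sols ps j g = sols ps j g'"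
proof (induction j arbitrary: g g')
  case 0
  then have "g = g'" by (simp add: fun_eq_iff)
  then show ?case by simp
next
  case (Suc j)
  have "sols ps j (g(j := x)) = sols ps j (g'(j := x))" for x
    by (rule Suc.IH) (use Suc.prems in auto)
  then show ?case by simp
qed

lemma sols_sound:
  "(c, us) \<in> sols ps j g \<Longrightarrow> (\<And>i. j \<le> i \<Longrightarrow> i < l \<Longrightarrow> g i < length ps) \<Longrightarrow>
   \<exists>\<psi>\<in>set \<psi>s. c = code \<psi> \<and> fits T (H \<psi>) us \<and> length us = l \<and> set us \<subseteq> set ps"
proof (induction j arbitrary: g)
  case 0
  then obtain \<psi> where "\<psi> \<in> set \<psi>s" "c = code \<psi>" "fits T (H \<psi>) us" "us = chosen ps g" by auto
  moreover from this have "length us = l" "set us \<subseteq> set ps" using 0(2) by (auto simp: chosen_def)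
  ultimately show ?case by blast
next
  case (Suc j)
  then obtain x where x: "x < length ps" "(c, us) \<in> sols ps j (g(j := x))" by auto
  show ?case by (rule Suc.IH[OF x(2)]) (use Suc.prems(2) x(1) in auto)
qed

lemma sols_complete:
  assumes "\<psi> \<in> set \<psi>s" and "fits T (H \<psi>) (chosen ps g')" and "\<And>i. i < j \<Longrightarrow> g' i < length ps"
    and "\<And>i. j \<le> i \<Longrightarrow> g' i = g i"
  shows "(code \<psi>, chosen ps g') \<in> sols ps j g"
  using assms(3,4)
proof (induction j arbitrary: g)
  case 0
  then have "g' = g" by (simp add: fun_eq_iff)
  then show ?case using assms by auto
next
  case (Suc j)
  have "(code \<psi>, chosen ps g') \<in> sols ps j (g(j := g' j))"
    by (rule Suc.IH) (use Suc.prems in auto)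
  then show ?case using Suc.prems(1)[of j] by auto
qed

text \<open>The clause on the entries from \<open>j\<close> on is what the enclosing loops rely on:
  their own indices survive the inner ones.\<close>

lemma runs_search:
  assumes "bounded m" and "holds_input k T m" and "holds_list ps m"
    and ps: "set ps \<subseteq> univ A" and len: "length ps \<le> L" and "j \<le> l"
    and "\<And>i. j \<le> i \<Longrightarrow> i < l \<Longrightarrow> mem m idx_bank i < length ps"
  shows "runs m (search k l (map (\<lambda>\<psi>. (code \<psi>, prog \<psi>)) \<psi>s) j) (\<lambda>m'.
     frame {idx_bank, i_bank, pos_bank, ok_bank, res_bank, sol_bank} m m' \<and>
     (\<forall>i\<ge>j. mem m' idx_bank i = mem m idx_bank i) \<and>
     advances l (sols ps j (mem m idx_bank)) m m')"
  using assms(1-3,6,7)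
proof (induction j arbitrary: m)
  case 0
  have "runs m (checks k l (map (\<lambda>\<psi>. (code \<psi>, prog \<psi>)) \<psi>s)) (\<lambda>m'.
     frame {i_bank, pos_bank, ok_bank, res_bank, sol_bank} m m' \<and>
     advances l {(code \<psi>, chosen ps (mem m idx_bank)) | \<psi>.
       \<psi> \<in> set \<psi>s \<and> fits T (H \<psi>) (chosen ps (mem m idx_bank))} m m')"
    using 0 ps by (intro runs_checks) auto
  then show ?case
    unfolding search.simps sols.simps
  proof (rule runs_mono)
    fix m'
    assume *: "frame {i_bank, pos_bank, ok_bank, res_bank, sol_bank} m m' \<and>
     advances l {(code \<psi>, chosen ps (mem m idx_bank)) | \<psi>.
       \<psi> \<in> set \<psi>s \<and> fits T (H \<psi>) (chosen ps (mem m idx_bank))} m m'"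
    have "frame {idx_bank, i_bank, pos_bank, ok_bank, res_bank, sol_bank} m m'"
      by (rule frame_weaken[OF conjunct1[OF *]]) auto
    moreover have "mem m' idx_bank = mem m idx_bank"
      by (rule frameD[OF conjunct1[OF *]]) auto
    ultimately show "frame {idx_bank, i_bank, pos_bank, ok_bank, res_bank, sol_bank} m m' \<and>
      (\<forall>i\<ge>0. mem m' idx_bank i = mem m idx_bank i) \<and>
      advances l {(code \<psi>, chosen ps (mem m idx_bank)) | \<psi>.
       \<psi> \<in> set \<psi>s \<and> fits T (H \<psi>) (chosen ps (mem m idx_bank))} m m'"
      using conjunct2[OF *] by simp
  qed
next
  case (Suc j)
  define F where "F = {idx_bank, i_bank, pos_bank, ok_bank, res_bank, sol_bank}"
  define g where "g = mem m idx_bank"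
  let ?search = "search k l (map (\<lambda>\<psi>. (code \<psi>, prog \<psi>)) \<psi>s) j"
  let ?incr = "Assign idx_bank (Num j) (Add (Cell idx_bank (Num j)) (Num 1)) :: ('r, 'w, 'o) com"
  define Inv where "Inv x m' \<longleftrightarrow> frame F m m' \<and> (\<forall>i>j. mem m' idx_bank i = g i) \<and>
    mem m' idx_bank j = x \<and> advances l (\<Union>y<x. sols ps j (g(j := y))) m m'" for x m'
  have step: "val m' (Less (Cell idx_bank (Num j)) (reg len_bank)) \<noteq> 0 \<and>
      runs m' (Seq ?search ?incr) (Inv (Suc x))"
    if x: "x < length ps" and m': "bounded m'" and inv: "Inv x m'" for x m'
  proof
    have fr: "frame F m m'" and gi: "\<And>i. i > j \<Longrightarrow> mem m' idx_bank i = g i"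
      and cj: "mem m' idx_bank j = x" and adv: "advances l (\<Union>y<x. sols ps j (g(j := y))) m m'"
      using inv by (auto simp: Inv_def)
    have inp: "holds_input k T m'" using input_frame[OF Suc.prems(2) fr] by (simp add: F_def)
    have hl: "holds_list ps m'" using list_frame[OF Suc.prems(3) fr] by (simp add: F_def)
    show "val m' (Less (Cell idx_bank (Num j)) (reg len_bank)) \<noteq> 0"
      using x cj hl by (simp add: holds_list_def)
    \<comment> \<open>Below \<open>j\<close> the bank still holds the final indices of the previous
      round; above \<open>j\<close> it agrees with \<open>g\<close>.\<close>
    have sols: "sols ps j (mem m' idx_bank) = sols ps j (g(j := x))"
      by (rule sols_cong) (use gi cj in auto)
    have idx: "mem m' idx_bank i < length ps" if "j \<le> i" "i < l" for i
      using that x cj gi[of i] Suc.prems(5)[of i] by (cases "i = j") (auto simp: g_def)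
    have 1: "runs m' ?search (\<lambda>m''. frame F m' m'' \<and> (\<forall>i\<ge>j. mem m'' idx_bank i = mem m' idx_bank i) \<and>
        advances l (sols ps j (g(j := x))) m' m'')"
      using Suc.IH[OF m' inp hl] Suc.prems(4) idx unfolding sols F_def by simp
    have 2: "runs m'' ?incr (Inv (Suc x))"
      if b: "bounded m''" and R: "frame F m' m'' \<and> (\<forall>i\<ge>j. mem m'' idx_bank i = mem m' idx_bank i) \<and>
        advances l (sols ps j (g(j := x))) m' m''" for m''
    proof (rule runs_Assign_eq[OF b _ _ _ refl])
      show "Suc x \<le> M" using x len L_le by simp
      have "frame F m (store idx_bank j (Suc x) m'')"
        using frame_trans[OF fr] R by (intro frame_store) (auto simp: F_def)
      moreover have "advances l ((\<Union>y<x. sols ps j (g(j := y))) \<union> sols ps j (g(j := x))) m m''"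
        using advances_trans[OF adv] R by blast
      then have "advances l (\<Union>y<Suc x. sols ps j (g(j := y))) m m''"
        by (simp add: lessThan_Suc Un_commute)
      then have "advances l (\<Union>y<Suc x. sols ps j (g(j := y))) m (store idx_bank j (Suc x) m'')"
        by (rule advances_cong) (simp_all add: mem_store)
      ultimately show "Inv (Suc x) (store idx_bank j (Suc x) m'')"
        using R gi by (simp add: Inv_def mem_store)
    qed (use R cj in simp_all)
    show "runs m' (Seq ?search ?incr) (Inv (Suc x))" by (rule runs_Seq[OF 1 2])
  qed
  define m1 where "m1 = store idx_bank j 0 m"
  have "frame F m m1" unfolding m1_def by (intro frame_store frame_refl) (simp add: F_def)
  then have Inv_0: "Inv 0 m1"
    by (simp add: Inv_def m1_def mem_store g_def advances_def)
  have "runs m1 (While (Less (Cell idx_bank (Num j)) (reg len_bank)) (Seq ?search ?incr))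
      (Inv (length ps))" if "bounded m1"
  proof (rule runs_While[where I = Inv and n = "length ps", OF that Inv_0 len step])
    fix m'
    assume inv: "Inv (length ps) m'"
    then have "holds_list ps m'" using list_frame[OF Suc.prems(3), of F m'] by (simp add: Inv_def F_def)
    then show "val m' (Less (Cell idx_bank (Num j)) (reg len_bank)) = 0 \<and> Inv (length ps) m'"
      using inv by (simp add: Inv_def holds_list_def)
  qed
  then have "runs m (search k l (map (\<lambda>\<psi>. (code \<psi>, prog \<psi>)) \<psi>s) (Suc j)) (Inv (length ps))"
    unfolding search.simps
    by (rule runs_Assign_Seq[OF Suc.prems(1) _ _ _ m1_def, rotated 3]) simp_all
  then show ?case
    by (rule runs_mono) (auto simp: Inv_def g_def F_def Suc_le_eq)
qed

section \<open>The complete program\<close>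

lemma runs_emit:
  assumes m: "bounded m"
  shows "runs m (emit l) (\<lambda>m'. \<forall>j\<le>l. mem m' io_bank j = mem m sol_bank j)"
proof -
  define m1 where "m1 = store io_bank 0 (mem m sol_bank 0) m"
  define xs where "xs = map (\<lambda>j. mem m sol_bank (Suc j)) [0..<l]"
  define m2 where "m2 = store_block io_bank 1 xs m1"
  have "\<forall>j\<le>l. mem m2 io_bank j = mem m sol_bank j"
    by (auto simp: m2_def m1_def mem_store mem_store_block xs_def Suc_le_eq)
  then have "runs m1 (puts io_bank (Num 1) (map (\<lambda>j. Cell sol_bank (Num (Suc j))) [0..<l]))
      (\<lambda>m'. \<forall>j\<le>l. mem m' io_bank j = mem m sol_bank j)" if "bounded m1"
    by (rule runs_puts_eq[OF that _ _ _ _ _ m2_def, rotated 5])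
      (auto simp: xs_def m1_def mem_store mem_le[OF m])
  then show ?thesis
    unfolding emit_def
    by (rule runs_Assign_Seq[OF m _ _ _ m1_def, rotated 3]) (simp_all add: mem_le[OF m])
qed

lemma bounded_initial: "bounded (initial (encode_training T))"
proof -
  have "x \<le> M" if "x \<in> set (encode_training T)" for x
  proof -
    consider "x = length T" | as b where "(as, b) \<in> set T" "x \<in> set as" | "x \<le> 1"
      using \<open>x \<in> set (encode_training T)\<close> by (auto simp: encode_training_def split: if_splits)
    then show ?thesis
    proof cases
      case 1
      then show ?thesis using T_L L_le by simp
    next
      case 2
      then show ?thesis using T[OF 2(1)] univ_le[of x] by (auto simp: tuples_def)
    next
      case 3
      then show ?thesis using M_pos by simp
    qed
  qed
  then show ?thesis
    using nth_mem by (auto simp: bounded_def initial_def store_list_def)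
qed

lemma runs_learner:
  fixes D :: nat
  defines "ps \<equiv> (expand A ^^ D) (0 # concat (map fst T))"
  assumes len0: "1 + length T * k \<le> L" and len: "length ps \<le> L"
  shows "runs (initial (encode_training T)) (learner k l D (map (\<lambda>\<psi>. (code \<psi>, prog \<psi>)) \<psi>s))
    (\<lambda>m. if rejects m then \<not> (\<exists>\<psi>\<in>set \<psi>s. \<exists>us. length us = l \<and> set us \<subseteq> set ps \<and> fits T (H \<psi>) us)
      else \<exists>\<psi>\<in>set \<psi>s. \<exists>us\<in>tuples l (univ A). returns code m \<psi> us \<and> fits T (H \<psi>) us)"
proof -
  define ps0 where "ps0 = 0 # concat (map fst T)"
  define m0 :: "'s memory" where "m0 = initial (encode_training T)"
  let ?cps = "map (\<lambda>\<psi>. (code \<psi>, prog \<psi>)) \<psi>s"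
  have m0: "bounded m0" unfolding m0_def by (rule bounded_initial)
  have inp: "holds_input k T m0" unfolding m0_def using T by (intro holds_input_initial) (auto simp: tuples_def)
  have zero: "mem m0 b i = 0" if "b \<noteq> io_bank" for b i
    using that by (simp add: m0_def initial_def store_list_def)
  have ps0: "set ps0 \<subseteq> univ A" using T zero_in by (fastforce simp: ps0_def tuples_def)
  have "set ((expand A ^^ n) ps0) \<subseteq> univ A" for n
  proof (induction n)
    case (Suc n)
    then show ?case using gaifman by (auto simp: set_expand)
  qed (use ps0 in simp)
  then have ps: "set ps \<subseteq> univ A" unfolding ps_def ps0_def[symmetric] .
  define F where "F = {cand_bank, len_bank, nbr_bank, i_bank, j_bank, old_bank, pos_bank}"
  define R where "R m \<longleftrightarrow> frame F m0 m \<and> holds_list ps0 m" for m :: "'s memory"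
  define R' where "R' m \<longleftrightarrow> frame F m0 m \<and> holds_list ps m" for m :: "'s memory"
  define R'' where "R'' m \<longleftrightarrow> (\<exists>g. advances l (sols ps l g) m0 m)" for m :: "'s memory"
  have 1: "runs m0 (collect k) R"
  proof (rule runs_mono[OF runs_collect[OF m0 inp zero zero len0]])
    show "R m" if "frame {cand_bank, len_bank, i_bank, pos_bank} m0 m \<and>
        holds_list (0 # concat (map fst T)) m" for m
      using that frame_weaken[of _ m0 m F] by (auto simp: R_def ps0_def F_def)
  qed simp_all
  have 2: "runs m (grows D) R'" if b: "bounded m" and m: "R m" for m
  proof (rule runs_mono[OF runs_grows[OF b _ ps0]])
    show "holds_list ps0 m" using m by (simp add: R_def)
    show "length ((expand A ^^ D) ps0) \<le> L" using len by (simp add: ps_def ps0_def)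
    show "R' m'" if "frame {cand_bank, len_bank, nbr_bank, i_bank, j_bank, old_bank} m m' \<and>
       holds_list ((expand A ^^ D) ps0) m'" for m'
    proof -
      have "frame F m m'" by (rule frame_weaken[OF conjunct1[OF that]]) (auto simp: F_def)
      then show ?thesis using that m frame_trans[of F m0 m m'] by (auto simp: R_def R'_def ps_def ps0_def)
    qed
  qed
  have 3: "runs m (search k l ?cps l) R''" if b: "bounded m" and m: "R' m" for m
  proof (rule runs_mono[OF runs_search[OF b _ _ ps len order_refl]])
    have fr: "frame F m0 m" using m by (simp add: R'_def)
    show "holds_input k T m" using input_frame[OF inp fr] by (simp add: F_def)
    show "holds_list ps m" using m by (simp add: R'_def)
    have "mem m sol_bank = mem m0 sol_bank" using frameD[OF fr] by (simp add: F_def)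
    then show "R'' m'" if "frame {idx_bank, i_bank, pos_bank, ok_bank, res_bank, sol_bank} m m' \<and>
       (\<forall>i\<ge>l. mem m' idx_bank i = mem m idx_bank i) \<and> advances l (sols ps l (mem m idx_bank)) m m'" for m'
      using that advances_cong[of l _ m m' m0 m'] unfolding R''_def by auto
  qed simp
  have 4: "runs m (emit l) (\<lambda>m. if rejects m
      then \<not> (\<exists>\<psi>\<in>set \<psi>s. \<exists>us. length us = l \<and> set us \<subseteq> set ps \<and> fits T (H \<psi>) us)
      else \<exists>\<psi>\<in>set \<psi>s. \<exists>us\<in>tuples l (univ A). returns code m \<psi> us \<and> fits T (H \<psi>) us)"
    if b: "bounded m" and m: "R'' m" for m
  proof (rule runs_mono[OF runs_emit[OF b]])
    fix m' :: "'s memory"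
    assume io: "\<forall>j\<le>l. mem m' io_bank j = mem m sol_bank j"
    obtain g where g: "advances l (sols ps l g) m0 m" using m by (auto simp: R''_def)
    show "if rejects m'
      then \<not> (\<exists>\<psi>\<in>set \<psi>s. \<exists>us. length us = l \<and> set us \<subseteq> set ps \<and> fits T (H \<psi>) us)
      else \<exists>\<psi>\<in>set \<psi>s. \<exists>us\<in>tuples l (univ A). returns code m' \<psi> us \<and> fits T (H \<psi>) us"
    proof (cases "rejects m'")
      case True
      then have "mem m sol_bank 0 = 0" using io by (simp add: rejects_def)
      \<comment> \<open>A solution met during the search would have left a successor in cell
        0.\<close>
      then have empty: "sols ps l g = {}" using g by (auto simp: advances_def)
      have False if "\<psi> \<in> set \<psi>s" "length us = l" "set us \<subseteq> set ps" "fits T (H \<psi>) us" for \<psi> us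
      proof -
        have "\<forall>i<l. \<exists>x<length ps. ps ! x = us ! i"
          using that(2,3) by (metis in_set_conv_nth nth_mem subsetD)
        then obtain h where h: "\<And>i. i < l \<Longrightarrow> h i < length ps \<and> ps ! h i = us ! i" by metis
        \<comment> \<open>Every entry of \<open>us\<close> occurs among the candidates and hence has
          an index. From \<open>l\<close> on, \<open>g'\<close> must agree with the indices
          \<open>g\<close> left outside the loops.\<close>
        define g' where "g' i = (if i < l then h i else g i)" for i
        have "chosen ps g' = us"
          using h that(2) by (intro nth_equalityI) (auto simp: chosen_def g'_def)
        then have "(code \<psi>, us) \<in> sols ps l g"
          using sols_complete[OF that(1), of ps g' l g] that(4) h by (simp add: g'_def)
        then show False using empty by blast
      qed
      then show ?thesis using True by auto
    next
      case False
      \<comment> \<open>In the initial memory this cell is 0, so \<open>sol_bank\<close> has changed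
        and the second alternative of \<open>advances\<close> applies.\<close>
      then have "mem m sol_bank 0 \<noteq> mem m0 sol_bank 0" using io zero by (simp add: rejects_def)
      then obtain c us where cu: "(c, us) \<in> sols ps l g" "mem m sol_bank 0 = Suc c"
        "\<forall>j<l. mem m sol_bank (Suc j) = us ! j"
        using g by (auto simp: advances_def)
      obtain \<psi> where \<psi>: "\<psi> \<in> set \<psi>s" "c = code \<psi>" "fits T (H \<psi>) us" "length us = l" "set us \<subseteq> set ps"
        using sols_sound[OF cu(1)] by auto
      have "returns code m' \<psi> us" using cu io \<psi> by (simp add: returns_def)
      moreover have "us \<in> tuples l (univ A)" using \<psi> ps by (auto simp: tuples_def)
      ultimately show ?thesis using False \<psi> by auto
    qed
  qed
  show ?thesis
    unfolding learner_def m0_def[symmetric]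
    by (rule runs_Seq[OF 1 runs_Seq[OF 2 runs_Seq[OF 3 4]]])
qed

lemma length_expand_power:
  assumes d: "\<And>a. a \<in> univ A \<Longrightarrow> card (gaifman A `` {a}) \<le> d" and ps: "set ps \<subseteq> univ A"
  shows "length ((expand A ^^ n) ps) \<le> length ps * (1 + d) ^ n"
proof -
  have exp: "length (expand A qs) \<le> length qs * (1 + d)" if "set qs \<subseteq> univ A" for qs
  proof -
    have "length (concat (map (nbrs A) qs)) \<le> length qs * d"
      using that
    proof (induction qs)
      case (Cons q qs)
      then show ?case using d[of q] by (simp add: length_nbrs add_mono)
    qed simp
    then show ?thesis by (simp add: expand_def)
  qed
  have "set ((expand A ^^ n) ps) \<subseteq> univ A \<and> length ((expand A ^^ n) ps) \<le> length ps * (1 + d) ^ n"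
  proof (induction n)
    case (Suc n)
    let ?qs = "(expand A ^^ n) ps"
    have "length (expand A ?qs) \<le> length ?qs * (1 + d)" using Suc exp by blast
    also have "\<dots> \<le> length ps * (1 + d) ^ n * (1 + d)" using Suc by (intro mult_right_mono) auto
    finally show ?case using Suc gaifman by (auto simp: set_expand algebra_simps)
  qed (use ps in simp)
  then show ?thesis ..
qed

lemma expand_power_reaches:
  assumes "a \<in> set ps" and "(a, b) \<in> gaifman A ^^ i" and "i \<le> n"
  shows "b \<in> set ((expand A ^^ n) ps)"
proof -
  have mono: "set ((expand A ^^ i) ps) \<subseteq> set ((expand A ^^ (i + j)) ps)" for i j
    by (induction j) (auto simp: set_expand)
  have "b \<in> set ((expand A ^^ i) ps)" if "(a, b) \<in> gaifman A ^^ i" for b i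
    using that by (induction i arbitrary: b) (use assms(1) in \<open>auto simp: set_expand\<close>)
  then show ?thesis using assms(2,3) mono[of i "n - i"] by auto
qed

end

section \<open>Exact learning in polynomial time\<close>

lemma weight_symbols_zero:
  "weight_types S \<Longrightarrow> weight_symbols S W \<Longrightarrow> W w = Some (m, G) \<Longrightarrow> \<zero>\<^bsub>G\<^esub> \<in> carrier G"
  unfolding weight_types_def weight_symbols_def
  by (metis abelian_group.axioms(1) abelian_monoid.zero_closed ring.is_abelian_group)

lemma size_cost_le_log: "1 \<le> n \<Longrightarrow> real (size_cost n) \<le> 2 + log 2 (real n)"
  by (simp add: size_cost_def floorlog_def)

text \<open>
  With \<open>D\<close> rounds of adding neighbours, \<open>L\<close> bounds the number of candidates and of loop iterations, and
  no memory cell ever exceeds the number in the third inequality.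
\<close>

lemma polynomial_bounds:
  fixes n d t k D C :: nat
  assumes n: "1 \<le> n"
  defines "N \<equiv> log 2 (real n) + real d + real t + 2"
    and "L \<equiv> (1 + t * k) * (1 + d) ^ D + t + d"
  shows "2 \<le> N" and "real (L + 1) \<le> N ^ (6 + k + D + C)"
    and "real (size_cost (n + L + (1 + (t + 1) * (k + 1)) + C)) \<le> N ^ (6 + k + D + C)"
proof -
  define a where "a = 3 + k + D + C"
  have log: "0 \<le> log 2 (real n)" using n by simp
  then show N: "2 \<le> N" by (simp add: N_def)
  have N1: "1 \<le> N" using N by simp
  have pow: "N ^ i \<le> N ^ j" if "i \<le> j" for i j using that N by (intro power_increasing) auto
  have t: "real (1 + t) \<le> N" and d: "real (1 + d) \<le> N" and td: "real (t + d + 1) \<le> N"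
    using log by (simp_all add: N_def)
  have k: "real (1 + k) \<le> N ^ (1 + k)" by (rule const_le_power[OF N])
  have tk: "real ((1 + t) * (1 + k)) \<le> N ^ (2 + k)"
  proof -
    have "real (1 + t) * real (1 + k) \<le> N * N ^ (1 + k)" using t k N by (intro mult_mono) auto
    then show ?thesis by (simp add: algebra_simps)
  qed
  have "real ((1 + t * k) * (1 + d) ^ D) \<le> real ((1 + t) * (1 + k)) * real (1 + d) ^ D"
    by (simp only: of_nat_mult of_nat_power of_nat_le_iff flip: of_nat_mult of_nat_power)
      (simp add: mult_right_mono)
  also have "\<dots> \<le> N ^ (2 + k) * N ^ D"
    using tk d N by (intro mult_mono power_mono) auto
  also have "\<dots> = N ^ (2 + k + D)" by (simp add: power_add)
  finally have L1: "real ((1 + t * k) * (1 + d) ^ D) \<le> N ^ (2 + k + D)" .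
  have "real (L + 1) \<le> N ^ (2 + k + D) + N" using L1 td by (simp add: L_def)
  also have "\<dots> \<le> N ^ (2 + k + D) + N ^ (2 + k + D)" using pow[of 1 "2 + k + D"] by simp
  also have "\<dots> \<le> N * N ^ (2 + k + D)" using N by simp
  also have "\<dots> = N ^ (3 + k + D)" by (simp add: numeral_3_eq_3)
  finally have L: "real (L + 1) \<le> N ^ (3 + k + D)" .
  have La: "real (L + 1) \<le> N ^ a" using L pow[of "3 + k + D" a] by (simp add: a_def)
  then show "real (L + 1) \<le> N ^ (6 + k + D + C)" using pow[of a "6 + k + D + C"] by (simp add: a_def)
  have tka: "real ((1 + t) * (1 + k)) \<le> N ^ a" using tk pow[of "2 + k" a] by (simp add: a_def)
  have Ca: "real C \<le> N ^ a" using const_le_power[OF N, of C] pow[of C a] by (simp add: a_def)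
  have Na: "N \<le> N ^ a" using pow[of 1 a] by (simp add: a_def)
  have onea: "1 \<le> N ^ a" using pow[of 0 a] by simp
  let ?rest = "L + (1 + (t + 1) * (k + 1)) + C"
  \<comment> \<open>Only \<open>n\<close> has to be measured by its length. The rest is polynomial
    in the parameters already, so bounding its length by its value is enough.\<close>
  have "size_cost (n + ?rest) \<le> size_cost n + Suc ?rest"
    using size_cost_add[of n ?rest] size_cost_le_Suc[of ?rest] by linarith
  then have "real (size_cost (n + ?rest)) \<le> real (size_cost n) + real (Suc ?rest)"
    by (simp flip: of_nat_add)
  also have "\<dots> \<le> N + (real (L + 1) + 1 + real ((1 + t) * (1 + k)) + real C)"
    using size_cost_le_log[OF n] by (simp add: N_def algebra_simps)
  \<comment> \<open>There are five summands, each at most \<open>N ^ a\<close>. Rounding up to 8,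
    the cube of 2, costs three more in the exponent and turns \<open>3 + k + D + C\<close> into
    \<open>6 + k + D + C\<close>.\<close>
  also have "\<dots> \<le> 8 * N ^ a" using Na La onea tka Ca by linarith
  also have "\<dots> \<le> N ^ 3 * N ^ a"
  proof -
    have "(2 :: real) ^ 3 \<le> N ^ 3" using N by (intro power_mono) auto
    then show ?thesis using onea by (intro mult_right_mono) auto
  qed
  also have "\<dots> = N ^ (6 + k + D + C)" by (simp add: a_def add.assoc flip: power_add)
  finally show "real (size_cost (n + L + (1 + (t + 1) * (k + 1)) + C)) \<le> N ^ (6 + k + D + C)"
    by (simp add: add.assoc)
qed

lemma card_le_degree:
  "finite (univ A) \<Longrightarrow> a \<in> univ A \<Longrightarrow> card (gaifman A `` {a}) \<le> degree A"
  unfolding degree_def by (rule Max_ge) auto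

theorem theorem5p3:
  fixes S :: "'s ring set" and W :: "('w, 's) weights"
    and \<sigma> \<sigma>s :: "'r signature" and X Y :: 'r
    and L :: "('f, 'v, 'r, 'w, 's) logic" and Ls :: "('g, 'v, 'r, 'w, 's) logic"
    and xs ys :: "'v list" and k l r :: nat
    and \<Phi> :: "'f set" and \<Phi>s :: "'g set" and code :: "'g \<Rightarrow> nat"
    and star :: "('r, 'w, 's) wstruct \<Rightarrow> ('r, 'w, 's) wstruct"
    and wop :: "'o \<Rightarrow> 's list \<Rightarrow> 's" and wtest :: "'o \<Rightarrow> 's list \<Rightarrow> bool"
    and f :: "('r, 'w, 's) wstruct \<Rightarrow> real"
  assumes "weight_types S" and "weight_symbols S W"
    and "signature \<sigma>" and "is_logic W L"
    and "distinct (xs @ ys)" and "length xs = k" and "length ys = l"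
    and "formulas_in L \<sigma> (xs @ ys) \<Phi>"
    and "X \<noteq> Y" and "X \<notin> dom \<sigma>s" and "Y \<notin> dom \<sigma>s"
    and "local_precomputation W X Y L \<sigma> xs ys \<Phi> \<sigma>s Ls r \<Phi>s star"
    and "inj_on code \<Phi>s"
    and "model_checking_bound wop wtest Ls (xs @ ys) \<Phi>s
           {star A | A. wstructure W \<sigma> A \<and> encoded A} f"
  shows "\<exists>p e. solves_exact_learning wop wtest W L \<sigma> xs ys \<Phi> Ls \<Phi>s code star p
           (\<lambda>B t. f B * (log 2 (card (univ B)) + degree B + t + 2) ^ e)"
proof -
  \<comment> \<open>The radius of \<open>ex_near_parameters\<close>: at most \<open>l\<close>
    parameters are collected, each at most \<open>2 * r + 1\<close> steps further away.\<close>
  define D where "D = l * (2 * r + 1)"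
  let ?K = "{star A | A. wstructure W \<sigma> A \<and> encoded A}"
  note lp = assms(12)[unfolded local_precomputation_def]
  note lp_star = lp[THEN conjunct2, THEN conjunct2, THEN conjunct2, THEN conjunct2, THEN conjunct2, THEN conjunct1]
  have Ls: "is_logic W Ls" and fin: "finite \<Phi>s" and form: "formulas_in Ls \<sigma>s (xs @ ys) \<Phi>s"
    using lp by simp_all
  have loc: "r_local W Ls \<sigma>s r \<psi>" if "\<psi> \<in> \<Phi>s" for \<psi>
    using lp[THEN conjunct2, THEN conjunct2, THEN conjunct2, THEN conjunct2, THEN conjunct1] that by (rule bspec)
  have star: "wstructure W \<sigma>s (star A)" "univ (star A) = univ A" if "wstructure W \<sigma> A" for A
    using lp_star[rule_format, OF that] by simp_all
  have trans: "\<exists>\<psi>\<in>\<Phi>s. \<forall>as\<in>tuples (length xs) (univ A). \<forall>bs\<in>tuples (length ys) (univ A).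
           models L A \<phi> (xs @ ys) (as @ bs) \<longleftrightarrow> models Ls (star A) \<psi> (xs @ ys) (as @ bs)"
    if "wstructure W \<sigma> A" "\<phi> \<in> \<Phi>" for A \<phi>
    using lp_star[THEN spec, THEN mp, OF that(1), THEN conjunct2, THEN conjunct2] that(2) by (rule bspec)
  have fv: "\<exists>\<Delta>. fv_decomposition W X Y Ls \<sigma>s \<Phi>s \<psi> z z' \<Delta>"
    if "\<psi> \<in> \<Phi>s" "z \<union> z' = free Ls \<psi>" "z \<inter> z' = {}" for \<psi> z z'
    using lp[THEN conjunct2, THEN conjunct2, THEN conjunct2, THEN conjunct2, THEN conjunct2, THEN conjunct2, THEN conjunct1, rule_format, OF that] .
  have neg: "\<exists>\<chi>\<in>\<Phi>s. equivalent W \<sigma>s (\<lambda>A. sat Ls A \<chi>) (\<lambda>A s. \<not> sat Ls A \<psi> s)"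
    if "\<psi> \<in> \<Phi>s" for \<psi>
    using lp[THEN conjunct2, THEN conjunct2, THEN conjunct2, THEN conjunct2, THEN conjunct2, THEN conjunct2, THEN conjunct2, THEN conjunct1, rule_format, OF that] .
  have disj: "\<exists>\<chi>\<in>\<Phi>s. equivalent W \<sigma>s (\<lambda>A. sat Ls A \<chi>) (\<lambda>A s. sat Ls A \<psi>1 s \<or> sat Ls A \<psi>2 s)"
    if "\<psi>1 \<in> \<Phi>s" "\<psi>2 \<in> \<Phi>s" for \<psi>1 \<psi>2
    using lp[THEN conjunct2, THEN conjunct2, THEN conjunct2, THEN conjunct2, THEN conjunct2, THEN conjunct2, THEN conjunct2, THEN conjunct2, rule_format, OF that] .
  obtain \<psi>s where \<psi>s: "set \<psi>s = \<Phi>s" using finite_list[OF fin] by blast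
  note mc = assms(14)[unfolded model_checking_bound_def]
  have f1: "1 \<le> f B" if "B \<in> ?K" for B using mc[THEN conjunct1] that by (rule bspec)
  \<comment> \<open>One program per formula, uniform over all structures in \<open>?K\<close>; only
    therefore can it be a constant part of the learner.\<close>
  obtain prog :: "'g \<Rightarrow> ('r, 'w, 'o) com" where prog: "\<forall>\<psi>\<in>\<Phi>s. \<forall>B\<in>?K.
      \<forall>cs\<in>tuples (length (xs @ ys)) (univ B). \<exists>c m. exec wop wtest B (prog \<psi>) (initial cs) c m \<and>
        real c \<le> f B \<and> mem m 0 0 = of_bool (models Ls B \<psi> (xs @ ys) cs)"
    using bchoice[OF mc[THEN conjunct2]] ..
  define p where "p = learner k l D (map (\<lambda>\<psi>. (code \<psi>, prog \<psi>)) \<psi>s)"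
  \<comment> \<open>Exceeds every code of a formula and depends on \<open>\<Phi>s\<close>
    alone.\<close>
  define C where "C = Suc (\<Sum>\<psi>\<in>\<Phi>s. code \<psi>)"
  \<comment> \<open>Program and exponent are fixed here, before any structure or training sequence
    is considered.\<close>
  obtain e where e: "\<forall>s L G (N :: real). 2 \<le> N \<longrightarrow> 1 \<le> G \<longrightarrow> real s \<le> N ^ (6 + k + D + C) \<longrightarrow>
      real (L + 1) \<le> N ^ (6 + k + D + C) \<longrightarrow> com_cost s L G p \<le> G * N ^ e"
    using com_cost_polynomial[of "6 + k + D + C" p] ..
  have "\<exists>c m. exec wop wtest (star A) p (initial (encode_training T)) c m \<and>
      real c \<le> f (star A) * (log 2 (card (univ (star A))) + degree (star A) + length T + 2) ^ e \<and>
      (if rejects m then \<not> (\<exists>h\<in>concept_class L \<Phi> A xs ys. consistent h T)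
       else \<exists>\<psi>\<in>\<Phi>s. \<exists>vs\<in>tuples (length ys) (univ A). returns code m \<psi> vs \<and>
              consistent (\<lambda>as. models Ls (star A) \<psi> (xs @ ys) (as @ vs)) T)"
    if A: "wstructure W \<sigma> A" and enc: "encoded A"
      and hT: "set T \<subseteq> tuples (length xs) (univ A) \<times> UNIV" for A T
  proof -
    define B where "B = star A"
    define n where "n = card (univ B)"
    define d where "d = degree B"
    define t where "t = length T"
    define Lb where "Lb = (1 + t * k) * (1 + d) ^ D + t + d"
    \<comment> \<open>The four summands cover the elements, the counters and list lengths, the
      positions in the input, and the codes in the output.\<close>
    define M where "M = n + Lb + (1 + (t + 1) * (k + 1)) + C"
    define N where "N = log 2 (real n) + real d + real t + 2"
    define H where "H = (\<lambda>\<psi>. models Ls B \<psi> (xs @ ys))"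
    have BK: "B \<in> ?K" using A enc by (auto simp: B_def)
    have B: "wstructure W \<sigma>s B" and uB: "univ B = univ A" using star[OF A] by (auto simp: B_def)
    then have pB: "prestructure W \<sigma>s B" by (simp add: wstructure_def)
    have finB: "finite (univ B)" and neB: "univ B \<noteq> {}" using prestructureD(1,2)[OF pB] by auto
    have univ: "univ B = {..<n}" using enc unfolding encoded_def n_def uB .
    have n: "1 \<le> n" using finB neB by (simp add: n_def Suc_le_eq card_gt_0_iff)
    interpret learning_ram wop wtest B M Lb "f B" T k l \<psi>s code prog H
    proof unfold_locales
      show "1 \<le> M" using n by (simp add: M_def)
      show "0 \<le> f B" using f1[OF BK] by simp
      show "gaifman B \<subseteq> univ B \<times> univ B" by (rule gaifman_subset[OF pB])
      show "a \<le> M" if "a \<in> univ B" for a using that univ by (simp add: M_def)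
      show "card (gaifman B `` {a}) \<le> Lb" if "a \<in> univ B" for a
        using card_le_degree[OF finB that] by (simp add: Lb_def d_def)
      show "0 \<in> univ B" using univ n by simp
      show "as \<in> tuples k (univ B)" if "(as, b) \<in> set T" for as b
        using that hT assms(6) uB by auto
      show "1 + (length T + 1) * (k + 1) \<le> M" by (simp add: M_def t_def)
      show "\<exists>c m. exec wop wtest B (prog \<psi>) (initial cs) c m \<and> real c \<le> f B \<and>
          mem m 0 0 = of_bool (H \<psi> cs)" if "\<psi> \<in> set \<psi>s" "cs \<in> tuples (k + l) (univ B)" for \<psi> cs
      proof -
        have "cs \<in> tuples (length (xs @ ys)) (univ B)" using that(2) assms(6,7) by simp
        then show ?thesis unfolding H_def using prog BK that(1) \<psi>s by blast
      qed
      show "Suc (code \<psi>) \<le> M" if "\<psi> \<in> set \<psi>s" for \<psi>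
        using member_le_sum[of \<psi> \<Phi>s code] that fin \<psi>s by (simp add: M_def C_def)
    qed (use finB in \<open>auto simp: Lb_def M_def t_def\<close>)
    define ps0 where "ps0 = 0 # concat (map fst T)"
    define ps where "ps = (expand B ^^ D) ps0"
    have len_T: "length (concat (map fst T')) = length T' * k" if "set T' \<subseteq> set T" for T'
      using that
    proof (induction T')
      case (Cons x T')
      then show ?case using T[of "fst x" "snd x"]
        by (auto simp: tuples_def)
    qed simp
    have ps0: "set ps0 \<subseteq> univ B" using hT uB zero_in by (fastforce simp: ps0_def tuples_def)
    have pow: "1 \<le> (1 + d) ^ D" by simp
    have len0: "1 + length T * k \<le> Lb"
    proof -
      have "(1 + t * k) * 1 \<le> (1 + t * k) * (1 + d) ^ D" using pow by (rule mult_le_mono2)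
      then show ?thesis by (simp add: Lb_def t_def)
    qed
    have "length ps \<le> length ps0 * (1 + d) ^ D"
      unfolding ps_def by (rule length_expand_power[OF _ ps0]) (simp add: d_def card_le_degree[OF finB])
    also have "length ps0 = 1 + t * k" using len_T[of T] by (simp add: ps0_def t_def)
    finally have len: "length ps \<le> Lb" by (simp add: Lb_def)
    obtain c m where c: "exec wop wtest B p (initial (encode_training T)) c m"
      "real c \<le> com_cost (size_cost M) Lb (f B) p"
      "if rejects m then \<not> (\<exists>\<psi>\<in>\<Phi>s. \<exists>us. length us = l \<and> set us \<subseteq> set ps \<and> fits T (H \<psi>) us)
       else \<exists>\<psi>\<in>\<Phi>s. \<exists>us\<in>tuples l (univ B). returns code m \<psi> us \<and> fits T (H \<psi>) us"
      using runs_learner[of D, folded ps0_def, folded ps_def, OF len0 len]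
      unfolding runs_def \<psi>s p_def by blast
    have fits: "fits T (H \<psi>) us \<longleftrightarrow> consistent (\<lambda>as. models Ls B \<psi> (xs @ ys) (as @ us)) T" for \<psi> us
      by (simp add: fits_def consistent_def H_def)
    have "com_cost (size_cost M) Lb (f B) p \<le> f B * N ^ e"
      using polynomial_bounds(1)[of n d t, OF n] polynomial_bounds(2,3)[of n t k d D C, OF n] f1[OF BK]
      unfolding M_def Lb_def N_def by (intro e[rule_format])
    then have "real c \<le> f B * (log 2 (card (univ B)) + degree B + length T + 2) ^ e"
      using c(2) by (simp add: N_def n_def d_def t_def)
    moreover have "\<not> (\<exists>h\<in>concept_class L \<Phi> A xs ys. consistent h T)" if rej: "rejects m"
    proof
      assume "\<exists>h\<in>concept_class L \<Phi> A xs ys. consistent h T"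
      then obtain \<phi> vs where \<phi>: "\<phi> \<in> \<Phi>" and vs: "vs \<in> tuples (length ys) (univ A)"
        and con: "consistent (\<lambda>as. models L A \<phi> (xs @ ys) (as @ vs)) T"
        by (auto simp: concept_class_def)
      obtain \<psi> where \<psi>: "\<psi> \<in> \<Phi>s" and eq: "\<And>as. as \<in> tuples (length xs) (univ A) \<Longrightarrow>
          models L A \<phi> (xs @ ys) (as @ vs) \<longleftrightarrow> models Ls B \<psi> (xs @ ys) (as @ vs)"
        using trans[OF A \<phi>] vs unfolding B_def by blast
      have fst_T: "fst ` set T \<subseteq> tuples (length xs) (univ B)" using hT uB by auto
      have vs_B: "vs \<in> tuples (length ys) (univ B)" using vs uB by simp
      \<comment> \<open>The substitute for far parameters is 0: it belongs to the universe since the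
        structure is encoded, and it heads the list of candidates.\<close>
      have "\<exists>\<chi>\<in>\<Phi>s. \<exists>us\<in>tuples (length ys) (univ B).
        (\<forall>u\<in>set us. u = 0 \<or>
          (\<exists>z\<in>\<Union> (set ` fst ` set T). \<exists>i\<le>length ys * (2 * r + 1). (z, u) \<in> gaifman B ^^ i)) \<and>
        (\<forall>as\<in>fst ` set T. models Ls B \<chi> (xs @ ys) (as @ us) \<longleftrightarrow> models Ls B \<psi> (xs @ ys) (as @ vs))"
        by (rule ex_near_parameters[OF Ls B _ assms(9-11) form assms(5) _ _ _ _ \<psi> vs_B fst_T zero_in])
          (rule weight_symbols_zero[OF assms(1,2)] loc fv neg disj; assumption)+
      then obtain \<chi> us where \<chi>: "\<chi> \<in> \<Phi>s" and us: "us \<in> tuples (length ys) (univ B)"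
        and near: "\<forall>u\<in>set us. u = 0 \<or>
          (\<exists>z\<in>\<Union> (set ` fst ` set T). \<exists>i\<le>length ys * (2 * r + 1). (z, u) \<in> gaifman B ^^ i)"
        and same: "\<forall>as\<in>fst ` set T.
          models Ls B \<chi> (xs @ ys) (as @ us) \<longleftrightarrow> models Ls B \<psi> (xs @ ys) (as @ vs)"
        by (elim bexE conjE)
      have near_ps: "u \<in> set ps" if "u \<in> set us" for u
      proof -
        obtain z i where "z \<in> set ps0" "(z, u) \<in> gaifman B ^^ i" "i \<le> D"
        proof (cases "u = 0")
          case True
          then show ?thesis using that[of 0 0] by (simp add: ps0_def)
        next
          case False
          then obtain z i where "z \<in> \<Union> (set ` fst ` set T)" "i \<le> length ys * (2 * r + 1)"
            "(z, u) \<in> gaifman B ^^ i" using bspec[OF near \<open>u \<in> set us\<close>] by blast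
          then show ?thesis using that[of z i] assms(7) by (auto simp: ps0_def D_def)
        qed
        then show ?thesis unfolding ps_def by (rule expand_power_reaches)
      qed
      have "fits T (H \<chi>) us"
        unfolding fits consistent_def
      proof (intro ballI, clarify)
        fix as b
        assume asb: "(as, b) \<in> set T"
        then have as: "as \<in> fst ` set T" "as \<in> tuples (length xs) (univ A)" using hT by force+
        have "models L A \<phi> (xs @ ys) (as @ vs) = b" using con asb unfolding consistent_def by blast
        then show "models Ls B \<chi> (xs @ ys) (as @ us) = b" using eq[OF as(2)] bspec[OF same as(1)] by simp
      qed
      moreover have "length us = l" "set us \<subseteq> set ps" using us assms(7) near_ps by (auto simp: tuples_def)
      ultimately show False using c(3) rej \<chi> by auto
    qed
    ultimately show ?thesis
      using c(1,3) assms(7) unfolding fits uB B_def[symmetric]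
      by (intro exI[of _ c] exI[of _ m]) (simp split: if_splits)
  qed
  then show ?thesis unfolding solves_exact_learning_def by blast
qed

end
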